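(* Let $k\ge 1$ and $n\ge 2$ be integers and let $\lambda$ be a partition of $n$. Then the multiplicity of the irreducible character $\chi^\lambda$ of $S_n$ in the $k$-th Kronecker power of $\chi^{(n-1,1)}$ equals the number of Kronecker tableaux of length $k$, initial shape $(n)$ and final shape $\lambda$: $${\chi^{(n-1,1)}}^{\otimes k}\big|_{\chi^\lambda}=\left|KT^k_{(n),\lambda}\right|.$$
   Context: $\chi^\lambda$ denotes the irreducible character of the symmetric group $S_n$ indexed by $\lambda\vdash n$; $\chi^{\otimes k}$ is the $k$-th Kronecker (pointwise) power, and $\chi|_{\chi^\lambda}$ is the multiplicity of $\chi^\lambda$ in the character $\chi$. Partitions are identified with their Ferrers diagrams (French notation: rows stacked from bottom to top, the $i$-th row from the bottom containing $\lambda_i$ cells, $\lambda_1\ge\lambda_2\ge\cdots$). A corner of a diagram is a cell located at the right end of a row and having no cell above it. The first corner of a diagram is its unique corner located on a row of longest length. A diagram $\lambda'\neq\lambda$ differs from $\lambda$ by the position of a corner if $\lambda'$ is obtained from $\lambda$ by removing a corner and then adding a new cell that becomes a corner of the new diagram. Given a positive integer $k$ and partitions $\mu,\lambda$ of the same weight, a Kronecker tableau of length $k$, initial shape $\mu$ and final shape $\lambda$ is a sequence $\mu^0=\mu,\mu^1,\ldots,\mu^k=\lambda$ of Ferrers diagrams such that for every pair of consecutive diagrams $\mu^i,\mu^{i+1}$, either $\mu^{i+1}$ differs from $\mu^i$ by the position of a corner, or $\mu^{i+1}=\mu^i$ and one corner of $\mu^{i+1}$, other than its first corner, is distinguished (the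 choice of distinguished corner is part of the data). $KT^k_{\mu,\lambda}$ is the set of these Kronecker tableaux. *)

theory Defs
  imports Complex_Main "HOL-Library.Function_Algebras" "HOL-Combinatorics.Permutations"
begin

text \<open>
  A partition is the weakly decreasing list of its positive parts. Cells of a Ferrers diagram are
  pairs (row, column), both counted from 0, with row 0 at the bottom (French notation).
\<close>

definition is_partition :: "nat \<Rightarrow> nat list \<Rightarrow> bool" where
  "is_partition n lam \<longleftrightarrow>
     sorted_wrt (\<ge>) lam \<and> (\<forall>x\<in>set lam. 0 < x) \<and> sum_list lam = n"

definition ferrers :: "nat list \<Rightarrow> (nat \<times> nat) set" where
  "ferrers lam = {(i, j). i < length lam \<and> j < lam ! i}"

subsection \<open>Irreducible characters of the symmetric group\<close>

definition cscale :: "complex \<Rightarrow> ('a \<Rightarrow> complex) \<Rightarrow> ('a \<Rightarrow> complex)" where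
  "cscale c f = (\<lambda>x. c * f x)"

interpretation cfun: vector_space "cscale :: complex \<Rightarrow> ('a \<Rightarrow> complex) \<Rightarrow> ('a \<Rightarrow> complex)"
  by unfold_locales (auto simp: cscale_def algebra_simps)

text \<open>
  The value does not depend on the chosen basis. It is meant for finite-dimensional subspaces
  that are invariant under the linear map.
\<close>

definition trace_on :: "('a \<Rightarrow> complex) set \<Rightarrow> (('a \<Rightarrow> complex) \<Rightarrow> ('a \<Rightarrow> complex)) \<Rightarrow> complex" where
  "trace_on V T =
     (let B = (SOME B. cfun.independent B \<and> cfun.span B = V)
      in \<Sum>b\<in>B. cfun.representation B (T b) b)"

text \<open>
  The symmetric group on n letters consists of the permutations of \<open>{..<n}\<close>, multiplied by
  composition. An element of its complex group algebra is the function giving its coefficients,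
  so left multiplication by a group element is the following translation.
\<close>

definition left_mult ::
    "(nat \<Rightarrow> nat) \<Rightarrow> ((nat \<Rightarrow> nat) \<Rightarrow> complex) \<Rightarrow> ((nat \<Rightarrow> nat) \<Rightarrow> complex)" where
  "left_mult g x = (\<lambda>h. x (inv g \<circ> h))"

text \<open>The canonical tableau, filled with 0, 1, 2, ... row by row.\<close>

definition tableau_entry :: "nat list \<Rightarrow> nat \<times> nat \<Rightarrow> nat" where
  "tableau_entry lam c = sum_list (take (fst c) lam) + snd c"

definition row_group :: "nat list \<Rightarrow> (nat \<Rightarrow> nat) set" where
  "row_group lam = {p. p permutes {..<sum_list lam} \<and>
     (\<forall>i. let R = tableau_entry lam ` {c \<in> ferrers lam. fst c = i} in p ` R = R)}"

definition column_group :: "nat list \<Rightarrow> (nat \<Rightarrow> nat) set" where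
  "column_group lam = {q. q permutes {..<sum_list lam} \<and>
     (\<forall>j. let C = tableau_entry lam ` {c \<in> ferrers lam. snd c = j} in q ` C = C)}"

text \<open>
  The Young symmetrizer: the product of the sum of all p in the row group and the sum of all
  \<open>sign q\<close> times q with q in the column group.
\<close>

definition young_symmetrizer :: "nat list \<Rightarrow> (nat \<Rightarrow> nat) \<Rightarrow> complex" where
  "young_symmetrizer lam =
     (\<lambda>g. \<Sum>p\<in>row_group lam. \<Sum>q\<in>column_group lam.
        if g = p \<circ> q then of_int (sign q) else 0)"

text \<open>
  The left ideal generated by the Young symmetrizer. This is the irreducible module indexed by
  \<open>lam\<close> (isomorphic to the Specht module), in the convention where the one-row partition gives
  the trivial module and the one-column partition the sign module.
\<close>

definition irr_module :: "nat list \<Rightarrow> ((nat \<Rightarrow> nat) \<Rightarrow> complex) set" where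
  "irr_module lam =
     cfun.span {left_mult g (young_symmetrizer lam) |g. g permutes {..<sum_list lam}}"

definition irr_char :: "nat list \<Rightarrow> (nat \<Rightarrow> nat) \<Rightarrow> complex" where
  "irr_char lam g = trace_on (irr_module lam) (left_mult g)"

definition kronecker_power ::
    "((nat \<Rightarrow> nat) \<Rightarrow> complex) \<Rightarrow> nat \<Rightarrow> ((nat \<Rightarrow> nat) \<Rightarrow> complex)" where
  "kronecker_power X k = (\<lambda>g. X g ^ k)"

text \<open>
  The multiplicity of the irreducible character of \<open>lam\<close> in the character X: its coefficient in
  the unique expression of X as a sum of irreducible characters.
\<close>

definition char_multiplicity :: "nat \<Rightarrow> ((nat \<Rightarrow> nat) \<Rightarrow> complex) \<Rightarrow> nat list \<Rightarrow> nat" where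
  "char_multiplicity n X lam =
     (THE m. \<exists>a :: nat list \<Rightarrow> nat. a lam = m \<and>
        (\<forall>g. g permutes {..<n} \<longrightarrow>
           X g = (\<Sum>mu | is_partition n mu. of_nat (a mu) * irr_char mu g)))"

subsection \<open>Kronecker tableaux\<close>

definition corners :: "nat list \<Rightarrow> (nat \<times> nat) set" where
  "corners lam = {(i, j) \<in> ferrers lam. (i, Suc j) \<notin> ferrers lam \<and> (Suc i, j) \<notin> ferrers lam}"

definition is_first_corner :: "nat list \<Rightarrow> nat \<times> nat \<Rightarrow> bool" where
  "is_first_corner lam c \<longleftrightarrow>
     c \<in> corners lam \<and> (\<forall>i<length lam. lam ! i \<le> lam ! fst c)"

definition differs_by_corner :: "nat list \<Rightarrow> nat list \<Rightarrow> bool" where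
  "differs_by_corner lam lam' \<longleftrightarrow> lam' \<noteq> lam \<and>
     (\<exists>c\<in>corners lam. \<exists>c'\<in>corners lam'.
        c' \<notin> ferrers lam - {c} \<and> ferrers lam' = insert c' (ferrers lam - {c}))"

text \<open>
  A tableau of length k is a list of k + 1 shapes together with a list of k marks: the mark of a
  step is \<open>None\<close> if the shape changes, and \<open>Some\<close> of the distinguished corner if it does not.
\<close>

definition kronecker_step :: "nat list \<Rightarrow> (nat \<times> nat) option \<Rightarrow> nat list \<Rightarrow> bool" where
  "kronecker_step lam d lam' \<longleftrightarrow>
     (case d of
        None \<Rightarrow> differs_by_corner lam lam'
      | Some c \<Rightarrow> lam' = lam \<and> c \<in> corners lam' \<and> \<not> is_first_corner lam' c)"

definition kronecker_tableaux ::
    "nat \<Rightarrow> nat list \<Rightarrow> nat list \<Rightarrow> (nat list list \<times> (nat \<times> nat) option list) set" where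
  "kronecker_tableaux k mu lam =
     {(s, d). length s = Suc k \<and> length d = k \<and> s ! 0 = mu \<and> s ! k = lam \<and>
        (\<forall>i\<le>k. is_partition (sum_list mu) (s ! i)) \<and>
        (\<forall>i<k. kronecker_step (s ! i) (d ! i) (s ! Suc i))}"

end

(*
  Restricting the Young symmetrizer c of a diagram D to the permutations fixing the largest letter,
  when that letter sits in a corner, gives the Young symmetrizer c' of the smaller diagram E.
  Hence c * c' is nonzero and the character of D, restricted to the smaller group, contains that of E.
  So the degree of D is at least the number of standard tableaux of D.  The squares of the degrees
  sum to at most n! by Bessel's inequality, the squares of the numbers of standard tableaux sum to n!
  because up- and down-steps in Young's lattice commute up to the identity.  Everything is therefore
  an equality: this gives completeness of the characters and the branching rule at the same time.
  Restricting and inducing shows that multiplying by the number of fixed points, which is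
  1 + chi^(n-1,1), amounts to removing a corner and adding a cell, and iteration counts tableaux.
*)
theory Submission imports Defs begin

section \<open>Convolution on symmetric groups\<close>

text \<open>Modules occur only as left ideals A e of the group algebra A, with e a rescaled Young
  symmetrizer. A multiplicity occurs as the trace of v \<mapsto> e v f. For idempotents this map is
  a projection, so the trace is the dimension of e A f: a natural number, and at least 1 as soon as
  the single element e f is nonzero. That is why one coefficient, computed at the identity, yields a
  lower bound for branching. The obstacle is that such computations give lower bounds only: they do
  not exclude further constituents of a restriction, nor further class functions beyond the span of
  the characters found. The count of squares closes both gaps at once. The identity term in the
  commutation of up- and down-steps comes from every diagram having one more addable than removable
  cell. The exclusion of the first corner mirrors the trivial character in 1 + chi^(n-1,1): going
  down and up again returns to the same diagram in as many ways as it has corners, and subtracting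
  the trivial character discounts one of them.\<close>

definition Sym :: "nat \<Rightarrow> (nat \<Rightarrow> nat) set" where
  "Sym n = {p. p permutes {..<n}}"

lemma finite_Sym [simp]: "finite (Sym n)"
  by (simp add: Sym_def finite_permutations)

lemma card_Sym: "card (Sym n) = fact n"
  unfolding Sym_def by (rule card_permutations) auto

lemma id_in_Sym [simp]: "id \<in> Sym n"
  by (simp add: Sym_def permutes_id)

lemma comp_in_Sym: "p \<in> Sym n \<Longrightarrow> q \<in> Sym n \<Longrightarrow> p \<circ> q \<in> Sym n"
  by (simp add: Sym_def permutes_compose)

lemma inv_in_Sym: "p \<in> Sym n \<Longrightarrow> inv p \<in> Sym n"
  by (simp add: Sym_def permutes_inv)

lemma Sym_mono: "m \<le> n \<Longrightarrow> p \<in> Sym m \<Longrightarrow> p \<in> Sym n"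
  unfolding Sym_def by (auto intro: permutes_subset)

lemma Sym_bij: "p \<in> Sym n \<Longrightarrow> bij p"
  by (simp add: Sym_def permutes_bij)

lemma Sym_lt: "p \<in> Sym n \<Longrightarrow> p x < n \<longleftrightarrow> x < n"
  using permutes_in_image[of p "{..<n}" x] by (simp add: Sym_def)

lemma bij_inv_comp:
  assumes "bij p"
  shows "inv p \<circ> p = id" "p \<circ> inv p = id" "inv p \<circ> (p \<circ> x) = x" "p \<circ> (inv p \<circ> y) = y"
        "inv (inv p) = p"
  using assms by (auto simp: fun_eq_iff bij_is_inj bij_is_surj surj_f_inv_f inv_inv_eq)

lemmas perm_simps = o_inv_distrib bij_comp bij_imp_bij_inv bij_inv_comp comp_assoc

lemma Sym_cancel_left: "p \<in> Sym n \<Longrightarrow> p \<circ> g \<in> Sym n \<longleftrightarrow> g \<in> Sym n"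
  using comp_in_Sym[of "inv p" n "p \<circ> g"] inv_in_Sym[of p n] comp_in_Sym[of p n g] Sym_bij[of p n]
  by (auto simp: perm_simps)

lemma sum_Sym_inv: "(\<Sum>h\<in>Sym n. f (inv h)) = (\<Sum>h\<in>Sym n. f h)"
  by (rule sum.reindex_bij_witness[of _ inv inv]) (auto simp: inv_in_Sym perm_simps Sym_bij)

lemma sum_Sym_left:
  assumes k: "k \<in> Sym n" shows "(\<Sum>h\<in>Sym n. f (k \<circ> h)) = (\<Sum>h\<in>Sym n. f h)"
  using k by (intro sum.reindex_bij_witness[of _ "\<lambda>h. inv k \<circ> h" "\<lambda>h. k \<circ> h"])
    (auto simp: inv_in_Sym comp_in_Sym perm_simps Sym_bij)

lemma sum_Sym_right:
  assumes k: "k \<in> Sym n" shows "(\<Sum>h\<in>Sym n. f (h \<circ> k)) = (\<Sum>h\<in>Sym n. f h)"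
  using k by (intro sum.reindex_bij_witness[of _ "\<lambda>h. h \<circ> inv k" "\<lambda>h. h \<circ> k"])
    (auto simp: inv_in_Sym comp_in_Sym perm_simps Sym_bij)

lemma sum_Sym_conj:
  assumes k: "k \<in> Sym n" shows "(\<Sum>h\<in>Sym n. f (k \<circ> h \<circ> inv k)) = (\<Sum>h\<in>Sym n. f h)"
proof -
  have "(\<Sum>h\<in>Sym n. f (k \<circ> h \<circ> inv k)) = (\<Sum>h\<in>Sym n. f (k \<circ> (h \<circ> inv k)))" by (simp add: comp_assoc)
  also have "\<dots> = (\<Sum>h\<in>Sym n. f (k \<circ> h))" by (rule sum_Sym_right) (use k in \<open>simp add: inv_in_Sym\<close>)
  finally show ?thesis using sum_Sym_left[OF k] by simp
qed

lemma sum_Sym_conj':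
  assumes k: "k \<in> Sym n" shows "(\<Sum>h\<in>Sym n. f (inv k \<circ> h \<circ> k)) = (\<Sum>h\<in>Sym n. f h)"
  using sum_Sym_conj[OF inv_in_Sym[OF k], of f] Sym_bij[OF k] by (simp add: perm_simps)

section \<open>The group algebra as functions under convolution\<close>

type_synonym galg = "(nat \<Rightarrow> nat) \<Rightarrow> complex"

definition conv :: "nat \<Rightarrow> galg \<Rightarrow> galg \<Rightarrow> galg" where
  "conv n x y = (\<lambda>g. \<Sum>h\<in>Sym n. x h * y (inv h \<circ> g))"

text \<open>Elements are functions on all of \<open>nat \<Rightarrow> nat\<close>, so belonging to
  the algebra means vanishing off \<open>Sym n\<close>. Permutations of fewer letters are the same
  functions; hence for m \<le> n \<open>GA m\<close> lies in \<open>GA n\<close> literally, and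
  restriction needs no embedding map.\<close>

definition GA :: "nat \<Rightarrow> galg set" where
  "GA n = {x. \<forall>g. g \<notin> Sym n \<longrightarrow> x g = 0}"

definition delta :: "'a \<Rightarrow> 'a \<Rightarrow> complex" where
  "delta k = (\<lambda>g. if g = k then 1 else 0)"

lemma GA_zero: "x \<in> GA n \<Longrightarrow> g \<notin> Sym n \<Longrightarrow> x g = 0"
  by (simp add: GA_def)

lemma GA_eqI: "x \<in> GA n \<Longrightarrow> y \<in> GA n \<Longrightarrow> (\<And>g. g \<in> Sym n \<Longrightarrow> x g = y g) \<Longrightarrow> x = y"
  by (rule ext) (metis GA_zero)

lemma GA_mono: "m \<le> n \<Longrightarrow> x \<in> GA m \<Longrightarrow> x \<in> GA n"
  by (auto simp: GA_def dest: Sym_mono)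

lemma conv_GA: "y \<in> GA n \<Longrightarrow> conv n x y \<in> GA n"
  by (auto simp: GA_def conv_def Sym_cancel_left inv_in_Sym)

lemma conv_assoc: "conv n (conv n x y) z = conv n x (conv n y z)"
proof
  fix g
  have "conv n x (conv n y z) g = (\<Sum>k\<in>Sym n. \<Sum>h\<in>Sym n. x k * (y h * z (inv h \<circ> (inv k \<circ> g))))"
    by (simp add: conv_def sum_distrib_left)
  also have "\<dots> = (\<Sum>k\<in>Sym n. \<Sum>h\<in>Sym n. x k * (y (inv k \<circ> h) * z (inv (inv k \<circ> h) \<circ> (inv k \<circ> g))))"
    by (intro sum.cong refl sum_Sym_left[symmetric] inv_in_Sym)
  also have "\<dots> = (\<Sum>k\<in>Sym n. \<Sum>h\<in>Sym n. x k * (y (inv k \<circ> h) * z (inv h \<circ> g)))"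
    by (intro sum.cong refl) (simp add: perm_simps Sym_bij)
  also have "\<dots> = conv n (conv n x y) z g"
    by (subst sum.swap) (simp add: conv_def sum_distrib_right mult.assoc)
  finally show "conv n (conv n x y) z g = conv n x (conv n y z) g" by simp
qed

lemma conv_alt:
  assumes g: "g \<in> Sym n"
  shows "conv n x y g = (\<Sum>k\<in>Sym n. x (g \<circ> inv k) * y k)"
proof -
  have "(\<Sum>k\<in>Sym n. x (g \<circ> inv k) * y k) = (\<Sum>k\<in>Sym n. x (g \<circ> k) * y (inv k))"
    by (subst sum_Sym_inv[symmetric]) (simp add: perm_simps Sym_bij)
  also have "\<dots> = (\<Sum>k\<in>Sym n. x (g \<circ> (inv g \<circ> k)) * y (inv (inv g \<circ> k)))"
    by (rule sum_Sym_left[symmetric]) (simp add: g inv_in_Sym)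
  also have "\<dots> = conv n x y g"
    unfolding conv_def by (intro sum.cong refl) (simp add: perm_simps Sym_bij Sym_bij[OF g])
  finally show ?thesis by simp
qed

lemma conv_delta_left: "k \<in> Sym n \<Longrightarrow> conv n (delta k) y = left_mult k y"
  by (rule ext) (simp add: conv_def delta_def left_mult_def if_distrib[of "\<lambda>c. c * _"] cong: if_cong)

lemma conv_cscale_left: "conv n (cscale c x) y = cscale c (conv n x y)"
  by (rule ext) (simp add: conv_def cscale_def sum_distrib_left mult.assoc)

lemma conv_cscale_right: "conv n x (cscale c y) = cscale c (conv n x y)"
  by (rule ext) (simp add: conv_def cscale_def sum_distrib_left mult_ac)

lemma cscale_cscale [simp]: "cscale a (cscale b x) = cscale (a * b) x"
  by (rule ext) (simp add: cscale_def)

lemma cscale_GA: "x \<in> GA n \<Longrightarrow> cscale c x \<in> GA n"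
  by (simp add: GA_def cscale_def)

lemma left_mult_GA: "x \<in> GA n \<Longrightarrow> k \<in> Sym n \<Longrightarrow> left_mult k x \<in> GA n"
  by (simp add: GA_def left_mult_def Sym_cancel_left inv_in_Sym)

lemma conv_restrict:
  assumes "m \<le> n" "x \<in> GA m" shows "conv n x y = conv m x y"
  unfolding conv_def
  by (rule ext, rule sum.mono_neutral_right) (use assms in \<open>auto simp: GA_zero dest: Sym_mono\<close>)

text \<open>The unnormalised conjugation average. For an idempotent x it is the character of the
  left ideal generated by x, read at the inverse: the coefficient of h in k h x, summed over h, is
  the value at \<open>inv k\<close>.\<close>

definition cl :: "nat \<Rightarrow> galg \<Rightarrow> galg" where
  "cl n x = (\<lambda>g. \<Sum>h\<in>Sym n. x (inv h \<circ> g \<circ> h))"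

lemma cl_cscale: "cl n (cscale c x) g = c * cl n x g"
  by (simp add: cl_def cscale_def sum_distrib_left)

lemma cl_conj: "k \<in> Sym n \<Longrightarrow> cl n x (inv k \<circ> g \<circ> k) = cl n x g"
proof -
  assume k: "k \<in> Sym n"
  have "cl n x (inv k \<circ> g \<circ> k) = (\<Sum>h\<in>Sym n. x (inv (k \<circ> h) \<circ> g \<circ> (k \<circ> h)))"
    unfolding cl_def by (intro sum.cong refl) (simp add: perm_simps Sym_bij Sym_bij[OF k])
  also have "\<dots> = cl n x g" unfolding cl_def by (rule sum_Sym_left[OF k])
  finally show ?thesis .
qed

text \<open>The trace property: in the double sum, replacing \<open>h\<close> by
  \<open>h \<circ> inv k\<close> moves the factor \<open>x k\<close> from the left of the product to
  its right.\<close>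

lemma cl_conv_commute:
  assumes g: "g \<in> Sym n"
  shows "cl n (conv n x y) g = cl n (conv n y x) g"
proof -
  have "cl n (conv n x y) g = (\<Sum>k\<in>Sym n. \<Sum>h\<in>Sym n. x k * y (inv k \<circ> (inv h \<circ> g \<circ> h)))"
    by (subst sum.swap) (simp add: cl_def conv_def)
  also have "\<dots> = (\<Sum>k\<in>Sym n. \<Sum>h\<in>Sym n. x k * y (inv k \<circ> (inv (h \<circ> inv k) \<circ> g \<circ> (h \<circ> inv k))))"
    by (intro sum.cong refl sum_Sym_right[symmetric] inv_in_Sym)
  also have "\<dots> = (\<Sum>k\<in>Sym n. \<Sum>h\<in>Sym n. y ((inv h \<circ> g \<circ> h) \<circ> inv k) * x k)"
    by (intro sum.cong refl) (simp add: perm_simps Sym_bij)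
  also have "\<dots> = (\<Sum>h\<in>Sym n. conv n y x (inv h \<circ> g \<circ> h))"
    by (subst sum.swap) (simp add: conv_alt comp_in_Sym inv_in_Sym g)
  finally show ?thesis by (simp add: cl_def)
qed

lemma cl_class_sum:
  assumes F: "\<And>h k. h \<in> Sym n \<Longrightarrow> k \<in> Sym n \<Longrightarrow> F (inv h \<circ> k \<circ> h) = F k"
  shows "(\<Sum>k\<in>Sym n. F k * cl n f k) = fact n * (\<Sum>k\<in>Sym n. F k * f k)"
proof -
  have "(\<Sum>k\<in>Sym n. F k * cl n f k) = (\<Sum>h\<in>Sym n. \<Sum>k\<in>Sym n. F (inv h \<circ> k \<circ> h) * f (inv h \<circ> k \<circ> h))"
    by (subst sum.swap) (simp add: cl_def sum_distrib_left F)
  also have "\<dots> = (\<Sum>h\<in>Sym n. \<Sum>k\<in>Sym n. F k * f k)"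
    by (intro sum.cong refl sum_Sym_conj'[where f = "\<lambda>k. F k * f k"])
  finally show ?thesis by (simp add: card_Sym)
qed

text \<open>On the right stands the trace of v \<mapsto> e v f, the sum over \<open>h\<close> of the
  coefficient of \<open>h\<close> in e h f. For idempotents the left side is \<open>fact m\<close>
  times the inner product of two characters on \<open>Sym m\<close>. Allowing m < n makes one
  identity serve both orthogonality and branching.\<close>

lemma inner_product_trace:
  assumes mn: "m \<le> n" and f: "f \<in> GA m"
  shows "(\<Sum>k\<in>Sym m. cl n e (inv k) * cl m f k) = fact m * (\<Sum>h\<in>Sym n. conv n e (left_mult h f) h)"
proof -
  have "(\<Sum>h\<in>Sym n. conv n e (left_mult h f) h) = (\<Sum>h\<in>Sym n. \<Sum>k\<in>Sym n. e k * f (inv h \<circ> (inv k \<circ> h)))"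
    by (simp add: conv_def left_mult_def)
  \<comment> \<open>Conjugating the inner variable by \<open>h\<close> frees the value of
    \<open>f\<close> from \<open>h\<close>; what is left of the sum over \<open>h\<close> is a class
    average of \<open>e\<close>.\<close>
  also have "\<dots> = (\<Sum>h\<in>Sym n. \<Sum>k\<in>Sym n. e (h \<circ> k \<circ> inv h) * f (inv h \<circ> (inv (h \<circ> k \<circ> inv h) \<circ> h)))"
    by (intro sum.cong refl sum_Sym_conj[symmetric])
  also have "\<dots> = (\<Sum>h\<in>Sym n. \<Sum>k\<in>Sym n. e (h \<circ> inv k \<circ> inv h) * f k)"
    by (rule sum.cong[OF refl], subst sum_Sym_inv[symmetric])
       (intro sum.cong refl, simp add: perm_simps Sym_bij)
  also have "\<dots> = (\<Sum>k\<in>Sym n. f k * (\<Sum>h\<in>Sym n. e (h \<circ> inv k \<circ> inv h)))"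
    by (subst sum.swap) (simp add: sum_distrib_left mult.commute)
  also have "\<dots> = (\<Sum>k\<in>Sym n. f k * cl n e (inv k))"
  proof (intro sum.cong refl arg_cong2[of _ _ _ _ times])
    fix k assume "k \<in> Sym n"
    have "(\<Sum>h\<in>Sym n. e (h \<circ> inv k \<circ> inv h)) = (\<Sum>h\<in>Sym n. e (inv h \<circ> inv k \<circ> inv (inv h)))"
      by (rule sum_Sym_inv[symmetric])
    also have "\<dots> = cl n e (inv k)"
      unfolding cl_def by (intro sum.cong refl) (simp add: perm_simps Sym_bij)
    finally show "(\<Sum>h\<in>Sym n. e (h \<circ> inv k \<circ> inv h)) = cl n e (inv k)" .
  qed
  also have "\<dots> = (\<Sum>k\<in>Sym m. f k * cl n e (inv k))"
    by (rule sum.mono_neutral_right) (use assms in \<open>auto simp: GA_zero dest: Sym_mono\<close>)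
  finally have 1: "(\<Sum>h\<in>Sym n. conv n e (left_mult h f) h) = (\<Sum>k\<in>Sym m. cl n e (inv k) * f k)"
    by (simp add: mult.commute)
  show ?thesis unfolding 1
  proof (rule cl_class_sum)
    fix h k assume h: "h \<in> Sym m" and k: "k \<in> Sym m"
    have "cl n e (inv (inv h \<circ> k \<circ> h)) = cl n e (inv h \<circ> inv k \<circ> h)"
      using h k by (simp add: perm_simps Sym_bij)
    then show "cl n e (inv (inv h \<circ> k \<circ> h)) = cl n e (inv k)"
      using cl_conj[OF Sym_mono[OF mn h]] by simp
  qed
qed

lemma class_central:
  assumes F: "F \<in> GA n" "\<And>h k. h \<in> Sym n \<Longrightarrow> k \<in> Sym n \<Longrightarrow> F (inv h \<circ> k \<circ> h) = F k" and x: "x \<in> GA n"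
  shows "conv n F x = conv n x F"
proof (rule GA_eqI[of _ n])
  fix g assume g: "g \<in> Sym n"
  have "conv n F x g = (\<Sum>k\<in>Sym n. F (g \<circ> inv k) * x k)" by (rule conv_alt[OF g])
  also have "\<dots> = (\<Sum>k\<in>Sym n. x k * F (inv k \<circ> g))"
  proof (intro sum.cong refl)
    fix k assume k: "k \<in> Sym n"
    have "F (inv k \<circ> g) = F (inv k \<circ> (g \<circ> inv k) \<circ> k)" using k by (simp add: perm_simps Sym_bij)
    also have "\<dots> = F (g \<circ> inv k)" by (rule F(2)) (use k g in \<open>auto simp: comp_in_Sym inv_in_Sym\<close>)
    finally show "F (g \<circ> inv k) * x k = x k * F (inv k \<circ> g)" by simp
  qed
  finally show "conv n F x g = conv n x F g" by (simp add: conv_def)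
qed (use assms in \<open>auto intro: conv_GA\<close>)

text \<open>Conjugation can be carried out inside the convolution because it leaves \<open>F\<close>
  unchanged.\<close>

lemma cl_conv_class:
  assumes F: "\<And>h k. h \<in> Sym n \<Longrightarrow> k \<in> Sym n \<Longrightarrow> F (inv h \<circ> k \<circ> h) = F k" and g: "g \<in> Sym n"
  shows "cl n (conv n F x) g = conv n F (cl n x) g"
proof -
  have "cl n (conv n F x) g = (\<Sum>h\<in>Sym n. \<Sum>k\<in>Sym n. F (inv h \<circ> k \<circ> h) * x (inv (inv h \<circ> k \<circ> h) \<circ> (inv h \<circ> g \<circ> h)))"
    unfolding cl_def conv_def by (intro sum.cong refl sum_Sym_conj'[symmetric])
  also have "\<dots> = (\<Sum>h\<in>Sym n. \<Sum>k\<in>Sym n. F k * x (inv h \<circ> (inv k \<circ> g) \<circ> h))"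
    by (intro sum.cong refl) (simp add: F, simp add: perm_simps Sym_bij)
  also have "\<dots> = conv n F (cl n x) g"
    by (subst sum.swap) (simp add: conv_def cl_def sum_distrib_left)
  finally show ?thesis .
qed

text \<open>Inversion of the argument reverses products, and both factors are fixed by it. It is
  applied to row sums and signed column sums.\<close>

lemma conv_inv:
  assumes x: "\<And>h. h \<in> Sym n \<Longrightarrow> x (inv h) = x h" and y: "\<And>h. h \<in> Sym n \<Longrightarrow> y (inv h) = y h"
    and g: "g \<in> Sym n"
  shows "conv n x y (inv g) = conv n y x g"
proof -
  have "conv n x y (inv g) = (\<Sum>h\<in>Sym n. x h * y (inv (g \<circ> h)))"
    unfolding conv_def by (intro sum.cong refl) (simp add: perm_simps Sym_bij Sym_bij[OF g])
  also have "\<dots> = (\<Sum>h\<in>Sym n. x (inv h) * y (g \<circ> h))"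
    by (intro sum.cong refl arg_cong2[of _ _ _ _ times]) (simp_all add: x y g comp_in_Sym)
  also have "\<dots> = (\<Sum>h\<in>Sym n. y (g \<circ> inv h) * x h)"
    by (subst sum_Sym_inv[symmetric]) (simp add: perm_simps Sym_bij mult.commute)
  finally show ?thesis using g by (simp add: conv_alt)
qed

lemma real_square_sum_zero:
  assumes "\<And>h. h \<in> A \<Longrightarrow> x h \<in> \<real>" "finite A" "(\<Sum>h\<in>A. x h * x h) = (0::complex)" "h \<in> A"
  shows "x h = 0"
proof -
  have "x h * x h = of_real ((Re (x h))\<^sup>2)" if "h \<in> A" for h
    using assms(1)[OF that] by (auto elim!: Reals_cases simp: power2_eq_square)
  then have "(\<Sum>h\<in>A. x h * x h) = of_real (\<Sum>h\<in>A. (Re (x h))\<^sup>2)" by simp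
  then have "(\<Sum>h\<in>A. (Re (x h))\<^sup>2) = 0" using assms(3) by (simp add: of_real_eq_0_iff del: of_real_sum)
  then have "Re (x h) = 0" using assms(2,4) by (subst (asm) sum_nonneg_eq_0_iff) auto
  then show ?thesis using assms(1)[OF assms(4)] by (auto elim!: Reals_cases)
qed

section \<open>Traces on left ideals\<close>

lemma sum_fun_apply: "(\<Sum>i\<in>A. F i) x = (\<Sum>i\<in>A. F i x)"
  for F :: "'i \<Rightarrow> 'a \<Rightarrow> 'b::comm_monoid_add"
  by (induction A rule: infinite_finite_induct) auto

lemma expand_delta:
  assumes "finite G" "\<And>g. g \<notin> G \<Longrightarrow> v g = 0"
  shows "v = (\<Sum>g\<in>G. cscale (v g) (delta g))"
  by (rule ext) (use assms in \<open>auto simp: sum_fun_apply cscale_def delta_def if_distrib[of "\<lambda>c. _ * c"] cong: if_cong\<close>)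

text \<open>\<open>T\<close> factors through the coordinate space of \<open>G\<close>: read off the
  values of v, then combine the \<open>W g\<close>. Since AB and BA have equal traces, the trace can
  be taken on coordinate space, where the diagonal entries are \<open>W g g\<close>; this removes
  the arbitrary basis in \<open>trace_on\<close>. The second part concerns the identity map, whose
  trace is the dimension.\<close>

lemma trace_on_eq:
  assumes V: "cfun.subspace V" and G: "finite G" and supp: "\<And>v g. v \<in> V \<Longrightarrow> g \<notin> G \<Longrightarrow> v g = 0"
    and W: "\<And>g. g \<in> G \<Longrightarrow> W g \<in> V"
    and T: "\<And>v. v \<in> V \<Longrightarrow> T v = (\<Sum>g\<in>G. cscale (v g) (W g))"
  shows "trace_on V T = (\<Sum>g\<in>G. W g g)"
    and "(\<And>v. v \<in> V \<Longrightarrow> T v = v) \<Longrightarrow> \<exists>d. trace_on V T = of_nat d \<and> ((\<exists>v\<in>V. v \<noteq> 0) \<longrightarrow> d \<ge> 1)"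
proof -
  define B where "B = (SOME B. cfun.independent B \<and> cfun.span B = V)"
  obtain B0 where B0: "B0 \<subseteq> V" "cfun.independent B0" "V \<subseteq> cfun.span B0"
    by (rule cfun.basis_exists[of V])
  then have "cfun.independent B0 \<and> cfun.span B0 = V" using V by (simp add: cfun.span_subspace)
  then have "cfun.independent B \<and> cfun.span B = V"
    unfolding B_def by (rule someI[where P = "\<lambda>B. cfun.independent B \<and> cfun.span B = V"])
  then have B: "cfun.independent B" "cfun.span B = V" by auto
  have "V \<subseteq> cfun.span (delta ` G)"
  proof
    fix v assume "v \<in> V"
    then have "v = (\<Sum>g\<in>G. cscale (v g) (delta g))" using G supp by (intro expand_delta) auto
    also have "\<dots> \<in> cfun.span (delta ` G)" by (intro cfun.span_sum cfun.span_scale cfun.span_base) auto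
    finally show "v \<in> cfun.span (delta ` G)" .
  qed
  then have fB: "finite B"
    using cfun.independent_span_bound[of "delta ` G" B] G B cfun.span_superset[of B] by auto
  have tr: "trace_on V T = (\<Sum>b\<in>B. cfun.representation B (T b) b)"
    by (simp add: trace_on_def B_def Let_def)
  have BV: "b \<in> V" if "b \<in> B" for b using B that cfun.span_base by auto
  have rep: "(\<Sum>b\<in>B. cfun.representation B v b * b g) = v g" if "v \<in> V" for v g
    using arg_cong[OF cfun.sum_representation_eq[of B v B], of "\<lambda>f. f g"] B fB that
    by (simp add: sum_fun_apply cscale_def)
  \<comment> \<open>Expand \<open>T b\<close> over \<open>G\<close>; after the swap, the sum over
    the basis reassembles the value of \<open>W g\<close> at \<open>g\<close>.\<close>
  have "(\<Sum>b\<in>B. cfun.representation B (T b) b) = (\<Sum>b\<in>B. \<Sum>g\<in>G. b g * cfun.representation B (W g) b)"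
  proof (rule sum.cong[OF refl])
    fix b assume b: "b \<in> B"
    have "cfun.representation B (T b) = (\<lambda>c. \<Sum>g\<in>G. cfun.representation B (cscale (b g) (W g)) c)"
      unfolding T[OF BV[OF b]] by (rule cfun.representation_sum[OF B(1)]) (simp add: B W V cfun.subspace_scale)
    then show "cfun.representation B (T b) b = (\<Sum>g\<in>G. b g * cfun.representation B (W g) b)"
      by (simp add: cfun.representation_scale B W)
  qed
  also have "\<dots> = (\<Sum>g\<in>G. W g g)"
  proof (subst sum.swap, rule sum.cong[OF refl])
    fix g assume "g \<in> G"
    show "(\<Sum>b\<in>B. b g * cfun.representation B (W g) b) = W g g"
      using rep[OF W[OF \<open>g \<in> G\<close>], of g] by (simp only: mult.commute)
  qed
  finally show "trace_on V T = (\<Sum>g\<in>G. W g g)" using tr by simp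
  assume id: "\<And>v. v \<in> V \<Longrightarrow> T v = v"
  have "trace_on V T = of_nat (card B)"
    unfolding tr using B BV id by (simp add: cfun.representation_basis)
  moreover have "card B \<ge> 1" if "v \<in> V" "v \<noteq> 0" for v
    using that B fB by (cases "B = {}") (auto simp: Suc_le_eq card_gt_0_iff)
  ultimately show "\<exists>d. trace_on V T = of_nat d \<and> ((\<exists>v\<in>V. v \<noteq> 0) \<longrightarrow> d \<ge> 1)" by blast
qed

lemma GA_lin: "x \<in> GA n \<Longrightarrow> y \<in> GA n \<Longrightarrow> cscale c x + y \<in> GA n"
  by (simp add: GA_def cscale_def)

lemma conv_expand: "conv n x y = (\<Sum>h\<in>Sym n. cscale (x h) (left_mult h y))"
  by (rule ext) (simp add: conv_def sum_fun_apply cscale_def left_mult_def)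

lemma conv_sum_right: "conv n x (\<Sum>i\<in>A. F i) = (\<Sum>i\<in>A. conv n x (F i))"
proof
  fix g show "conv n x (\<Sum>i\<in>A. F i) g = (\<Sum>i\<in>A. conv n x (F i)) g"
    by (simp add: conv_def sum_fun_apply sum_distrib_left) (rule sum.swap)
qed

lemma conv_left_mult:
  assumes "k \<in> Sym n"
  shows "conv n (left_mult k x) y = left_mult k (conv n x y)"
  using assms by (simp add: conv_delta_left[symmetric] conv_assoc)

text \<open>Elements of the ideal satisfy v e = v, so left multiplication by \<open>k\<close> sends
  v to the sum of the v(h) k h e. The coefficient of \<open>h\<close> in k h e is
  \<open>e (inv h \<circ> inv k \<circ> h)\<close>, whence the inverse of \<open>k\<close>.\<close>

lemma trace_left_ideal:
  assumes k: "k \<in> Sym n" and e: "e \<in> GA n" "conv n e e = e"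
  shows "trace_on (cfun.span ((\<lambda>g. left_mult g e) ` Sym n)) (left_mult k) = cl n e (inv k)"
proof -
  let ?V = "cfun.span ((\<lambda>g. left_mult g e) ` Sym n)"
  have fixV: "v \<in> GA n \<and> conv n v e = v" if "v \<in> ?V" for v
    using that
  proof (induction rule: cfun.span_induct_alt)
    case base
    show ?case by (auto simp: GA_def conv_def)
  next
    case (step c x y)
    then obtain g where g: "g \<in> Sym n" "x = left_mult g e" by auto
    have "conv n (cscale c x + y) e = cscale c (conv n x e) + conv n y e"
      by (rule ext) (simp add: conv_def cscale_def distrib_right sum.distrib sum_distrib_left mult.assoc)
    moreover have "conv n x e = x" using g e by (simp add: conv_left_mult)
    moreover have "x \<in> GA n" using g e by (simp add: left_mult_GA)
    ultimately show ?case using step by (simp add: GA_lin[unfolded plus_fun_def] plus_fun_def)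
  qed
  have "trace_on ?V (left_mult k) = (\<Sum>h\<in>Sym n. left_mult (k \<circ> h) e h)"
  proof (rule trace_on_eq(1)[where W = "\<lambda>h. left_mult (k \<circ> h) e"])
    fix v assume v: "v \<in> ?V"
    have "left_mult k v = left_mult k (\<Sum>h\<in>Sym n. cscale (v h) (left_mult h e))"
      using fixV[OF v] by (simp add: conv_expand[symmetric])
    also have "\<dots> = (\<Sum>h\<in>Sym n. cscale (v h) (left_mult (k \<circ> h) e))"
      by (rule ext) (auto simp: left_mult_def sum_fun_apply cscale_def perm_simps Sym_bij Sym_bij[OF k] intro!: sum.cong)
    finally show "left_mult k v = (\<Sum>h\<in>Sym n. cscale (v h) (left_mult (k \<circ> h) e))" .
  qed (use fixV k in \<open>auto simp: GA_def comp_in_Sym intro: cfun.span_base\<close>)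
  also have "\<dots> = cl n e (inv k)"
    unfolding cl_def by (intro sum.cong refl) (simp add: left_mult_def perm_simps Sym_bij Sym_bij[OF k])
  finally show ?thesis .
qed

text \<open>v \<mapsto> e v f is a projection onto e A f, so its trace is the dimension of that
  space, which contains e f. Integrality and positivity of degrees and of branching multiplicities
  come from here.\<close>

lemma trace_two_sided:
  assumes e: "conv n e e = e" and f: "f \<in> GA n" "conv n f f = f"
  shows "\<exists>d. (\<Sum>h\<in>Sym n. conv n e (left_mult h f) h) = of_nat d \<and> (conv n e f \<noteq> 0 \<longrightarrow> d \<ge> 1)"
proof -
  let ?W = "\<lambda>h. conv n e (left_mult h f)"
  let ?V = "cfun.span (?W ` Sym n)"
  have fixV: "v \<in> GA n \<and> conv n e (conv n v f) = v" if "v \<in> ?V" for v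
    using that
  proof (induction rule: cfun.span_induct_alt)
    case base
    show ?case by (auto simp: GA_def conv_def)
  next
    case (step c x y)
    then obtain g where g: "g \<in> Sym n" "x = ?W g" by auto
    have "conv n e (conv n (cscale c x + y) f) = cscale c (conv n e (conv n x f)) + conv n e (conv n y f)"
      by (rule ext) (simp add: conv_def cscale_def algebra_simps sum.distrib sum_distrib_left)
    moreover have "conv n e (conv n x f) = x"
      using g e f by (simp add: conv_left_mult conv_assoc) (simp add: conv_assoc[symmetric])
    moreover have "x \<in> GA n" using g f by (simp add: left_mult_GA conv_GA)
    ultimately show ?case using step by (simp add: GA_lin[unfolded plus_fun_def] plus_fun_def)
  qed
  have W: "v = (\<Sum>h\<in>Sym n. cscale (v h) (?W h))" if "v \<in> ?V" for v
  proof -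
    have "v = conv n e (conv n v f)" using fixV[OF that] by simp
    also have "\<dots> = (\<Sum>h\<in>Sym n. cscale (v h) (?W h))"
      by (simp only: conv_expand[of n v] conv_sum_right conv_cscale_right)
    finally show ?thesis .
  qed
  have V: "cfun.subspace ?V" "finite (Sym n)" "\<And>v g. v \<in> ?V \<Longrightarrow> g \<notin> Sym n \<Longrightarrow> v g = 0"
    "\<And>g. g \<in> Sym n \<Longrightarrow> ?W g \<in> ?V"
    using fixV by (auto simp: GA_def intro: cfun.span_base)
  have "\<exists>d. trace_on ?V (\<lambda>v. v) = of_nat d \<and> ((\<exists>v\<in>?V. v \<noteq> 0) \<longrightarrow> d \<ge> 1)"
    by (rule trace_on_eq(2)[where T = "\<lambda>v. v" and W = ?W and V = ?V and G = "Sym n"]) (fact V | fact W | simp)+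
  moreover have "trace_on ?V (\<lambda>v. v) = (\<Sum>h\<in>Sym n. conv n e (left_mult h f) h)"
    by (rule trace_on_eq(1)[where T = "\<lambda>v. v" and W = ?W and V = ?V and G = "Sym n"]) (fact V | fact W)+
  moreover have "conv n e f \<in> ?V"
    by (rule cfun.span_base, rule image_eqI[of _ _ id]) (auto simp: left_mult_def)
  ultimately show ?thesis by auto
qed

section \<open>Tableaux and the combinatorics of row and column groups\<close>

text \<open>Diagrams are down-closed finite sets rather than lists, so that removing or adding a
  cell, union and intersection are plain set operations.\<close>

definition young :: "(nat \<times> nat) set \<Rightarrow> bool" where
  "young D \<longleftrightarrow> finite D \<and> (\<forall>i j i' j'. (i, j) \<in> D \<longrightarrow> i' \<le> i \<longrightarrow> j' \<le> j \<longrightarrow> (i', j') \<in> D)"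

text \<open>\<open>pos\<close> sends a letter to its cell, inversely to the usual filling. It is
  unconstrained from n on, so a filling can be extended by one letter with a function
  update.\<close>

definition tableau :: "nat \<Rightarrow> (nat \<times> nat) set \<Rightarrow> (nat \<Rightarrow> nat \<times> nat) \<Rightarrow> bool" where
  "tableau n D pos \<longleftrightarrow> young D \<and> bij_betw pos {..<n} D"

lemma young_finite: "young D \<Longrightarrow> finite D"
  by (simp add: young_def)

lemma young_le: "young D \<Longrightarrow> (i, j) \<in> D \<Longrightarrow> i' \<le> i \<Longrightarrow> j' \<le> j \<Longrightarrow> (i', j') \<in> D"
  unfolding young_def by blast

lemma down_closed_nat:
  assumes "finite A" "\<And>a b. a \<in> A \<Longrightarrow> b \<le> a \<Longrightarrow> b \<in> A"
  shows "A = {..<card A}"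
proof (cases "A = {}")
  case False
  have "A = {..Max A}"
    using assms False by (auto intro: Max_ge Max_in)
  then have "A = {..<Suc (Max A)}" by (simp add: lessThan_Suc_atMost)
  then show ?thesis by (metis card_lessThan)
qed simp

lemma young_column:
  assumes "young D" shows "{a. (a, j) \<in> D} = {..<card {a. (a, j) \<in> D}}"
proof (rule down_closed_nat)
  have "{a. (a, j) \<in> D} \<subseteq> fst ` D" by force
  then show "finite {a. (a, j) \<in> D}" using young_finite[OF assms] finite_subset by blast
qed (use assms in \<open>auto intro: young_le\<close>)

lemma card_fibers:
  fixes A :: "'k set" and c :: "'k \<Rightarrow> nat"
  assumes "finite A" "finite J" "c ` A \<subseteq> J"
  shows "(\<Sum>j\<in>J. card {k \<in> A. c k = j}) = card A"
  using sum.group[OF assms, of "\<lambda>_. 1::nat"] by simp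

lemma bij_card_filter:
  assumes "bij_betw P K D" "\<And>k. k \<in> K \<Longrightarrow> Q (P k) \<longleftrightarrow> Q' k"
  shows "card {k \<in> K. Q' k} = card {x \<in> D. Q x}"
proof (rule bij_betw_same_card[of P])
  have "{x \<in> D. Q x} = P ` {k \<in> K. Q' k}" using assms by (force simp: bij_betw_def)
  moreover have "inj_on P {k \<in> K. Q' k}"
    using assms(1) by (auto simp: bij_betw_def inj_on_def)
  ultimately show "bij_betw P {k \<in> K. Q' k} {x \<in> D. Q x}" by (simp add: bij_betw_def)
qed

context
  fixes K :: "'k set" and r c :: "'k \<Rightarrow> nat" and P Q :: "'k \<Rightarrow> nat \<times> nat" and D E :: "(nat \<times> nat) set"
  assumes K: "finite K" and inj: "inj_on (\<lambda>k. (r k, c k)) K"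
    and P: "bij_betw P K D" "\<And>k. k \<in> K \<Longrightarrow> fst (P k) = r k"
    and Q: "bij_betw Q K E" "\<And>k. k \<in> K \<Longrightarrow> snd (Q k) = c k"
    and E: "young E"
begin

text \<open>In this setting \<open>r\<close> is the row of a letter in a filling of \<open>D\<close>
  and \<open>c\<close> its column in a filling of \<open>E\<close>, and no two letters share both.
  The letters of column \<open>j\<close> thus lie in distinct rows, so at most \<open>i\<close> of
  them lie below row \<open>i\<close>; nor can there be more than the height of that column of
  \<open>E\<close>. The smaller of the two bounds is the number of its cells below row
  \<open>i\<close>.\<close>

lemma column_fit: "card {k \<in> K. r k < i \<and> c k = j} \<le> card {x \<in> E. fst x < i \<and> snd x = j}"
proof -
  define h where "h = card {a. (a, j) \<in> E}"
  have h: "(a, j) \<in> E \<longleftrightarrow> a < h" for a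
    using young_column[OF E, of j] unfolding h_def by blast
  have "{x \<in> E. fst x < i \<and> snd x = j} = (\<lambda>a. (a, j)) ` {..<min i h}"
    by (auto simp: h)
  then have "card {x \<in> E. fst x < i \<and> snd x = j} = min i h"
    by (simp add: card_image inj_on_def)
  moreover have "card {k \<in> K. r k < i \<and> c k = j} \<le> card {..<i}"
    by (rule card_inj_on_le[of r]) (use inj in \<open>auto simp: inj_on_def\<close>)
  moreover have "card {k \<in> K. r k < i \<and> c k = j} \<le> card {k \<in> K. c k = j}"
    by (rule card_mono) (use K in auto)
  moreover have "card {k \<in> K. c k = j} = card {x \<in> E. snd x = j}"
    by (rule bij_card_filter[OF Q(1)]) (simp add: Q)
  moreover have "{x \<in> E. snd x = j} = (\<lambda>a. (a, j)) ` {..<h}"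
    by (auto simp: h)
  then have "card {x \<in> E. snd x = j} = h"
    by (simp add: card_image inj_on_def)
  ultimately show ?thesis by simp
qed

lemma rows_count:
  defines "J \<equiv> c ` K \<union> snd ` E"
  shows "finite J" and "card {x \<in> D. fst x < i} = (\<Sum>j\<in>J. card {k \<in> K. r k < i \<and> c k = j})"
    and "card {x \<in> E. fst x < i} = (\<Sum>j\<in>J. card {x \<in> E. fst x < i \<and> snd x = j})"
proof -
  show J: "finite J" using K young_finite[OF E] by (simp add: J_def)
  have "card {x \<in> D. fst x < i} = card {k \<in> K. r k < i}"
    by (rule bij_card_filter[OF P(1), symmetric]) (simp add: P)
  also have "\<dots> = (\<Sum>j\<in>J. card {k \<in> {k \<in> K. r k < i}. c k = j})"
    by (rule card_fibers[symmetric]) (use K J in \<open>auto simp: J_def\<close>)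
  finally show "card {x \<in> D. fst x < i} = (\<Sum>j\<in>J. card {k \<in> K. r k < i \<and> c k = j})"
    by (simp add: conj_assoc)
  have "card {x \<in> E. fst x < i} = (\<Sum>j\<in>J. card {x \<in> {x \<in> E. fst x < i}. snd x = j})"
    by (rule card_fibers[symmetric]) (use young_finite[OF E] J in \<open>auto simp: J_def\<close>)
  then show "card {x \<in> E. fst x < i} = (\<Sum>j\<in>J. card {x \<in> E. fst x < i \<and> snd x = j})"
    by (simp add: conj_assoc)
qed

text \<open>The bound is summed over columns: a pair of fillings without collision forces
  \<open>E\<close> to dominate \<open>D\<close>.\<close>

lemma dominance: "card {x \<in> D. fst x < i} \<le> card {x \<in> E. fst x < i}"
  unfolding rows_count by (intro sum_mono column_fit)

text \<open>With equal shapes the summed bounds are equalities, hence so is each bound. Differences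
  in \<open>i\<close> then count one letter for every cell of \<open>E\<close>.\<close>

lemma dominance_eq:
  assumes "D = E"
  shows "(\<lambda>k. (r k, c k)) ` K = E"
proof -
  have eq: "card {k \<in> K. r k < i \<and> c k = j} = card {x \<in> E. fst x < i \<and> snd x = j}" for i j
  proof (cases "j \<in> c ` K \<union> snd ` E")
    case True
    have "(\<Sum>j\<in>c ` K \<union> snd ` E. card {k \<in> K. r k < i \<and> c k = j}) = (\<Sum>j\<in>c ` K \<union> snd ` E. card {x \<in> E. fst x < i \<and> snd x = j})"
      using rows_count(2,3)[of i] assms by simp
    then show ?thesis by (rule sum_mono_inv[OF _ column_fit True]) (rule rows_count(1))
  next
    case False
    then have "{k \<in> K. r k < i \<and> c k = j} = {}" "{x \<in> E. fst x < i \<and> snd x = j} = {}" by force+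
    then show ?thesis by (simp only: card.empty)
  qed
  have cells: "card {k \<in> K. r k = i \<and> c k = j} = card {x \<in> E. fst x = i \<and> snd x = j}" for i j
  proof -
    have "card {k \<in> K. r k < Suc i \<and> c k = j} = card {k \<in> K. r k < i \<and> c k = j} + card {k \<in> K. r k = i \<and> c k = j}"
      by (subst card_Un_disjoint[symmetric]) (use K in \<open>auto intro!: arg_cong[of _ _ card]\<close>)
    moreover have "card {x \<in> E. fst x < Suc i \<and> snd x = j} = card {x \<in> E. fst x < i \<and> snd x = j} + card {x \<in> E. fst x = i \<and> snd x = j}"
      by (subst card_Un_disjoint[symmetric]) (use young_finite[OF E] in \<open>auto intro!: arg_cong[of _ _ card]\<close>)
    ultimately show ?thesis using eq by simp
  qed
  have "{k \<in> K. r k = i \<and> c k = j} = {} \<longleftrightarrow> {x \<in> E. fst x = i \<and> snd x = j} = {}" for i j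
  proof -
    have "finite {k \<in> K. r k = i \<and> c k = j}" "finite {x \<in> E. fst x = i \<and> snd x = j}"
      using K young_finite[OF E] by auto
    note f = this
    have "{k \<in> K. r k = i \<and> c k = j} = {} \<longleftrightarrow> card {k \<in> K. r k = i \<and> c k = j} = 0"
      by (rule card_0_eq[OF f(1), symmetric])
    also have "\<dots> \<longleftrightarrow> card {x \<in> E. fst x = i \<and> snd x = j} = 0" by (simp only: cells)
    also have "\<dots> \<longleftrightarrow> {x \<in> E. fst x = i \<and> snd x = j} = {}" by (rule card_0_eq[OF f(2)])
    finally show ?thesis .
  qed
  then have "(i, j) \<in> (\<lambda>k. (r k, c k)) ` K \<longleftrightarrow> (i, j) \<in> E" for i j
    by force
  then show ?thesis by (auto simp: set_eq_iff)
qed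

end

section \<open>Row and column groups\<close>

definition rowG :: "nat \<Rightarrow> (nat \<Rightarrow> nat \<times> nat) \<Rightarrow> (nat \<Rightarrow> nat) set" where
  "rowG n pos = {p \<in> Sym n. \<forall>x<n. fst (pos (p x)) = fst (pos x)}"

definition colG :: "nat \<Rightarrow> (nat \<Rightarrow> nat \<times> nat) \<Rightarrow> (nat \<Rightarrow> nat) set" where
  "colG n pos = {p \<in> Sym n. \<forall>x<n. snd (pos (p x)) = snd (pos x)}"

text \<open>Rows and columns are both labellings of the letters, so one proof for the stabilizer of
  a labelling gives the group laws for both.\<close>

lemma stab_group:
  fixes f :: "nat \<Rightarrow> 'b" and n :: nat
  defines "S \<equiv> {p \<in> Sym n. \<forall>x<n. f (p x) = f x}"
  shows "id \<in> S" "p \<in> S \<Longrightarrow> q \<in> S \<Longrightarrow> p \<circ> q \<in> S" "p \<in> S \<Longrightarrow> inv p \<in> S"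
    "p \<in> S \<Longrightarrow> p \<circ> g \<in> S \<longleftrightarrow> g \<in> S" "p \<in> S \<Longrightarrow> g \<circ> p \<in> S \<longleftrightarrow> g \<in> S"
    "p \<in> Sym n \<Longrightarrow> inv p \<in> S \<longleftrightarrow> p \<in> S"
proof -
  show 1: "id \<in> S" by (simp add: S_def)
  have 2: "p \<circ> q \<in> S" if "p \<in> S" "q \<in> S" for p q
    using that by (auto simp: S_def comp_in_Sym Sym_lt)
  have 3: "inv p \<in> S" if "p \<in> S" for p
  proof -
    have p: "p \<in> Sym n" using that by (simp add: S_def)
    have "f (inv p x) = f x" if "x < n" for x
    proof -
      have "inv p x < n" using that Sym_lt[OF inv_in_Sym[OF p]] by simp
      then have "f (p (inv p x)) = f (inv p x)" using \<open>p \<in> S\<close> by (simp add: S_def)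
      then show ?thesis using Sym_bij[OF p] by (simp add: bij_is_surj surj_f_inv_f)
    qed
    then show ?thesis using p by (simp add: S_def inv_in_Sym)
  qed
  show "p \<in> S \<Longrightarrow> q \<in> S \<Longrightarrow> p \<circ> q \<in> S" "p \<in> S \<Longrightarrow> inv p \<in> S" using 2 3 by auto
  have bij: "bij p" if "p \<in> S" for p using that Sym_bij[of p n] by (simp add: S_def)
  show "p \<in> S \<Longrightarrow> p \<circ> g \<in> S \<longleftrightarrow> g \<in> S"
    using 2[of p g] 2[of "inv p" "p \<circ> g"] 3[of p] bij_inv_comp(3)[OF bij[of p], of g] by metis
  show "p \<in> S \<Longrightarrow> g \<circ> p \<in> S \<longleftrightarrow> g \<in> S"
    using 2[of g p] 2[of "g \<circ> p" "inv p"] 3[of p] bij_inv_comp(2)[OF bij[of p]]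
    by (metis comp_assoc comp_id)
  show "p \<in> Sym n \<Longrightarrow> inv p \<in> S \<longleftrightarrow> p \<in> S"
    using 3[of p] 3[of "inv p"] bij_inv_comp(5)[OF Sym_bij[of p n]] by metis
qed

lemmas rowG_group = stab_group[where f = "\<lambda>x. fst (pos x)" and n = n, folded rowG_def[of n pos]] for n and pos :: "nat \<Rightarrow> nat \<times> nat"
lemmas colG_group = stab_group[where f = "\<lambda>x. snd (pos x)" and n = n, folded colG_def[of n pos]] for n and pos :: "nat \<Rightarrow> nat \<times> nat"

lemma rowG_Sym: "p \<in> rowG n pos \<Longrightarrow> p \<in> Sym n" by (simp add: rowG_def)
lemma colG_Sym: "p \<in> colG n pos \<Longrightarrow> p \<in> Sym n" by (simp add: colG_def)

lemma row_col_trivial: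
  assumes "tableau n D pos" "p \<in> rowG n pos" "p \<in> colG n pos"
  shows "p = id"
proof
  fix x
  have p: "p \<in> Sym n" using assms by (simp add: rowG_def)
  show "p x = id x"
  proof (cases "x < n")
    case True
    then have "pos (p x) = pos x" using assms by (simp add: rowG_def colG_def prod_eq_iff)
    moreover have "p x < n" using True p Sym_lt by simp
    ultimately show ?thesis using True assms(1) by (auto simp: tableau_def bij_betw_def inj_on_def)
  next
    case False
    then show ?thesis using p by (simp add: Sym_def permutes_def)
  qed
qed

lemma transpose_in_Sym: "x < n \<Longrightarrow> y < n \<Longrightarrow> transpose x y \<in> Sym n"
  by (simp add: Sym_def permutes_swap_id)

lemma Sym_sign: "p \<in> Sym n \<Longrightarrow> q \<in> Sym n \<Longrightarrow> sign (p \<circ> q) = sign p * sign q"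
  unfolding Sym_def using permutation_permutes sign_compose finite_lessThan by blast

lemma Sym_sign_inv: "p \<in> Sym n \<Longrightarrow> sign (inv p) = sign p"
  unfolding Sym_def using permutation_permutes sign_inverse finite_lessThan by blast

text \<open>The invariance shared by all products a x b', with a the row sum of \<open>pos\<close>
  and b' the signed column sum of \<open>pos'\<close>. Two tableaux are kept apart because different
  shapes have to be compared.\<close>

definition row_col_type :: "nat \<Rightarrow> (nat \<Rightarrow> nat \<times> nat) \<Rightarrow> (nat \<Rightarrow> nat \<times> nat) \<Rightarrow> galg \<Rightarrow> bool" where
  "row_col_type n pos pos' y \<longleftrightarrow> y \<in> GA n \<and>
    (\<forall>g\<in>Sym n. \<forall>p\<in>rowG n pos. y (p \<circ> g) = y g) \<and>
    (\<forall>g\<in>Sym n. \<forall>q\<in>colG n pos'. y (g \<circ> q) = of_int (sign q) * y g)"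

text \<open>The transposition of \<open>a\<close> and \<open>b\<close> lies in the row group, its
  conjugate \<open>?s\<close> in the column group with sign -1. Multiplying \<open>g\<close> by the
  one on the left or by the other on the right gives the same permutation, so y g = - y g.\<close>

lemma row_col_collision:
  assumes y: "row_col_type n pos pos' y" and g: "g \<in> Sym n"
    and ab: "a < n" "b < n" "a \<noteq> b" "fst (pos a) = fst (pos b)"
      "snd (pos' (inv g a)) = snd (pos' (inv g b))"
  shows "y g = 0"
proof -
  let ?t = "transpose a b" and ?s = "transpose (inv g a) (inv g b)"
  have bg: "bij g" by (rule Sym_bij[OF g])
  have lt: "inv g a < n" "inv g b < n" using ab Sym_lt[OF inv_in_Sym[OF g]] by auto
  have ne: "inv g a \<noteq> inv g b" using ab(3) bg by (metis bij_inv_eq_iff)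
  have t: "?t \<in> rowG n pos" using ab by (auto simp: rowG_def transpose_in_Sym transpose_def)
  have s: "?s \<in> colG n pos'" using ab lt by (auto simp: colG_def transpose_in_Sym transpose_def)
  have gs: "g \<circ> ?s = ?t \<circ> g"
    using bg by (auto simp: fun_eq_iff transpose_def bij_inv_eq_iff) (metis bij_inv_eq_iff)+
  have "y (g \<circ> ?s) = of_int (sign ?s) * y g" using y g s by (simp add: row_col_type_def)
  moreover have "y (?t \<circ> g) = y g" using y g t by (simp add: row_col_type_def)
  moreover have "sign ?s = -1" using ne by (simp add: sign_swap_id)
  ultimately show ?thesis using gs by simp
qed

text \<open>A permutation without collision would match the filling \<open>pos\<close> of
  \<open>D\<close> with the filling \<open>pos' \<circ> inv g\<close> of \<open>E\<close>, which
  dominance forbids. So every permutation has a collision.\<close>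

lemma row_col_type_zero:
  assumes y: "row_col_type n pos pos' y" and D: "tableau n D pos" and E: "tableau n E pos'"
    and i: "card {x \<in> D. fst x < i} > card {x \<in> E. fst x < i}"
  shows "y = 0"
proof
  fix g
  show "y g = 0 g"
  proof (cases "g \<in> Sym n")
    case g: True
    have "\<not> inj_on (\<lambda>k. (fst (pos k), snd (pos' (inv g k)))) {..<n}"
    proof
      assume inj: "inj_on (\<lambda>k. (fst (pos k), snd (pos' (inv g k)))) {..<n}"
      have ig: "bij_betw (inv g) {..<n} {..<n}"
        using inv_in_Sym[OF g] by (simp add: Sym_def permutes_imp_bij)
      have "card {x \<in> D. fst x < i} \<le> card {x \<in> E. fst x < i}"
        by (rule dominance[OF _ inj, where P = pos and Q = "pos' \<circ> inv g"])
          (use D E ig in \<open>auto simp: tableau_def intro: bij_betw_trans\<close>)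
      then show False using i by simp
    qed
    then obtain a b where "a < n" "b < n" "a \<noteq> b" "fst (pos a) = fst (pos b)"
      "snd (pos' (inv g a)) = snd (pos' (inv g b))"
      by (auto simp: inj_on_def)
    then show ?thesis using row_col_collision[OF y g] by simp
  qed (use y in \<open>simp add: row_col_type_def GA_def\<close>)
qed

text \<open>Without collisions, the pairs formed by the row of k and its column in the filling
  translated by \<open>g\<close> run through all cells once; the letters of these cells define the
  row permutation. This is von Neumann's lemma.\<close>

lemma row_col_factor:
  assumes T: "tableau n D pos" and g: "g \<in> Sym n"
    and inj: "inj_on (\<lambda>k. (fst (pos k), snd (pos (inv g k)))) {..<n}"
  shows "\<exists>p\<in>rowG n pos. \<exists>q\<in>colG n pos. g = p \<circ> q"
proof -
  let ?U = "\<lambda>k. (fst (pos k), snd (pos (inv g k)))"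
  have ig: "bij_betw (inv g) {..<n} {..<n}"
    using inv_in_Sym[OF g] by (simp add: Sym_def permutes_imp_bij)
  have pos: "bij_betw pos {..<n} D" using T by (simp add: tableau_def)
  have "?U ` {..<n} = D"
    by (rule dominance_eq[OF _ inj, where P = pos and Q = "pos \<circ> inv g" and D = D])
      (use T ig in \<open>auto simp: tableau_def intro: bij_betw_trans\<close>)
  then have U: "bij_betw ?U {..<n} D" using inj by (simp add: bij_betw_def)
  \<comment> \<open>\<open>p\<close> moves \<open>k\<close> within its row to the column that
    \<open>k\<close> has in the translated filling; therefore \<open>p \<circ> g\<close> preserves
    columns.\<close>
  define p where "p = (\<lambda>k. if k < n then inv_into {..<n} pos (?U k) else k)"
  have "bij_betw (inv_into {..<n} pos \<circ> ?U) {..<n} {..<n}"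
    using U bij_betw_inv_into[OF pos] by (rule bij_betw_trans)
  then have "bij_betw p {..<n} {..<n}" by (rule bij_betw_cong[THEN iffD1, rotated]) (simp add: p_def)
  then have pS: "p \<in> Sym n" unfolding Sym_def by (auto intro!: bij_imp_permutes simp: p_def split: if_splits)
  have pp: "pos (p k) = ?U k" if "k < n" for k
  proof -
    have "?U k \<in> pos ` {..<n}" using bij_betwE[OF U] that pos by (auto simp: bij_betw_def)
    then show ?thesis using that by (simp add: p_def f_inv_into_f)
  qed
  have p: "p \<in> rowG n pos" using pS pp by (simp add: rowG_def)
  have q: "p \<circ> g \<in> colG n pos"
    using pS g pp by (auto simp: colG_def comp_in_Sym Sym_lt bij_is_inj[OF Sym_bij[OF g]])
  have "g = inv p \<circ> (p \<circ> g)" using Sym_bij[OF pS] by (simp add: perm_simps)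
  then show ?thesis using q rowG_group(3)[OF p] by blast
qed

text \<open>The value at the identity fixes the values at all products p q, and every other
  permutation has a collision, where the value is 0.\<close>

lemma row_col_type_unique:
  assumes T: "tableau n D pos" and y: "row_col_type n pos pos y" and z: "row_col_type n pos pos z"
    and z1: "z id = 1"
  shows "y = cscale (y id) z"
proof
  fix g
  have val: "x (p \<circ> q) = of_int (sign q) * x id"
    if "row_col_type n pos pos x" "p \<in> rowG n pos" "q \<in> colG n pos" for x p q
  proof -
    have "x (p \<circ> q) = of_int (sign q) * x p"
      using that by (simp add: row_col_type_def rowG_Sym)
    also have "x p = x (p \<circ> id)" by simp
    also have "\<dots> = x id" using that by (simp only: row_col_type_def id_in_Sym)
    finally show ?thesis .
  qed
  show "y g = cscale (y id) z g"
  proof (cases "g \<in> Sym n")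
    case g: True
    show ?thesis
    proof (cases "inj_on (\<lambda>k. (fst (pos k), snd (pos (inv g k)))) {..<n}")
      case True
      then obtain p q where "p \<in> rowG n pos" "q \<in> colG n pos" "g = p \<circ> q"
        using row_col_factor[OF T g] by blast
      then show ?thesis using val[OF y] val[OF z] z1 by (simp add: cscale_def)
    next
      case False
      then obtain a b where "a < n" "b < n" "a \<noteq> b" "fst (pos a) = fst (pos b)"
        "snd (pos (inv g a)) = snd (pos (inv g b))"
        by (auto simp: inj_on_def)
      then show ?thesis using row_col_collision[OF y g] row_col_collision[OF z g] by (simp add: cscale_def)
    qed
  qed (use y z in \<open>simp add: row_col_type_def GA_def cscale_def\<close>)
qed

section \<open>Young symmetrizers and their characters\<close>

definition rowel :: "nat \<Rightarrow> (nat \<Rightarrow> nat \<times> nat) \<Rightarrow> galg" where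
  "rowel n pos g = (if g \<in> rowG n pos then 1 else 0)"

definition colel :: "nat \<Rightarrow> (nat \<Rightarrow> nat \<times> nat) \<Rightarrow> galg" where
  "colel n pos g = (if g \<in> colG n pos then of_int (sign g) else 0)"

definition ysym :: "nat \<Rightarrow> (nat \<Rightarrow> nat \<times> nat) \<Rightarrow> galg" where
  "ysym n pos = conv n (rowel n pos) (colel n pos)"

lemma rowel_GA: "rowel n pos \<in> GA n"
  by (auto simp: GA_def rowel_def rowG_def)

lemma colel_GA: "colel n pos \<in> GA n"
  by (auto simp: GA_def colel_def colG_def)

lemma ysym_GA: "ysym n pos \<in> GA n"
  by (simp add: ysym_def conv_GA colel_GA)

lemma rowel_inv: "h \<in> Sym n \<Longrightarrow> rowel n pos (inv h) = rowel n pos h"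
  by (simp add: rowel_def rowG_group)

lemma colel_inv: "h \<in> Sym n \<Longrightarrow> colel n pos (inv h) = colel n pos h"
  by (simp add: colel_def colG_group Sym_sign_inv)

lemma row_col_type_conv:
  "row_col_type n pos pos' (conv n (rowel n pos) (conv n x (colel n pos')))"
proof -
  have left: "conv n (rowel n pos) z (p \<circ> g) = conv n (rowel n pos) z g"
    if p: "p \<in> rowG n pos" for z p g
  proof -
    have "conv n (rowel n pos) z (p \<circ> g) = (\<Sum>h\<in>Sym n. rowel n pos (p \<circ> h) * z (inv (p \<circ> h) \<circ> (p \<circ> g)))"
      unfolding conv_def by (rule sum_Sym_left[OF rowG_Sym[OF p], symmetric])
    also have "\<dots> = conv n (rowel n pos) z g"
      unfolding conv_def by (intro sum.cong refl)
        (simp add: rowel_def rowG_group(4)[OF p] perm_simps Sym_bij Sym_bij[OF rowG_Sym[OF p]])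
    finally show ?thesis .
  qed
  have right: "conv n z (colel n pos') (g \<circ> q) = of_int (sign q) * conv n z (colel n pos') g"
    if g: "g \<in> Sym n" and q: "q \<in> colG n pos'" for z q g
  proof -
    have q': "q \<in> Sym n" by (rule colG_Sym[OF q])
    have "conv n z (colel n pos') (g \<circ> q) = (\<Sum>k\<in>Sym n. z ((g \<circ> q) \<circ> inv k) * colel n pos' k)"
      by (rule conv_alt) (simp add: comp_in_Sym g q')
    also have "\<dots> = (\<Sum>k\<in>Sym n. z ((g \<circ> q) \<circ> inv (k \<circ> q)) * colel n pos' (k \<circ> q))"
      by (rule sum_Sym_right[OF q', symmetric])
    also have "\<dots> = (\<Sum>k\<in>Sym n. of_int (sign q) * (z (g \<circ> inv k) * colel n pos' k))"
      by (intro sum.cong refl)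
        (simp add: colel_def colG_group(5)[OF q] perm_simps Sym_bij Sym_bij[OF q'] Sym_sign[OF _ q'])
    finally show ?thesis using g by (simp add: conv_alt sum_distrib_left)
  qed
  show ?thesis
    unfolding row_col_type_def
    using left right[of _ _ "conv n (rowel n pos) x"]
    by (auto simp: conv_GA colel_GA conv_assoc)
qed

text \<open>A term at the identity needs \<open>h\<close> in both the row and the column group, and
  these meet trivially.\<close>

lemma ysym_id:
  assumes "tableau n D pos" shows "ysym n pos id = 1"
proof -
  have "ysym n pos id = (\<Sum>h\<in>Sym n. if h = id then 1 else 0)"
    unfolding ysym_def conv_def
  proof (intro sum.cong refl)
    fix h assume h: "h \<in> Sym n"
    have "h \<in> rowG n pos \<Longrightarrow> h \<in> colG n pos \<Longrightarrow> h = id" using row_col_trivial[OF assms] by blast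
    then show "rowel n pos h * colel n pos (inv h \<circ> id) = (if h = id then 1 else 0)"
      using h by (auto simp: rowel_def colel_inv colel_def rowG_group(1) colG_group(1) colG_group(6)[OF h] sign_id)
  qed
  then show ?thesis by simp
qed

lemma rowG_filter: "{h \<in> Sym n. h \<in> rowG n pos} = rowG n pos"
  by (auto simp: rowG_def)

lemma rowel_square: "conv n (rowel n pos) (rowel n pos) = cscale (of_nat (card (rowG n pos))) (rowel n pos)"
proof
  fix g
  have "conv n (rowel n pos) (rowel n pos) g = (\<Sum>h\<in>Sym n. if h \<in> rowG n pos then rowel n pos g else 0)"
    unfolding conv_def by (intro sum.cong refl) (simp add: rowel_def rowG_group)
  also have "\<dots> = (\<Sum>h\<in>rowG n pos. rowel n pos g)"
    by (simp add: sum.inter_filter[symmetric] rowG_filter)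
  finally show "conv n (rowel n pos) (rowel n pos) g = cscale (of_nat (card (rowG n pos))) (rowel n pos) g"
    by (simp add: cscale_def)
qed

lemma colG_filter: "{h \<in> Sym n. h \<in> colG n pos} = colG n pos"
  by (auto simp: colG_def)

lemma colel_square: "conv n (colel n pos) (colel n pos) = cscale (of_nat (card (colG n pos))) (colel n pos)"
proof
  fix g
  have "conv n (colel n pos) (colel n pos) g = (\<Sum>h\<in>Sym n. if h \<in> colG n pos then colel n pos g else 0)"
    unfolding conv_def
  proof (intro sum.cong refl)
    fix h assume h: "h \<in> Sym n"
    have "sign h * sign (inv h \<circ> g) = sign g" if "g \<in> colG n pos"
      using that h by (simp add: Sym_sign[OF inv_in_Sym] colG_Sym Sym_sign_inv sign_idempotent flip: mult.assoc)
    then have "of_int (sign h) * of_int (sign (inv h \<circ> g)) = (of_int (sign g) :: complex)" if "g \<in> colG n pos"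
      using that by (metis of_int_mult)
    then show "colel n pos h * colel n pos (inv h \<circ> g) = (if h \<in> colG n pos then colel n pos g else 0)"
      by (simp add: colel_def colG_group)
  qed
  also have "\<dots> = (\<Sum>h\<in>colG n pos. colel n pos g)"
    by (simp add: sum.inter_filter[symmetric] colG_filter)
  finally show "conv n (colel n pos) (colel n pos) g = cscale (of_nat (card (colG n pos))) (colel n pos) g"
    by (simp add: cscale_def)
qed

lemma conv_real:
  "(\<And>h. x h \<in> \<real>) \<Longrightarrow> (\<And>h. y h \<in> \<real>) \<Longrightarrow> conv n x y g \<in> \<real>"
  unfolding conv_def by (intro sum_in_Reals Reals_mult)

lemma rowel_real: "rowel n pos g \<in> \<real>" by (simp add: rowel_def)
lemma colel_real: "colel n pos g \<in> \<real>" by (simp add: colel_def)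

lemma ysym_real: "ysym n pos g \<in> \<real>"
  unfolding ysym_def by (intro conv_real rowel_real colel_real)

lemma conv_zero [simp]: "conv n 0 y = 0" "conv n x 0 = 0"
  by (auto simp: conv_def fun_eq_iff)

lemma cscale_zero [simp]: "cscale c 0 = 0"
  by (auto simp: cscale_def fun_eq_iff)

text \<open>If the square vanished, positivity of the bilinear form \<open>x, y \<mapsto> (x * y\<^sup>*)(1)\<close> would successively
  kill \<open>aba\<close> and \<open>ab\<close>, where \<open>a\<close> and \<open>b\<close> are the row sum and the signed column sum.\<close>

lemma ysym_square_nonzero:
  assumes T: "tableau n D pos" shows "conv n (ysym n pos) (ysym n pos) \<noteq> 0"
proof
  assume 0: "conv n (ysym n pos) (ysym n pos) = 0"
  let ?a = "rowel n pos" and ?b = "colel n pos"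
  define ab where "ab = conv n ?a ?b"
  define aba where "aba = conv n ab ?a"
  have inv_ab: "conv n ?a ?b (inv g) = conv n ?b ?a g" if "g \<in> Sym n" for g
    using that by (intro conv_inv) (auto simp: rowel_inv colel_inv)
  have inv_aba: "aba (inv g) = aba g" if g: "g \<in> Sym n" for g
  proof -
    have "aba (inv g) = (\<Sum>h\<in>Sym n. ab h * ?a (inv h \<circ> inv g))" by (simp add: aba_def conv_def)
    also have "\<dots> = (\<Sum>h\<in>Sym n. ab (inv h) * ?a (h \<circ> inv g))"
      by (subst sum_Sym_inv[symmetric]) (simp add: perm_simps Sym_bij)
    also have "\<dots> = (\<Sum>h\<in>Sym n. ?a (g \<circ> inv h) * conv n ?b ?a h)"
    proof (intro sum.cong refl)
      fix h assume h: "h \<in> Sym n"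
      have "?a (h \<circ> inv g) = ?a (inv (h \<circ> inv g))"
        by (rule rowel_inv[symmetric]) (simp add: comp_in_Sym inv_in_Sym h g)
      also have "inv (h \<circ> inv g) = g \<circ> inv h" by (simp add: perm_simps Sym_bij[OF h] Sym_bij[OF g])
      finally have "?a (h \<circ> inv g) = ?a (g \<circ> inv h)" .
      then show "ab (inv h) * ?a (h \<circ> inv g) = ?a (g \<circ> inv h) * conv n ?b ?a h"
        unfolding ab_def inv_ab[OF h] by (simp only: mult.commute)
    qed
    also have "\<dots> = conv n ?a (conv n ?b ?a) g" by (rule conv_alt[OF g, symmetric])
    finally show ?thesis by (simp add: aba_def ab_def conv_assoc)
  qed
  have real: "ab h \<in> \<real>" "aba h \<in> \<real>" for h
    unfolding ab_def aba_def by (intro conv_real rowel_real colel_real)+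
  have "conv n aba aba = conv n ab (conv n (conv n ?a ?a) (conv n ?b ?a))"
    by (simp add: aba_def ab_def conv_assoc)
  also have "\<dots> = cscale (of_nat (card (rowG n pos))) (conv n (conv n ab ab) ?a)"
    by (simp add: rowel_square conv_cscale_left conv_cscale_right ab_def conv_assoc)
  also have "\<dots> = 0" using 0 by (simp add: ysym_def ab_def)
  finally have "conv n aba aba id = 0" by simp
  then have "(\<Sum>h\<in>Sym n. aba h * aba h) = 0" by (simp add: conv_def inv_aba)
  then have "aba h = 0" if "h \<in> Sym n" for h
    using real_square_sum_zero[of "Sym n" aba h] real that by simp
  then have aba0: "aba = 0"
    by (intro GA_eqI[of _ n]) (auto simp: aba_def conv_GA rowel_GA, simp add: GA_def)
  have "conv n ab (conv n ?b ?a) = conv n ?a (conv n (conv n ?b ?b) ?a)"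
    by (simp add: ab_def conv_assoc)
  also have "\<dots> = cscale (of_nat (card (colG n pos))) aba"
    by (simp add: colel_square conv_cscale_left conv_cscale_right aba_def ab_def conv_assoc)
  finally have "conv n ab (conv n ?b ?a) id = 0" using aba0 by simp
  moreover have "conv n ?b ?a (inv h) = ab h" if "h \<in> Sym n" for h
    unfolding ab_def using that by (intro conv_inv) (auto simp: rowel_inv colel_inv)
  ultimately have "(\<Sum>h\<in>Sym n. ab h * ab h) = 0" by (simp add: conv_def[of n ab])
  then have "ab id = 0" using real_square_sum_zero[of "Sym n" ab id] real by simp
  then show False using ysym_id[OF T] by (simp add: ysym_def ab_def)
qed

text \<open>The scalar by which squaring multiplies the Young symmetrizer. It can be read at the
  identity, where the symmetrizer of a tableau has the value 1.\<close>

definition kappa :: "nat \<Rightarrow> (nat \<Rightarrow> nat \<times> nat) \<Rightarrow> complex" where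
  "kappa n pos = conv n (ysym n pos) (ysym n pos) id"

definition idem :: "nat \<Rightarrow> (nat \<Rightarrow> nat \<times> nat) \<Rightarrow> galg" where
  "idem n pos = cscale (1 / kappa n pos) (ysym n pos)"

text \<open>Regrouping (a b) x (a' b') as a (b x a') b' shows the required invariance whatever
  \<open>x\<close> is.\<close>

lemma ysym_sandwich_type:
  "row_col_type n pos pos' (conv n (ysym n pos) (conv n x (ysym n pos')))"
  using row_col_type_conv[of n pos pos' "conv n (colel n pos) (conv n x (rowel n pos'))"]
  by (simp add: ysym_def conv_assoc)

lemma conv_id_left: "y \<in> GA n \<Longrightarrow> conv n (delta id) y = y"
  by (simp add: conv_delta_left) (simp add: left_mult_def)

lemma ysym_type: "row_col_type n pos pos (ysym n pos)"
  using row_col_type_conv[of n pos pos "delta id"] by (simp add: ysym_def conv_id_left colel_GA)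

lemma ysym_sandwich:
  assumes T: "tableau n D pos"
  shows "conv n (ysym n pos) (conv n x (ysym n pos)) =
    cscale (conv n (ysym n pos) (conv n x (ysym n pos)) id) (ysym n pos)"
  by (rule row_col_type_unique[OF T ysym_sandwich_type ysym_type ysym_id[OF T]])

lemma ysym_square:
  assumes T: "tableau n D pos"
  shows "conv n (ysym n pos) (ysym n pos) = cscale (kappa n pos) (ysym n pos)"
  using ysym_sandwich[OF T, of "delta id"] by (simp add: kappa_def conv_id_left ysym_GA)

lemma kappa_nonzero:
  assumes T: "tableau n D pos" shows "kappa n pos \<noteq> 0"
  using ysym_square[OF T] ysym_square_nonzero[OF T] by (auto simp: cscale_def fun_eq_iff)

lemma idem_GA: "idem n pos \<in> GA n"
  by (simp add: idem_def cscale_GA ysym_GA)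

lemma idem_square:
  assumes T: "tableau n D pos" shows "conv n (idem n pos) (idem n pos) = idem n pos"
  using kappa_nonzero[OF T]
  by (simp add: idem_def conv_cscale_left conv_cscale_right ysym_square[OF T])

lemma idem_real: "idem n pos g \<in> \<real>"
  unfolding idem_def cscale_def kappa_def
  by (intro Reals_mult Reals_divide ysym_real conv_real) auto

text \<open>Primitivity of the idempotent e: a sandwich is of row-column type for a single tableau,
  so e A e is the line spanned by e. Irreducibility enters the later arguments in this form.\<close>

lemma idem_sandwich:
  assumes T: "tableau n D pos"
  shows "\<exists>s. conv n (idem n pos) (conv n x (idem n pos)) = cscale s (idem n pos)"
proof -
  let ?y = "ysym n pos" and ?k = "kappa n pos"
  define t where "t = conv n ?y (conv n x ?y) id"
  have "conv n (idem n pos) (conv n x (idem n pos)) = cscale (1 / ?k * (1 / ?k)) (conv n ?y (conv n x ?y))"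
    by (simp add: idem_def conv_cscale_left conv_cscale_right)
  also have "\<dots> = cscale (t / ?k) (idem n pos)"
    unfolding ysym_sandwich[OF T, of x, folded t_def] by (simp add: idem_def)
  finally show ?thesis by blast
qed

text \<open>The comparison is one-sided because rows of the left tableau meet columns of the right
  one. The opposite case is settled on characters, where the inner product is symmetric.\<close>

lemma idem_orthogonal:
  assumes "tableau n D pos" "tableau n E pos'" "card {x \<in> D. fst x < i} > card {x \<in> E. fst x < i}"
  shows "conv n (idem n pos) (conv n x (idem n pos')) = 0"
  using row_col_type_zero[OF ysym_sandwich_type assms, of x]
  by (simp add: idem_def conv_cscale_left conv_cscale_right)

section \<open>Characters as class averages of idempotents\<close>

definition chi :: "nat \<Rightarrow> (nat \<Rightarrow> nat \<times> nat) \<Rightarrow> galg" where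
  "chi n pos = cl n (idem n pos)"

lemma chi_class: "h \<in> Sym n \<Longrightarrow> chi n pos (inv h \<circ> k \<circ> h) = chi n pos k"
  unfolding chi_def by (rule cl_conj)

lemma chi_real: "chi n pos g \<in> \<real>"
  unfolding chi_def cl_def by (intro sum_in_Reals idem_real)

text \<open>Inversion turns row sum times column sum into the product in the other order, and a
  class average does not see the order.\<close>

lemma chi_inv:
  assumes g: "g \<in> Sym n" shows "chi n pos (inv g) = chi n pos g"
proof -
  have "cl n (ysym n pos) (inv g) = (\<Sum>h\<in>Sym n. ysym n pos (inv (inv h \<circ> g \<circ> h)))"
    unfolding cl_def by (intro sum.cong refl) (simp add: perm_simps Sym_bij Sym_bij[OF g])
  also have "\<dots> = (\<Sum>h\<in>Sym n. conv n (colel n pos) (rowel n pos) (inv h \<circ> g \<circ> h))"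
    unfolding ysym_def by (intro sum.cong refl conv_inv) (auto simp: rowel_inv colel_inv comp_in_Sym inv_in_Sym g)
  also have "\<dots> = cl n (ysym n pos) g"
    unfolding ysym_def cl_conv_commute[OF g] by (simp add: cl_def)
  finally show ?thesis by (simp add: chi_def idem_def cl_cscale)
qed

lemma young_row_count_inject:
  assumes D: "young D" and E: "young E"
    and eq: "\<And>i. card {x \<in> D. fst x < i} = card {x \<in> E. fst x < i}"
  shows "D = E"
proof -
  have row: "card {x \<in> F. fst x < Suc i} = card {x \<in> F. fst x < i} + card {j. (i, j) \<in> F}"
    if "young F" for F i
  proof -
    have "{x \<in> F. fst x < Suc i} = {x \<in> F. fst x < i} \<union> Pair i ` {j. (i, j) \<in> F}" by (auto simp: less_Suc_eq)
    moreover have "finite (Pair i ` {j. (i, j) \<in> F})"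
      by (rule finite_subset[OF _ young_finite[OF that]]) auto
    moreover have "{x \<in> F. fst x < i} \<inter> Pair i ` {j. (i, j) \<in> F} = {}" by auto
    ultimately show ?thesis using young_finite[OF that]
      by (simp add: card_Un_disjoint card_image inj_on_def)
  qed
  have set: "{j. (i, j) \<in> F} = {..<card {j. (i, j) \<in> F}}" if "young F" for F i
  proof (rule down_closed_nat)
    have "{j. (i, j) \<in> F} \<subseteq> snd ` F" by force
    then show "finite {j. (i, j) \<in> F}" using young_finite[OF that] finite_subset by blast
  qed (use that in \<open>auto intro: young_le\<close>)
  have rows: "{j. (i, j) \<in> D} = {j. (i, j) \<in> E}" for i
  proof -
    have c: "card {j. (i, j) \<in> D} = card {j. (i, j) \<in> E}"
      using row[OF D, of i] row[OF E, of i] eq[of i] eq[of "Suc i"] by linarith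
    have "{j. (i, j) \<in> D} = {..<card {j. (i, j) \<in> D}}" by (rule set[OF D])
    also have "\<dots> = {..<card {j. (i, j) \<in> E}}" by (simp only: c)
    also have "\<dots> = {j. (i, j) \<in> E}" by (rule set[OF E, symmetric])
    finally show ?thesis .
  qed
  show ?thesis
  proof (rule set_eqI)
    fix x :: "nat \<times> nat"
    show "x \<in> D \<longleftrightarrow> x \<in> E"
      using eqset_imp_iff[OF rows[of "fst x"], of "snd x"] by simp
  qed
qed

lemma chi_inner_branch:
  assumes "m \<le> n"
  shows "(\<Sum>k\<in>Sym m. chi n pos k * chi m pos' k) =
    fact m * (\<Sum>h\<in>Sym n. conv n (idem n pos) (left_mult h (idem m pos')) h)"
proof -
  have "(\<Sum>k\<in>Sym m. chi n pos k * chi m pos' k) = (\<Sum>k\<in>Sym m. cl n (idem n pos) (inv k) * cl m (idem m pos') k)"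
    using chi_inv[OF Sym_mono[OF assms]] by (intro sum.cong refl) (simp add: chi_def)
  then show ?thesis using inner_product_trace[OF assms idem_GA] by simp
qed

text \<open>Partial row counts of different diagrams differ somewhere. The diagram with the larger
  count is put on the left, where all sandwiches vanish.\<close>

lemma chi_orthogonal:
  assumes T: "tableau n D pos" "tableau n E pos'" and "D \<noteq> E"
  shows "(\<Sum>k\<in>Sym n. chi n pos k * chi n pos' k) = 0"
proof -
  have z: "(\<Sum>k\<in>Sym n. chi n pos k * chi n pos' k) = 0"
    if "tableau n D pos" "tableau n E pos'" "card {x \<in> D. fst x < i} > card {x \<in> E. fst x < i}"
    for D E pos pos' i
    using idem_orthogonal[OF that] by (simp add: chi_inner_branch conv_delta_left[symmetric])
  obtain i where "card {x \<in> D. fst x < i} \<noteq> card {x \<in> E. fst x < i}"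
    using young_row_count_inject[of D E] assms by (auto simp: tableau_def)
  then consider "card {x \<in> D. fst x < i} > card {x \<in> E. fst x < i}" | "card {x \<in> D. fst x < i} < card {x \<in> E. fst x < i}"
    by linarith
  then show ?thesis
  proof cases
    case 1 then show ?thesis using z[OF T] by blast
  next
    case 2 then show ?thesis using z[OF T(2,1)] by (simp add: mult.commute)
  qed
qed

text \<open>The trace of v \<mapsto> e v e is 1, as e A e is the line spanned by e.\<close>

lemma chi_norm:
  assumes T: "tableau n D pos"
  shows "(\<Sum>k\<in>Sym n. chi n pos k * chi n pos k) = fact n"
proof -
  let ?e = "idem n pos"
  \<comment> \<open>The scalar in e h e = s(h) e, read at the identity, where e does not vanish. The
    sum of all e(h) s(h) is then the value of e e e = e at the identity, divided by itself.\<close>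
  define s where "s h = conv n ?e (left_mult h ?e) id / ?e id" for h
  have e1: "?e id \<noteq> 0" using kappa_nonzero[OF T] ysym_id[OF T] by (simp add: idem_def cscale_def)
  have s: "conv n ?e (left_mult h ?e) = cscale (s h) ?e" if h: "h \<in> Sym n" for h
  proof -
    obtain t where t: "conv n ?e (left_mult h ?e) = cscale t ?e"
      using idem_sandwich[OF T, of "delta h"] conv_delta_left[OF h] by auto
    then have "s h = t" using e1 by (simp add: s_def cscale_def)
    then show ?thesis using t by simp
  qed
  have "(\<Sum>h\<in>Sym n. conv n ?e (left_mult h ?e) h) = (\<Sum>h\<in>Sym n. ?e h * conv n ?e (left_mult h ?e) id) / ?e id"
    unfolding sum_divide_distrib
  proof (intro sum.cong refl)
    fix h assume "h \<in> Sym n"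
    then have "conv n ?e (left_mult h ?e) h = s h * ?e h" by (simp only: s cscale_def)
    then show "conv n ?e (left_mult h ?e) h = ?e h * conv n ?e (left_mult h ?e) id / ?e id"
      by (simp only: s_def) simp
  qed
  also have "(\<Sum>h\<in>Sym n. ?e h * conv n ?e (left_mult h ?e) id) = conv n ?e (conv n ?e ?e) id"
    by (simp add: conv_expand[of n ?e ?e] conv_sum_right conv_cscale_right sum_fun_apply) (simp add: cscale_def)
  also have "\<dots> = ?e id" by (simp add: idem_square[OF T])
  finally have "(\<Sum>h\<in>Sym n. conv n ?e (left_mult h ?e) h) = 1" using divide_self[OF e1] by (rule trans)
  then show ?thesis by (simp add: chi_inner_branch)
qed

text \<open>With the unit \<open>delta id\<close> as left idempotent, the two-sided trace is the
  dimension of the left ideal A e, which contains e.\<close>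

lemma chi_dim:
  assumes T: "tableau n D pos"
  shows "\<exists>d\<ge>1. chi n pos id = of_nat d"
proof -
  have "(\<Sum>h\<in>Sym n. conv n (delta id) (left_mult h (idem n pos)) h) = chi n pos id"
    unfolding chi_def cl_def
    by (intro sum.cong refl) (simp add: conv_id_left left_mult_GA idem_GA, simp add: left_mult_def perm_simps Sym_bij)
  moreover have "conv n (delta id) (idem n pos) \<noteq> 0"
  proof
    assume "conv n (delta id) (idem n pos) = 0"
    then have "idem n pos id = 0" by (simp add: conv_id_left idem_GA)
    then show False using kappa_nonzero[OF T] ysym_id[OF T] by (simp add: idem_def cscale_def)
  qed
  moreover have "delta id \<in> GA n" by (auto simp: GA_def delta_def)
  ultimately show ?thesis
    using trace_two_sided[OF conv_id_left idem_GA idem_square[OF T]] by force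
qed

section \<open>Restriction to a smaller symmetric group\<close>

lemma conjugate_tableau:
  assumes T: "tableau n D pos" and T': "tableau n D pos'"
  obtains s where "s \<in> Sym n" "\<And>x. x < n \<Longrightarrow> pos' x = pos (s x)"
proof -
  have pos: "bij_betw pos {..<n} D" "bij_betw pos' {..<n} D" using T T' by (auto simp: tableau_def)
  define s where "s = (\<lambda>k. if k < n then inv_into {..<n} pos (pos' k) else k)"
  have "bij_betw (inv_into {..<n} pos \<circ> pos') {..<n} {..<n}"
    using pos(2) bij_betw_inv_into[OF pos(1)] by (rule bij_betw_trans)
  then have "bij_betw s {..<n} {..<n}" by (rule bij_betw_cong[THEN iffD1, rotated]) (simp add: s_def)
  then have "s \<in> Sym n" unfolding Sym_def by (auto intro!: bij_imp_permutes simp: s_def split: if_splits)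
  moreover have "pos' x = pos (s x)" if "x < n" for x
  proof -
    have "pos' x \<in> pos ` {..<n}" using bij_betwE[OF pos(2)] that pos(1) by (auto simp: bij_betw_def)
    then show ?thesis using that by (simp add: s_def f_inv_into_f)
  qed
  ultimately show ?thesis using that by blast
qed

lemma stab_conj:
  fixes f f' :: "nat \<Rightarrow> 'b"
  assumes s: "s \<in> Sym n" and f: "\<And>x. x < n \<Longrightarrow> f' x = f (s x)" and g: "g \<in> Sym n"
  shows "(\<forall>x<n. f (s (g (inv s x))) = f x) \<longleftrightarrow> (\<forall>x<n. f' (g x) = f' x)"
proof
  assume L: "\<forall>x<n. f (s (g (inv s x))) = f x"
  show "\<forall>x<n. f' (g x) = f' x"
  proof (intro allI impI)
    fix x assume x: "x < n"
    then have "f (s (g (inv s (s x)))) = f (s x)" using L Sym_lt[OF s] by blast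
    then show "f' (g x) = f' x" using x Sym_lt[OF g] by (simp add: f bij_is_inj[OF Sym_bij[OF s]])
  qed
next
  assume R: "\<forall>x<n. f' (g x) = f' x"
  show "\<forall>x<n. f (s (g (inv s x))) = f x"
  proof (intro allI impI)
    fix x assume "x < n"
    then have y: "inv s x < n" using Sym_lt[OF inv_in_Sym[OF s]] by blast
    then have "f' (g (inv s x)) = f' (inv s x)" using R by blast
    then show "f (s (g (inv s x))) = f x"
      using y Sym_lt[OF g] by (simp add: f bij_is_surj[OF Sym_bij[OF s]] surj_f_inv_f)
  qed
qed

lemma sign_conj: "s \<in> Sym n \<Longrightarrow> g \<in> Sym n \<Longrightarrow> sign (s \<circ> g \<circ> inv s) = sign g"
  by (simp add: Sym_sign[of _ n] comp_in_Sym inv_in_Sym Sym_sign_inv[of s n] sign_idempotent mult_ac)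

text \<open>Two fillings of one diagram differ by some \<open>s\<close>. Conjugation by
  \<open>s\<close> carries row sums, column sums, their convolutions and \<open>kappa\<close> from
  one to the other, and the class average absorbs it. This freedom allows a filling adapted to a
  subdiagram.\<close>

lemma chi_independent:
  assumes T: "tableau n D pos" and T': "tableau n D pos'" and g: "g \<in> Sym n"
  shows "chi n pos' g = chi n pos g"
proof -
  obtain s where s: "s \<in> Sym n" and pos': "\<And>x. x < n \<Longrightarrow> pos' x = pos (s x)"
    using conjugate_tableau[OF T T'] by blast
  let ?c = "\<lambda>g. s \<circ> g \<circ> inv s"
  have c: "?c g \<in> Sym n" if "g \<in> Sym n" for g
    using that s by (simp add: comp_in_Sym inv_in_Sym)
  have row: "rowel n pos' g = rowel n pos (?c g)" if "g \<in> Sym n" for g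
    using stab_conj[OF s, where f = "\<lambda>x. fst (pos x)" and f' = "\<lambda>x. fst (pos' x)" and g = g] that c[OF that]
    by (simp add: rowel_def rowG_def pos')
  have col: "colel n pos' g = colel n pos (?c g)" if "g \<in> Sym n" for g
    using stab_conj[OF s, where f = "\<lambda>x. snd (pos x)" and f' = "\<lambda>x. snd (pos' x)" and g = g] that c[OF that]
    by (simp add: colel_def colG_def pos' sign_conj[OF s])
  have conv: "conv n x' y' g = conv n x y (?c g)"
    if "\<And>g. g \<in> Sym n \<Longrightarrow> x' g = x (?c g)" "\<And>g. g \<in> Sym n \<Longrightarrow> y' g = y (?c g)" and g: "g \<in> Sym n"
    for x x' y y' g
  proof -
    have "conv n x y (?c g) = (\<Sum>h\<in>Sym n. x (s \<circ> h \<circ> inv s) * y (inv (s \<circ> h \<circ> inv s) \<circ> ?c g))"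
      unfolding conv_def by (rule sum_Sym_conj[OF s, symmetric])
    also have "\<dots> = conv n x' y' g"
      unfolding conv_def
    proof (intro sum.cong refl)
      fix h assume h: "h \<in> Sym n"
      have "inv (s \<circ> h \<circ> inv s) \<circ> ?c g = ?c (inv h \<circ> g)"
        by (simp add: perm_simps Sym_bij[OF h] Sym_bij[OF s])
      then show "x (s \<circ> h \<circ> inv s) * y (inv (s \<circ> h \<circ> inv s) \<circ> ?c g) = x' h * y' (inv h \<circ> g)"
        using that h by (simp add: comp_in_Sym inv_in_Sym)
    qed
    finally show ?thesis by simp
  qed
  have ysym: "ysym n pos' g = ysym n pos (?c g)" if "g \<in> Sym n" for g
    unfolding ysym_def by (rule conv[where x = "rowel n pos" and y = "colel n pos"]) (simp_all add: row col that)
  have "kappa n pos' = conv n (ysym n pos) (ysym n pos) (?c id)"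
    unfolding kappa_def by (rule conv[where x = "ysym n pos" and y = "ysym n pos", symmetric, THEN sym]) (simp_all add: ysym)
  also have "?c id = id" by (simp add: perm_simps Sym_bij[OF s])
  finally have kappa: "kappa n pos' = kappa n pos" by (simp only: kappa_def)
  have "chi n pos' g = (\<Sum>h\<in>Sym n. idem n pos (?c (inv h \<circ> g \<circ> h)))"
    unfolding chi_def cl_def by (intro sum.cong refl)
      (simp add: idem_def cscale_def kappa ysym comp_in_Sym inv_in_Sym g)
  also have "\<dots> = (\<Sum>h\<in>Sym n. idem n pos (?c (inv (h \<circ> s) \<circ> g \<circ> (h \<circ> s))))"
    by (rule sum_Sym_right[OF s, symmetric])
  also have "\<dots> = chi n pos g"
    unfolding chi_def cl_def by (intro sum.cong refl) (simp add: perm_simps Sym_bij Sym_bij[OF s])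
  finally show ?thesis .
qed

lemma Sym_Suc_fix:
  assumes "h \<in> Sym (Suc m)" "h m = m" shows "h \<in> Sym m"
  using assms unfolding Sym_def by (auto intro: permutes_superset simp: less_Suc_eq)

lemma Sym_fix: "h \<in> Sym m \<Longrightarrow> h m = m"
  by (simp add: Sym_def permutes_def)

text \<open>A term survives only if \<open>inv h\<close> preserves rows and
  \<open>inv h \<circ> g\<close> preserves columns. As \<open>g\<close> fixes \<open>m\<close>, the
  letter \<open>inv h m\<close> shares both the row and the column of \<open>m\<close>, so
  \<open>h\<close> fixes \<open>m\<close> and lies in the smaller group.\<close>

lemma ysym_restrict:
  assumes T: "tableau (Suc m) D pos" and T': "tableau m E pos'"
    and pos: "\<And>x. x < m \<Longrightarrow> pos x = pos' x" and g: "g \<in> Sym m"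
  shows "ysym (Suc m) pos g = ysym m pos' g"
proof -
  have stab: "h \<in> rowG (Suc m) pos \<longleftrightarrow> h \<in> rowG m pos'" "h \<in> colG (Suc m) pos \<longleftrightarrow> h \<in> colG m pos'"
    if h: "h \<in> Sym m" for h
  proof -
    have "pos (h x) = pos' (h x)" "pos x = pos' x" if "x < m" for x
      using pos that Sym_lt[OF h] by auto
    then show "h \<in> rowG (Suc m) pos \<longleftrightarrow> h \<in> rowG m pos'" "h \<in> colG (Suc m) pos \<longleftrightarrow> h \<in> colG m pos'"
      using Sym_fix[OF h] h Sym_mono[of m "Suc m"] by (auto simp: rowG_def colG_def less_Suc_eq)
  qed
  have "ysym (Suc m) pos g = (\<Sum>h\<in>Sym m. rowel (Suc m) pos h * colel (Suc m) pos (inv h \<circ> g))"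
    unfolding ysym_def conv_def
  proof (rule sum.mono_neutral_right)
    show "\<forall>h\<in>Sym (Suc m) - Sym m. rowel (Suc m) pos h * colel (Suc m) pos (inv h \<circ> g) = 0"
    proof
      fix h assume h: "h \<in> Sym (Suc m) - Sym m"
      then have hS: "h \<in> Sym (Suc m)" by simp
      show "rowel (Suc m) pos h * colel (Suc m) pos (inv h \<circ> g) = 0"
      proof (rule ccontr)
        assume "rowel (Suc m) pos h * colel (Suc m) pos (inv h \<circ> g) \<noteq> 0"
        then have hr: "inv h \<in> rowG (Suc m) pos" and hc: "inv h \<circ> g \<in> colG (Suc m) pos"
          by (auto simp: rowel_def colel_def rowG_group split: if_splits)
        have "fst (pos (inv h m)) = fst (pos m)" using hr by (simp add: rowG_def)
        moreover have "snd (pos ((inv h \<circ> g) m)) = snd (pos m)" using hc unfolding colG_def by blast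
        ultimately have "pos (inv h m) = pos m" using Sym_fix[OF g] by (simp add: prod_eq_iff)
        moreover have "inv h m < Suc m" using Sym_lt[OF inv_in_Sym[OF hS]] by simp
        ultimately have "inv h m = m"
          using T by (auto simp: tableau_def bij_betw_def inj_on_def)
        then have "h m = m" using Sym_bij[OF hS] by (metis bij_inv_eq_iff)
        then show False using Sym_Suc_fix[OF hS] h by simp
      qed
    qed
  qed (auto intro: Sym_mono[of m "Suc m"])
  also have "\<dots> = ysym m pos' g"
    unfolding ysym_def conv_def by (intro sum.cong refl)
      (simp add: rowel_def colel_def stab comp_in_Sym inv_in_Sym g)
  finally show ?thesis .
qed

text \<open>At the identity, the product sees the larger symmetrizer only on \<open>Sym m\<close>,
  where it agrees with the smaller one. Before rescaling its value is therefore
  \<open>kappa m pos'\<close>.\<close>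

lemma branch_nonzero:
  assumes T: "tableau (Suc m) D pos" and T': "tableau m E pos'"
    and pos: "\<And>x. x < m \<Longrightarrow> pos x = pos' x"
  shows "conv (Suc m) (idem (Suc m) pos) (idem m pos') \<noteq> 0"
proof
  assume 0: "conv (Suc m) (idem (Suc m) pos) (idem m pos') = 0"
  have "conv (Suc m) (ysym (Suc m) pos) (ysym m pos') id = (\<Sum>h\<in>Sym m. ysym (Suc m) pos h * ysym m pos' (inv h \<circ> id))"
    unfolding conv_def
    by (rule sum.mono_neutral_right)
      (auto intro: Sym_mono[of m "Suc m"] simp: GA_zero[OF ysym_GA] dest: inv_in_Sym
        intro!: GA_zero[OF ysym_GA] simp: Sym_bij perm_simps)
  also have "\<dots> = kappa m pos'"
    unfolding kappa_def conv_def by (intro sum.cong refl) (simp add: ysym_restrict[OF T T' pos])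
  finally have "conv (Suc m) (idem (Suc m) pos) (idem m pos') id = 1 / kappa (Suc m) pos * (1 / kappa m pos' * kappa m pos')"
    by (simp add: idem_def conv_cscale_left conv_cscale_right) (simp add: cscale_def)
  then show False using 0 kappa_nonzero[OF T] kappa_nonzero[OF T'] by simp
qed

section \<open>Characters indexed by diagrams\<close>

definition diagrams :: "nat \<Rightarrow> (nat \<times> nat) set set" where
  "diagrams n = {D. young D \<and> card D = n}"

definition sp_char :: "(nat \<times> nat) set \<Rightarrow> galg" where
  "sp_char D = chi (card D) (SOME pos. tableau (card D) D pos)"

lemma tableau_exists: "D \<in> diagrams n \<Longrightarrow> \<exists>pos. tableau n D pos"
  using ex_bij_betw_nat_finite[of D] by (auto simp: diagrams_def tableau_def young_def atLeast0LessThan)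

lemma sp_char_eq:
  assumes "tableau n D pos" "g \<in> Sym n" shows "sp_char D g = chi n pos g"
proof -
  have n: "card D = n" using assms(1) bij_betw_same_card by (fastforce simp: tableau_def)
  have "tableau n D (SOME pos. tableau n D pos)" using assms(1) by (rule someI[where P = "tableau n D"])
  then show ?thesis unfolding sp_char_def n using chi_independent[OF assms(1) _ assms(2)] by blast
qed

lemma sp_char_some:
  assumes "D \<in> diagrams n"
  obtains pos where "tableau n D pos" "\<And>g. g \<in> Sym n \<Longrightarrow> sp_char D g = chi n pos g"
  using tableau_exists[OF assms] sp_char_eq by blast

lemma sp_char_class:
  assumes "D \<in> diagrams n" "h \<in> Sym n" "k \<in> Sym n"
  shows "sp_char D (inv h \<circ> k \<circ> h) = sp_char D k"
  using sp_char_some[OF assms(1)] chi_class[OF assms(2)] assms(2,3) by (metis comp_in_Sym inv_in_Sym)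

lemma sp_char_real: "sp_char D g \<in> \<real>"
  unfolding sp_char_def by (rule chi_real)

lemma sp_char_orthonormal:
  assumes "D \<in> diagrams n" "E \<in> diagrams n"
  shows "(\<Sum>k\<in>Sym n. sp_char D k * sp_char E k) = (if D = E then fact n else 0)"
proof -
  obtain pos pos' where T: "tableau n D pos" "\<And>g. g \<in> Sym n \<Longrightarrow> sp_char D g = chi n pos g"
    "tableau n E pos'" "\<And>g. g \<in> Sym n \<Longrightarrow> sp_char E g = chi n pos' g"
    using sp_char_some assms by metis
  show ?thesis
  proof (cases "D = E")
    case True
    have "(\<Sum>k\<in>Sym n. sp_char D k * sp_char E k) = (\<Sum>k\<in>Sym n. chi n pos k * chi n pos k)"
      by (intro sum.cong refl) (simp add: T(2) True[symmetric])
    then show ?thesis using True chi_norm[OF T(1)] by simp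
  next
    case False
    have "(\<Sum>k\<in>Sym n. sp_char D k * sp_char E k) = (\<Sum>k\<in>Sym n. chi n pos k * chi n pos' k)"
      by (intro sum.cong refl) (simp add: T)
    then show ?thesis using False chi_orthogonal[OF T(1,3)] by simp
  qed
qed

lemma sp_char_dim:
  assumes "D \<in> diagrams n" shows "\<exists>d\<ge>1. sp_char D id = of_nat d"
  using sp_char_some[OF assms] chi_dim by (metis id_in_Sym)

text \<open>The number d is the dimension of e A f in the larger group algebra, where the idempotent
  f of \<open>E\<close> remains idempotent. For \<open>E\<close> inside \<open>D\<close> the filling
  of \<open>D\<close> is chosen so that e f is visibly nonzero.\<close>

lemma sp_char_branch:
  assumes D: "D \<in> diagrams (Suc m)" and E: "E \<in> diagrams m"
  shows "\<exists>d. (\<Sum>k\<in>Sym m. sp_char D k * sp_char E k) = fact m * of_nat d \<and> (E \<subseteq> D \<longrightarrow> d \<ge> 1)"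
proof -
  obtain pos' where T': "tableau m E pos'" "\<And>g. g \<in> Sym m \<Longrightarrow> sp_char E g = chi m pos' g"
    using sp_char_some[OF E] by blast
  have main: "\<exists>d. (\<Sum>k\<in>Sym m. sp_char D k * sp_char E k) = fact m * of_nat d \<and>
      (conv (Suc m) (idem (Suc m) pos) (idem m pos') \<noteq> 0 \<longrightarrow> d \<ge> 1)"
    if T: "tableau (Suc m) D pos" for pos
  proof -
    have "conv (Suc m) (idem m pos') (idem m pos') = idem m pos'"
      using idem_square[OF T'(1)] conv_restrict[OF _ idem_GA, of m "Suc m"] by simp
    from trace_two_sided[OF idem_square[OF T] GA_mono[OF _ idem_GA] this]
    obtain d where "(\<Sum>h\<in>Sym (Suc m). conv (Suc m) (idem (Suc m) pos) (left_mult h (idem m pos')) h) = of_nat d"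
      "conv (Suc m) (idem (Suc m) pos) (idem m pos') \<noteq> 0 \<longrightarrow> d \<ge> 1" by auto
    moreover have "(\<Sum>k\<in>Sym m. sp_char D k * sp_char E k) = (\<Sum>k\<in>Sym m. chi (Suc m) pos k * chi m pos' k)"
      by (intro sum.cong refl) (simp add: T'(2) sp_char_eq[OF T] Sym_mono[of m "Suc m"])
    ultimately show ?thesis by (simp add: chi_inner_branch)
  qed
  show ?thesis
  proof (cases "E \<subseteq> D")
    case True
    have "finite E" "finite D" "card D = Suc m" "card E = m"
      using D E by (auto simp: diagrams_def young_def)
    then have "card (D - E) = 1" using True by (simp add: card_Diff_subset)
    then obtain c where "D - E = {c}" by (auto simp: card_1_singleton_iff)
    then have c: "D = insert c E" "c \<notin> E" using True by auto
    \<comment> \<open>The filling of \<open>E\<close> is extended by the last letter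
      \<open>m\<close>, placed in the extra cell.\<close>
    define p where "p = pos'(m := c)"
    have p: "p m = c" "\<And>x. x < m \<Longrightarrow> p x = pos' x" by (auto simp: p_def)
    have "bij_betw p {..<m} E"
    proof (rule bij_betw_cong[THEN iffD1])
      show "bij_betw pos' {..<m} E" using T'(1) by (simp add: tableau_def)
    qed (simp add: p)
    then have "bij_betw p (insert m {..<m}) (insert c E)"
      using c(2) p(1) by (auto simp: bij_betw_def inj_on_insert)
    then have T: "tableau (Suc m) D p" using D by (simp add: tableau_def diagrams_def c lessThan_Suc)
    show ?thesis using main[OF T] branch_nonzero[OF T T'(1) p(2)] by auto
  next
    case False
    then show ?thesis using main tableau_exists[OF D] by blast
  qed
qed

text \<open>Schur's lemma for central \<open>F\<close>: F e = F e e = e F e is a multiple of e, and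
  averaging carries the scalar over to the character.\<close>

lemma sp_char_conv_class:
  assumes D: "D \<in> diagrams n" and F: "F \<in> GA n" "\<And>h k. h \<in> Sym n \<Longrightarrow> k \<in> Sym n \<Longrightarrow> F (inv h \<circ> k \<circ> h) = F k"
  shows "\<exists>s. \<forall>g\<in>Sym n. conv n F (sp_char D) g = s * sp_char D g"
proof -
  obtain pos where T: "tableau n D pos" "\<And>g. g \<in> Sym n \<Longrightarrow> sp_char D g = chi n pos g"
    using sp_char_some[OF D] by blast
  let ?e = "idem n pos"
  have "conv n F ?e = conv n (conv n F ?e) ?e" by (simp add: conv_assoc idem_square[OF T(1)])
  also have "\<dots> = conv n (conv n ?e F) ?e" by (simp only: class_central[OF F idem_GA, of pos])
  also have "\<dots> = conv n ?e (conv n F ?e)" by (rule conv_assoc)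
  finally have eq: "conv n F ?e = conv n ?e (conv n F ?e)" .
  obtain s where "conv n ?e (conv n F ?e) = cscale s ?e" using idem_sandwich[OF T(1), of F] by blast
  with eq have s: "conv n F ?e = cscale s ?e" by (rule trans)
  have "conv n F (sp_char D) g = s * sp_char D g" if g: "g \<in> Sym n" for g
  proof -
    have "conv n F (sp_char D) g = conv n F (chi n pos) g"
      unfolding conv_def by (intro sum.cong refl) (simp add: T(2) comp_in_Sym inv_in_Sym g)
    also have "\<dots> = cl n (conv n F ?e) g" 
      using cl_conv_class[where F = F and n = n and x = ?e and g = g] F(2) g by (simp only: chi_def)
    finally show ?thesis by (simp add: s cl_cscale T(2)[OF g] chi_def)
  qed
  then show ?thesis by blast
qed

section \<open>Young's lattice\<close>

lemma young_Un: "young D \<Longrightarrow> young E \<Longrightarrow> young (D \<union> E)"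
  unfolding young_def by blast

lemma young_Int: "young D \<Longrightarrow> young E \<Longrightarrow> young (D \<inter> E)"
  unfolding young_def by blast

lemma diagramsD: "D \<in> diagrams n \<Longrightarrow> young D" "D \<in> diagrams n \<Longrightarrow> card D = n"
  "D \<in> diagrams n \<Longrightarrow> finite D"
  by (auto simp: diagrams_def young_def)

definition rowlen :: "(nat \<times> nat) set \<Rightarrow> nat \<Rightarrow> nat" where
  "rowlen D i = card {j. (i, j) \<in> D}"

lemma mem_rowlen:
  assumes "young D" shows "(i, j) \<in> D \<longleftrightarrow> j < rowlen D i"
proof -
  have "{j. (i, j) \<in> D} = {..<rowlen D i}"
    unfolding rowlen_def
  proof (rule down_closed_nat)
    have "{j. (i, j) \<in> D} \<subseteq> snd ` D" by force
    then show "finite {j. (i, j) \<in> D}" using young_finite[OF assms] finite_subset by blast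
  qed (use assms in \<open>auto intro: young_le\<close>)
  from eqset_imp_iff[OF this, of j] show ?thesis by simp
qed

lemma rowlen_antimono:
  assumes "young D" "i \<le> i'" shows "rowlen D i' \<le> rowlen D i"
proof (rule ccontr)
  assume "\<not> ?thesis"
  then have "(i', rowlen D i) \<in> D" by (simp add: mem_rowlen[OF assms(1)])
  then have "(i, rowlen D i) \<in> D" using young_le[OF assms(1)] assms(2) by blast
  then show False by (simp add: mem_rowlen[OF assms(1)])
qed

lemma finite_diagrams [simp]: "finite (diagrams n)"
proof (rule finite_subset)
  show "diagrams n \<subseteq> Pow ({..<n} \<times> {..<n})"
  proof clarify
    fix D i j assume D: "D \<in> diagrams n" and ij: "(i, j) \<in> D"
    have "(\<lambda>a. (a, j)) ` {..i} \<subseteq> D" "Pair i ` {..j} \<subseteq> D"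
      using young_le[OF diagramsD(1)[OF D] ij] by auto
    then have "card ((\<lambda>a. (a, j)) ` {..i}) \<le> card D" "card (Pair i ` {..j}) \<le> card D"
      using diagramsD(3)[OF D] by (auto intro: card_mono)
    then have "Suc i \<le> n" "Suc j \<le> n"
      using diagramsD(2)[OF D] by (simp_all add: card_image inj_on_def)
    then show "i \<in> {..<n} \<and> j \<in> {..<n}" by simp
  qed
qed simp

definition outer_corners :: "(nat \<times> nat) set \<Rightarrow> (nat \<times> nat) set" where
  "outer_corners D = {(i, j) \<in> D. (i, Suc j) \<notin> D \<and> (Suc i, j) \<notin> D}"

lemma young_remove:
  assumes D: "young D" and c: "c \<in> D"
  shows "young (D - {c}) \<longleftrightarrow> c \<in> outer_corners D"
proof -
  obtain i j where ij: "c = (i, j)" by (cases c)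
  show ?thesis
  proof
    assume Y: "young (D - {c})"
    have "(i, Suc j) \<notin> D" using young_le[OF Y, of i "Suc j" i j] by (auto simp: ij)
    moreover have "(Suc i, j) \<notin> D" using young_le[OF Y, of "Suc i" j i j] by (auto simp: ij)
    ultimately show "c \<in> outer_corners D" using c by (simp add: ij outer_corners_def)
  next
    assume "c \<in> outer_corners D"
    then have n: "(i, Suc j) \<notin> D" "(Suc i, j) \<notin> D" by (auto simp: ij outer_corners_def)
    show "young (D - {c})"
      unfolding young_def
    proof (intro conjI allI impI)
      show "finite (D - {c})" using young_finite[OF D] by simp
      fix a b a' b' assume ab: "(a, b) \<in> D - {c}" "a' \<le> a" "b' \<le> b"
      then have D': "(a', b') \<in> D" using young_le[OF D, of a b a' b'] by simp
      have "(a', b') \<noteq> (i, j)"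
      proof
        assume eq: "(a', b') = (i, j)"
        then consider "Suc j \<le> b" | "Suc i \<le> a" using ab by (fastforce simp: ij)
        then show False
        proof cases
          case 1
          have "(i, Suc j) \<in> D" by (rule young_le[OF D, of a b]) (use 1 eq ab in auto)
          with n show False by simp
        next
          case 2
          have "(Suc i, j) \<in> D" by (rule young_le[OF D, of a b]) (use 2 eq ab in auto)
          with n show False by simp
        qed
      qed
      then show "(a', b') \<in> D - {c}" using D' by (simp add: ij)
    qed
  qed
qed

lemma down_eq:
  assumes D: "young D"
  shows "{F. young F \<and> Suc (card F) = card D \<and> F \<subseteq> D} = (\<lambda>c. D - {c}) ` outer_corners D"
proof (intro equalityI subsetI)
  fix F assume F: "F \<in> {F. young F \<and> Suc (card F) = card D \<and> F \<subseteq> D}"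
  have "card (D - F) = 1" using F card_Diff_subset[of F D] young_finite[of F] by auto
  then obtain c where c: "D - F = {c}" by (auto simp: card_1_singleton_iff)
  then have F': "F = D - {c}" using F by auto
  then have "c \<in> outer_corners D" using young_remove[OF D, of c] F c by auto
  then show "F \<in> (\<lambda>c. D - {c}) ` outer_corners D" using F' by blast
next
  fix F assume "F \<in> (\<lambda>c. D - {c}) ` outer_corners D"
  then obtain c where c: "c \<in> outer_corners D" "F = D - {c}" by blast
  then have "c \<in> D" by (auto simp: outer_corners_def)
  then show "F \<in> {F. young F \<and> Suc (card F) = card D \<and> F \<subseteq> D}"
    using c young_remove[OF D, of c] card_Suc_Diff1[OF young_finite[OF D], of c] by auto
qed

lemma card_down:
  assumes D: "young D"
  shows "card {F. young F \<and> Suc (card F) = card D \<and> F \<subseteq> D} = card (outer_corners D)"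
proof -
  have "inj_on (\<lambda>c. D - {c}) (outer_corners D)"
  proof (rule inj_onI)
    fix x y assume "x \<in> outer_corners D" "D - {x} = D - {y}"
    then have "x \<in> D" "x \<notin> D - {y}" by (auto simp: outer_corners_def)
    then show "x = y" by simp
  qed
  then show ?thesis unfolding down_eq[OF D] by (rule card_image)
qed

lemma outer_corners_rowlen:
  assumes D: "young D"
  shows "outer_corners D = (\<lambda>i. (i, rowlen D i - 1)) ` {i. rowlen D (Suc i) < rowlen D i}"
proof (intro equalityI subsetI)
  fix c assume c: "c \<in> outer_corners D"
  obtain i j where ij: "c = (i, j)" by (cases c)
  have "j < rowlen D i" "\<not> Suc j < rowlen D i" "\<not> j < rowlen D (Suc i)"
    using c by (auto simp: outer_corners_def ij mem_rowlen[OF D])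
  then have "j = rowlen D i - 1" "rowlen D (Suc i) < rowlen D i" by auto
  then show "c \<in> (\<lambda>i. (i, rowlen D i - 1)) ` {i. rowlen D (Suc i) < rowlen D i}" by (auto simp: ij)
qed (auto simp: outer_corners_def mem_rowlen[OF D])

lemma finite_descents:
  assumes D: "young D" shows "finite {i. rowlen D (Suc i) < rowlen D i}"
proof (rule finite_subset)
  show "{i. rowlen D (Suc i) < rowlen D i} \<subseteq> fst ` D"
  proof
    fix i assume "i \<in> {i. rowlen D (Suc i) < rowlen D i}"
    then have "(i, 0) \<in> D" by (simp add: mem_rowlen[OF D])
    then show "i \<in> fst ` D" by force
  qed
qed (use young_finite[OF D] in simp)

lemma up_eq:
  assumes D: "D \<in> diagrams n"
  shows "{F \<in> diagrams (Suc n). D \<subseteq> F} =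
    (\<lambda>i. insert (i, rowlen D i) D) ` insert 0 (Suc ` {i. rowlen D (Suc i) < rowlen D i})"
proof -
  let ?r = "rowlen D"
  have Y: "young D" by (rule diagramsD(1)[OF D])
  \<comment> \<open>Row \<open>i\<close> accepts a new cell exactly if all rows below it are
    strictly longer; as lengths decrease weakly, only the row just below has to be checked.\<close>
  have rows: "insert 0 (Suc ` {i. ?r (Suc i) < ?r i}) = {i. \<forall>k<i. ?r i < ?r k}"
  proof (intro equalityI subsetI)
    fix i assume "i \<in> insert 0 (Suc ` {i. ?r (Suc i) < ?r i})"
    then consider "i = 0" | k where "i = Suc k" "?r (Suc k) < ?r k" by auto
    then show "i \<in> {i. \<forall>k<i. ?r i < ?r k}"
    proof cases
      case 2
      then have "?r i < ?r k'" if "k' < i" for k'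
        using rowlen_antimono[OF Y, of k' k] that by simp
      then show ?thesis by simp
    qed simp
  next
    fix i assume "i \<in> {i. \<forall>k<i. ?r i < ?r k}"
    then show "i \<in> insert 0 (Suc ` {i. ?r (Suc i) < ?r i})" by (cases i) auto
  qed
  show ?thesis unfolding rows
  proof (intro equalityI subsetI)
    fix F assume F: "F \<in> {F \<in> diagrams (Suc n). D \<subseteq> F}"
    then have YF: "young F" and DF: "D \<subseteq> F" by (auto intro: diagramsD)
    have "card (F - D) = 1" using F diagramsD(2,3)[OF D] diagramsD(2)[of F "Suc n"] by (simp add: card_Diff_subset)
    then obtain i j where "F - D = {(i, j)}" by (auto simp: card_1_singleton_iff)
    then have c: "F = insert (i, j) D" "(i, j) \<notin> D" using DF by auto
    have "?r i \<le> j" using c(2) by (simp add: mem_rowlen[OF Y])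
    moreover have "(i, ?r i) \<in> F" by (rule young_le[OF YF, of i j]) (use c \<open>?r i \<le> j\<close> in auto)
    ultimately have j: "j = ?r i" using c by (auto simp: mem_rowlen[OF Y])
    have "?r i < ?r k" if "k < i" for k
    proof -
      have "(k, ?r i) \<in> F" by (rule young_le[OF YF, of i j]) (use c j that in auto)
      then show ?thesis using c that by (auto simp: mem_rowlen[OF Y])
    qed
    then show "F \<in> (\<lambda>i. insert (i, ?r i) D) ` {i. \<forall>k<i. ?r i < ?r k}" using c j by auto
  next
    fix F assume "F \<in> (\<lambda>i. insert (i, ?r i) D) ` {i. \<forall>k<i. ?r i < ?r k}"
    then obtain i where i: "F = insert (i, ?r i) D" "\<forall>k<i. ?r i < ?r k" by auto
    have "young F"
      unfolding young_def
    proof (intro conjI allI impI)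
      show "finite F" using i young_finite[OF Y] by simp
      fix a b a' b' assume ab: "(a, b) \<in> F" "a' \<le> a" "b' \<le> b"
      show "(a', b') \<in> F"
      proof (cases "(a, b) \<in> D")
        case True
        then show ?thesis using ab young_le[OF Y, of a b a' b'] i by simp
      next
        case False
        then have e: "a = i" "b = ?r i" using ab i by auto
        show ?thesis
        proof (cases "a' = i")
          case True
          then show ?thesis using ab e i by (auto simp: mem_rowlen[OF Y])
        next
          case False
          then have "?r i < ?r a'" using i ab e by simp
          then show ?thesis using ab e i by (simp add: mem_rowlen[OF Y])
        qed
      qed
    qed
    moreover have "card F = Suc n"
      using i diagramsD(2,3)[OF D] by (simp add: mem_rowlen[OF Y])
    ultimately show "F \<in> {F \<in> diagrams (Suc n). D \<subseteq> F}" using i by (auto simp: diagrams_def)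
  qed
qed

text \<open>Each strict drop of row lengths gives one removable cell, in the row before it, and one
  addable cell, in the row after it. Row 0 adds one more addable cell.\<close>

lemma card_up:
  assumes D: "D \<in> diagrams n"
  shows "card {F \<in> diagrams (Suc n). D \<subseteq> F} = Suc (card (outer_corners D))"
proof -
  let ?r = "rowlen D" and ?B = "{i. rowlen D (Suc i) < rowlen D i}"
  have Y: "young D" by (rule diagramsD(1)[OF D])
  have "inj_on (\<lambda>i. insert (i, ?r i) D) (insert 0 (Suc ` ?B))"
  proof (rule inj_onI)
    fix i k assume "insert (i, ?r i) D = insert (k, ?r k) D"
    then have "(i, ?r i) \<in> insert (k, ?r k) D" by auto
    then show "i = k" by (auto simp: mem_rowlen[OF Y])
  qed
  then have "card {F \<in> diagrams (Suc n). D \<subseteq> F} = card (insert 0 (Suc ` ?B))"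
    unfolding up_eq[OF D] by (rule card_image)
  also have "\<dots> = Suc (card ?B)"
    using finite_descents[OF Y] by (simp add: card_insert_if card_image image_iff)
  also have "card ?B = card (outer_corners D)"
    unfolding outer_corners_rowlen[OF Y] by (rule card_image[symmetric]) (simp add: inj_on_def)
  finally show ?thesis .
qed

text \<open>This is DU - UD = I on Young's lattice, entry by entry. Off the diagonal the only
  candidates are the union and the intersection; their sizes add up to 2n, so one is admissible
  exactly if the other is. The form \<open>Suc (card F) = n\<close> also covers n = 0, where nothing
  lies below.\<close>

lemma common_neighbours:
  assumes D: "D \<in> diagrams n" and E: "E \<in> diagrams n"
  shows "card {F \<in> diagrams (Suc n). D \<subseteq> F \<and> E \<subseteq> F} =
    card {F. young F \<and> Suc (card F) = n \<and> F \<subseteq> D \<and> F \<subseteq> E} + (if D = E then 1 else 0)"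
proof (cases "D = E")
  case True
  then show ?thesis using card_up[OF D] card_down[OF diagramsD(1)[OF D]] diagramsD(2)[OF D] by simp
next
  case False
  note d = diagramsD[OF D] diagramsD[OF E]
  have ui: "card (D \<union> E) + card (D \<inter> E) = n + n" using card_Un_Int[of D E] d by simp
  have "card (D \<inter> E) < n"
  proof -
    have "D \<inter> E \<noteq> D" using False d card_subset_eq[of E D] by auto
    then show ?thesis using psubset_card_mono[of D "D \<inter> E"] d by auto
  qed
  have up: "{F \<in> diagrams (Suc n). D \<subseteq> F \<and> E \<subseteq> F} = (if card (D \<union> E) = Suc n then {D \<union> E} else {})"
  proof -
    have eq: "F = D \<union> E" if F: "F \<in> diagrams (Suc n)" "D \<subseteq> F" "E \<subseteq> F" for F
    proof (rule card_seteq[symmetric])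
      show "card F \<le> card (D \<union> E)" using \<open>card (D \<inter> E) < n\<close> ui diagramsD(2)[OF F(1)] by simp
    qed (use F diagramsD in auto)
    have mem: "D \<union> E \<in> diagrams (Suc n) \<longleftrightarrow> card (D \<union> E) = Suc n"
      using young_Un[OF d(1,4)] by (simp add: diagrams_def)
    show ?thesis
    proof (rule set_eqI)
      fix F
      show "F \<in> {F \<in> diagrams (Suc n). D \<subseteq> F \<and> E \<subseteq> F} \<longleftrightarrow> F \<in> (if card (D \<union> E) = Suc n then {D \<union> E} else {})"
        using eq[of F] mem by (cases "F = D \<union> E") auto
    qed
  qed
  have down: "{F. young F \<and> Suc (card F) = n \<and> F \<subseteq> D \<and> F \<subseteq> E} = (if Suc (card (D \<inter> E)) = n then {D \<inter> E} else {})"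
  proof -
    have eq: "F = D \<inter> E" if F: "young F" "Suc (card F) = n" "F \<subseteq> D" "F \<subseteq> E" for F
    proof (rule card_seteq)
      show "card (D \<inter> E) \<le> card F" using \<open>card (D \<inter> E) < n\<close> F by simp
    qed (use F d in auto)
    show ?thesis
    proof (rule set_eqI)
      fix F
      show "F \<in> {F. young F \<and> Suc (card F) = n \<and> F \<subseteq> D \<and> F \<subseteq> E} \<longleftrightarrow> F \<in> (if Suc (card (D \<inter> E)) = n then {D \<inter> E} else {})"
        using eq[of F] young_Int[OF d(1,4)] by (cases "F = D \<inter> E") auto
    qed
  qed
  have "card (D \<union> E) = Suc n \<longleftrightarrow> Suc (card (D \<inter> E)) = n" using ui by linarith
  then show ?thesis using False by (simp add: up down)
qed

text \<open>For \<open>D\<close> in \<open>diagrams n\<close>: chains of diagrams from the empty one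
  up to \<open>D\<close>, that is, standard tableaux of shape \<open>D\<close>.\<close>

primrec nsyt :: "nat \<Rightarrow> (nat \<times> nat) set \<Rightarrow> nat" where
  "nsyt 0 D = 1"
| "nsyt (Suc n) D = (\<Sum>E | E \<in> diagrams n \<and> E \<subseteq> D. nsyt n E)"

lemma sum_swap_rel:
  assumes "finite A" "finite B"
  shows "(\<Sum>x | x \<in> A \<and> P x. \<Sum>y | y \<in> B \<and> Q x y. f y) = (\<Sum>y\<in>B. card {x \<in> A. P x \<and> Q x y} * (f y :: nat))"
proof -
  have "(\<Sum>x | x \<in> A \<and> P x. \<Sum>y | y \<in> B \<and> Q x y. f y) = (\<Sum>y\<in>B. \<Sum>x | x \<in> {x. x \<in> A \<and> P x} \<and> Q x y. f y)"
    by (rule sum.swap_restrict) (use assms in auto)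
  then show ?thesis by (simp add: conj_assoc)
qed

text \<open>Expanding \<open>nsyt\<close> of the larger diagrams gives a down-step after an up-step.
  Exchanging the two costs one identity, which raises the factor by one at each level.\<close>

lemma nsyt_up:
  assumes "D \<in> diagrams n"
  shows "(\<Sum>F | F \<in> diagrams (Suc n) \<and> D \<subseteq> F. nsyt (Suc n) F) = Suc n * nsyt n D"
  using assms
proof (induction n arbitrary: D)
  case 0
  have *: "{E. E \<in> diagrams 0 \<and> E \<subseteq> F} = {{}}" for F
    by (auto simp: diagrams_def young_def)
  have "card {F. F \<in> diagrams (Suc 0) \<and> D \<subseteq> F} = 1"
    using common_neighbours[OF 0 0] by simp
  then show ?case by (simp add: *)
next
  case (Suc n)
  have "(\<Sum>F | F \<in> diagrams (Suc (Suc n)) \<and> D \<subseteq> F. nsyt (Suc (Suc n)) F) =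
      (\<Sum>E\<in>diagrams (Suc n). card {F \<in> diagrams (Suc (Suc n)). D \<subseteq> F \<and> E \<subseteq> F} * nsyt (Suc n) E)"
    unfolding nsyt.simps(2)[of "Suc n"] by (rule sum_swap_rel) simp_all
  also have "\<dots> = (\<Sum>E\<in>diagrams (Suc n). card {F \<in> diagrams n. F \<subseteq> D \<and> F \<subseteq> E} * nsyt (Suc n) E) +
      (\<Sum>E\<in>diagrams (Suc n). if D = E then nsyt (Suc n) E else 0)"
    unfolding sum.distrib[symmetric]
  proof (intro sum.cong refl)
    fix E assume E: "E \<in> diagrams (Suc n)"
    have "{F. young F \<and> Suc (card F) = Suc n \<and> F \<subseteq> D \<and> F \<subseteq> E} = {F \<in> diagrams n. F \<subseteq> D \<and> F \<subseteq> E}"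
      by (auto simp: diagrams_def)
    then have "card {F \<in> diagrams (Suc (Suc n)). D \<subseteq> F \<and> E \<subseteq> F} =
        card {F \<in> diagrams n. F \<subseteq> D \<and> F \<subseteq> E} + (if D = E then 1 else 0)"
      using common_neighbours[OF Suc.prems E] by simp
    then show "card {F \<in> diagrams (Suc (Suc n)). D \<subseteq> F \<and> E \<subseteq> F} * nsyt (Suc n) E =
        card {F \<in> diagrams n. F \<subseteq> D \<and> F \<subseteq> E} * nsyt (Suc n) E + (if D = E then nsyt (Suc n) E else 0)"
      by (simp only: distrib_right) simp
  qed
  also have "(\<Sum>E\<in>diagrams (Suc n). if D = E then nsyt (Suc n) E else 0) = nsyt (Suc n) D"
    using Suc.prems by simp
  also have "(\<Sum>E\<in>diagrams (Suc n). card {F \<in> diagrams n. F \<subseteq> D \<and> F \<subseteq> E} * nsyt (Suc n) E) =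
      (\<Sum>F | F \<in> diagrams n \<and> F \<subseteq> D. \<Sum>E | E \<in> diagrams (Suc n) \<and> F \<subseteq> E. nsyt (Suc n) E)"
    by (rule sum_swap_rel[symmetric]) simp_all
  also have "\<dots> = (\<Sum>F | F \<in> diagrams n \<and> F \<subseteq> D. Suc n * nsyt n F)"
    by (rule sum.cong[OF refl]) (use Suc.IH in blast)
  also have "\<dots> = Suc n * nsyt (Suc n) D" by (simp only: nsyt.simps(2) sum_distrib_left)
  finally show ?case by simp
qed

text \<open>Up and down are adjoint: the down-step in one factor becomes an up-step on the other,
  where \<open>nsyt_up\<close> evaluates it.\<close>

lemma sum_nsyt_squares: "(\<Sum>D\<in>diagrams n. nsyt n D * nsyt n D) = fact n"
proof (induction n)
  case 0
  have "diagrams 0 = {{}}" by (auto simp: diagrams_def young_def)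
  then show ?case by simp
next
  case (Suc n)
  have "(\<Sum>D\<in>diagrams (Suc n). nsyt (Suc n) D * nsyt (Suc n) D) =
      (\<Sum>D\<in>diagrams (Suc n). \<Sum>E | E \<in> diagrams n \<and> E \<subseteq> D. nsyt (Suc n) D * nsyt n E)"
    by (simp add: sum_distrib_left)
  also have "\<dots> = (\<Sum>E\<in>diagrams n. \<Sum>D | D \<in> diagrams (Suc n) \<and> E \<subseteq> D. nsyt (Suc n) D * nsyt n E)"
    by (rule sum.swap_restrict) simp_all
  also have "\<dots> = (\<Sum>E\<in>diagrams n. (Suc n * nsyt n E) * nsyt n E)"
    unfolding sum_distrib_right[symmetric] by (intro sum.cong refl) (simp only: nsyt_up)
  also have "\<dots> = Suc n * fact n" by (simp only: mult.assoc sum_distrib_left[symmetric] Suc.IH)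
  finally show ?case by simp
qed

section \<open>Completeness and the branching rule\<close>

text \<open>\<open>rho\<close> is the regular character minus its candidate decomposition, and
  orthonormality gives its norm as in Pythagoras. The degrees \<open>d\<close> stay general: the
  upper bound uses them while unknown, completeness with \<open>nsyt\<close> in their place.\<close>

lemma deviation_norm:
  assumes d: "\<And>D. D \<in> diagrams n \<Longrightarrow> sp_char D id = of_nat (d D)"
  defines "rho \<equiv> \<lambda>g. (if g = id then fact n else 0) - (\<Sum>D\<in>diagrams n. of_nat (d D) * sp_char D g)"
  shows "(\<Sum>g\<in>Sym n. rho g * rho g) = fact n * (fact n - of_nat (\<Sum>D\<in>diagrams n. d D * d D))"
proof -
  define u :: galg where "u = (\<lambda>g. if g = id then fact n else 0)"
  define v where "v = (\<lambda>g. \<Sum>D\<in>diagrams n. of_nat (d D) * sp_char D g)"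
  let ?S = "of_nat (\<Sum>D\<in>diagrams n. d D * d D) :: complex"
  have uu: "(\<Sum>g\<in>Sym n. u g * u g) = fact n * fact n"
    by (simp add: u_def if_distrib[of "\<lambda>c. c * _"] if_distrib[of "\<lambda>c. _ * c"] cong: if_cong)
  have "v id = ?S" by (simp add: v_def d)
  then have uv: "(\<Sum>g\<in>Sym n. u g * v g) = fact n * ?S"
    by (simp add: u_def if_distrib[of "\<lambda>c. c * _"] cong: if_cong)
  have "(\<Sum>g\<in>Sym n. v g * v g) =
      (\<Sum>g\<in>Sym n. \<Sum>D\<in>diagrams n. \<Sum>E\<in>diagrams n. of_nat (d D) * of_nat (d E) * (sp_char D g * sp_char E g))"
    by (simp add: v_def sum_product mult_ac)
  also have "\<dots> = (\<Sum>D\<in>diagrams n. \<Sum>g\<in>Sym n. \<Sum>E\<in>diagrams n. of_nat (d D) * of_nat (d E) * (sp_char D g * sp_char E g))"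
    by (rule sum.swap)
  also have "\<dots> = (\<Sum>D\<in>diagrams n. \<Sum>E\<in>diagrams n. \<Sum>g\<in>Sym n. of_nat (d D) * of_nat (d E) * (sp_char D g * sp_char E g))"
    by (intro sum.cong refl sum.swap)
  also have "\<dots> = (\<Sum>D\<in>diagrams n. \<Sum>E\<in>diagrams n. of_nat (d D) * of_nat (d E) * (if D = E then fact n else 0))"
    by (intro sum.cong refl) (simp add: sum_distrib_left[symmetric] sp_char_orthonormal)
  also have "\<dots> = fact n * ?S"
    by (simp add: if_distrib[of "\<lambda>c. _ * c"] sum_distrib_left mult_ac cong: if_cong)
  finally have vv: "(\<Sum>g\<in>Sym n. v g * v g) = fact n * ?S" .
  have "(\<Sum>g\<in>Sym n. rho g * rho g) = (\<Sum>g\<in>Sym n. u g * u g - 2 * (u g * v g) + v g * v g)"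
  proof (intro sum.cong refl)
    fix g
    have "rho g = u g - v g" by (simp only: rho_def u_def v_def)
    show "rho g * rho g = u g * u g - 2 * (u g * v g) + v g * v g"
      unfolding \<open>rho g = u g - v g\<close> by (simp add: algebra_simps)
  qed
  also have "\<dots> = (\<Sum>g\<in>Sym n. u g * u g) - 2 * (\<Sum>g\<in>Sym n. u g * v g) + (\<Sum>g\<in>Sym n. v g * v g)"
    by (simp add: sum.distrib sum_subtractf sum_distrib_left)
  finally show ?thesis unfolding uu uv vv by (simp add: algebra_simps)
qed

lemma deviation_real:
  "(if g = id then fact n else 0) - (\<Sum>D\<in>diagrams n. of_nat (d D) * sp_char D g) \<in> (\<real> :: complex set)"
proof -
  have "(fact n :: complex) \<in> \<real>" using Reals_of_real[of "fact n"] by simp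
  then show ?thesis by (intro Reals_diff sum_in_Reals Reals_mult sp_char_real) auto
qed

lemma bessel_dims:
  assumes d: "\<And>D. D \<in> diagrams n \<Longrightarrow> sp_char D id = of_nat (d D)"
  shows "(\<Sum>D\<in>diagrams n. d D * d D) \<le> fact n"
proof -
  define rho :: galg where "rho = (\<lambda>g. (if g = id then fact n else 0) - (\<Sum>D\<in>diagrams n. of_nat (d D) * sp_char D g))"
  have real: "rho g \<in> \<real>" for g using deviation_real[of g n d] by (simp only: rho_def)
  have "rho g * rho g = of_real ((Re (rho g))\<^sup>2)" for g
    using real[of g] by (auto simp: power2_eq_square elim!: Reals_cases)
  then have "of_real (\<Sum>g\<in>Sym n. (Re (rho g))\<^sup>2) = (\<Sum>g\<in>Sym n. rho g * rho g)" by simp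
  also have "\<dots> = of_real (fact n * (fact n - real (\<Sum>D\<in>diagrams n. d D * d D)))"
    using deviation_norm[OF d] by (simp add: rho_def)
  finally have "(\<Sum>g\<in>Sym n. (Re (rho g))\<^sup>2) = fact n * (fact n - real (\<Sum>D\<in>diagrams n. d D * d D))"
    by (simp only: of_real_eq_iff)
  moreover have "(\<Sum>g\<in>Sym n. (Re (rho g))\<^sup>2) \<ge> 0" by (rule sum_nonneg) simp
  ultimately have ge: "0 \<le> fact n * (fact n - real (\<Sum>D\<in>diagrams n. d D * d D))" by (simp only:)
  have pos: "0 \<le> x" if "0 \<le> fact n * x" for x :: real
    using that fact_gt_zero[of n, where 'a = real] by (simp add: zero_le_mult_iff)
  have "real (\<Sum>D\<in>diagrams n. d D * d D) \<le> fact n"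
    by (rule diff_ge_0_iff_ge[THEN iffD1, OF pos[OF ge]])
  also have "fact n = real (fact n)" by simp
  finally show ?thesis by (simp only: of_nat_le_iff)
qed

text \<open>With degrees \<open>nsyt\<close> the deviation has norm 0 by
  \<open>sum_nsyt_squares\<close>, and being real-valued it vanishes.\<close>

lemma regular_character:
  assumes d: "\<And>D. D \<in> diagrams n \<Longrightarrow> sp_char D id = of_nat (nsyt n D)" and g: "g \<in> Sym n"
  shows "(\<Sum>D\<in>diagrams n. of_nat (nsyt n D) * sp_char D g) = (if g = id then fact n else 0)"
proof -
  let ?rho = "\<lambda>g. (if g = id then fact n else 0) - (\<Sum>D\<in>diagrams n. of_nat (nsyt n D) * sp_char D g)"
  have "(\<Sum>g\<in>Sym n. ?rho g * ?rho g) = 0"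
    using deviation_norm[OF d] by (simp only: sum_nsyt_squares) simp
  then have "?rho g = 0"
    by (rule real_square_sum_zero[where x = ?rho, OF deviation_real finite_Sym _ g])
  then show ?thesis by simp
qed

text \<open>Weighting the multiplicities by degrees amounts to pairing the restricted character with
  the regular character of \<open>Sym m\<close>, which picks out its value at the identity.\<close>

lemma branch_coefficients:
  assumes d: "\<And>E. E \<in> diagrams m \<Longrightarrow> sp_char E id = of_nat (nsyt m E)"
    and D: "D \<in> diagrams (Suc m)"
  shows "\<exists>c. (\<forall>E\<in>diagrams m. (\<Sum>k\<in>Sym m. sp_char D k * sp_char E k) = fact m * of_nat (c E) \<and>
      (E \<subseteq> D \<longrightarrow> c E \<ge> 1)) \<and> sp_char D id = of_nat (\<Sum>E\<in>diagrams m. c E * nsyt m E)"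
proof -
  obtain c where c: "\<And>E. E \<in> diagrams m \<Longrightarrow> (\<Sum>k\<in>Sym m. sp_char D k * sp_char E k) = fact m * of_nat (c E)"
    "\<And>E. E \<in> diagrams m \<Longrightarrow> E \<subseteq> D \<Longrightarrow> c E \<ge> 1"
    using sp_char_branch[OF D] by metis
  have "fact m * of_nat (\<Sum>E\<in>diagrams m. c E * nsyt m E) =
      (\<Sum>E\<in>diagrams m. (\<Sum>k\<in>Sym m. sp_char D k * sp_char E k) * of_nat (nsyt m E))"
    unfolding of_nat_sum sum_distrib_left by (intro sum.cong refl) (simp add: c(1))
  also have "\<dots> = (\<Sum>k\<in>Sym m. sp_char D k * (\<Sum>E\<in>diagrams m. of_nat (nsyt m E) * sp_char E k))"
    unfolding sum_distrib_left sum_distrib_right by (subst sum.swap) (simp add: mult_ac)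
  also have "\<dots> = (\<Sum>k\<in>Sym m. sp_char D k * (if k = id then fact m else 0))"
    by (intro sum.cong refl) (simp add: regular_character[OF d])
  also have "\<dots> = fact m * sp_char D id"
    by (simp add: if_distrib[of "\<lambda>c. _ * c"] cong: if_cong)
  finally have "sp_char D id = of_nat (\<Sum>E\<in>diagrams m. c E * nsyt m E)" by simp
  then show ?thesis using c by blast
qed

lemma nsyt_le_weighted:
  assumes "\<And>E. E \<in> diagrams m \<Longrightarrow> E \<subseteq> D \<Longrightarrow> c E \<ge> (1::nat)"
  shows "nsyt (Suc m) D \<le> (\<Sum>E\<in>diagrams m. c E * nsyt m E)"
proof -
  have "nsyt (Suc m) D = (\<Sum>E\<in>diagrams m. (if E \<subseteq> D then 1 else 0) * nsyt m E)"
    by (simp add: if_distrib[of "\<lambda>c. c * _"] sum.inter_filter[symmetric] cong: if_cong)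
  also have "\<dots> \<le> (\<Sum>E\<in>diagrams m. c E * nsyt m E)"
    using assms by (intro sum_mono mult_right_mono) auto
  finally show ?thesis .
qed

text \<open>The induction runs through the regular character: exact degrees at level m determine it
  for \<open>Sym m\<close>, it expresses degrees at level m + 1 by branching multiplicities, and the
  bound on squares leaves no room above \<open>nsyt\<close>.\<close>

lemma sp_char_nsyt:
  "D \<in> diagrams n \<Longrightarrow> sp_char D id = of_nat (nsyt n D)"
proof (induction n arbitrary: D)
  case 0
  obtain d where d: "d \<ge> 1" "sp_char D id = of_nat d" using sp_char_dim[OF 0] by blast
  have "diagrams 0 = {{}}" by (auto simp: diagrams_def young_def)
  then have "d * d \<le> 1" using bessel_dims[of 0 "\<lambda>_. d"] d 0 by auto
  then have "d = 1" using d(1) by (cases d) auto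
  then show ?case using d(2) by (simp only: nsyt.simps)
next
  case (Suc m)
  have "\<exists>d. \<forall>D\<in>diagrams (Suc m). sp_char D id = of_nat (d D) \<and> nsyt (Suc m) D \<le> d D"
  proof (rule bchoice, rule ballI)
    fix D assume D: "D \<in> diagrams (Suc m)"
    obtain c where c: "\<And>E. E \<in> diagrams m \<Longrightarrow> E \<subseteq> D \<Longrightarrow> c E \<ge> 1"
      "sp_char D id = of_nat (\<Sum>E\<in>diagrams m. c E * nsyt m E)"
      using branch_coefficients[OF Suc.IH D] by blast
    show "\<exists>d. sp_char D id = of_nat d \<and> nsyt (Suc m) D \<le> d"
      using c(2) nsyt_le_weighted[of m D c, OF c(1)] by blast
  qed
  then obtain d where d: "\<And>D. D \<in> diagrams (Suc m) \<Longrightarrow> sp_char D id = of_nat (d D)"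
    "\<And>D. D \<in> diagrams (Suc m) \<Longrightarrow> nsyt (Suc m) D \<le> d D" by blast
  have le: "nsyt (Suc m) D * nsyt (Suc m) D \<le> d D * d D" if "D \<in> diagrams (Suc m)" for D
    using d(2)[OF that] by (intro mult_mono) auto
  have "(\<Sum>D\<in>diagrams (Suc m). d D * d D) \<le> (\<Sum>D\<in>diagrams (Suc m). nsyt (Suc m) D * nsyt (Suc m) D)"
    unfolding sum_nsyt_squares by (rule bessel_dims[OF d(1)])
  then have "(\<Sum>D\<in>diagrams (Suc m). nsyt (Suc m) D * nsyt (Suc m) D) = (\<Sum>D\<in>diagrams (Suc m). d D * d D)"
    using sum_mono[OF le] by (rule antisym[rotated])
  then have "nsyt (Suc m) D * nsyt (Suc m) D = d D * d D"
    by (rule sum_mono_inv[OF _ le Suc.prems]) simp_all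
  then have "nsyt (Suc m) D = d D" by (metis power2_eq_square power2_eq_iff_nonneg zero_le)
  then show ?case using d(1)[OF Suc.prems] by (simp only:)
qed

text \<open>The degree is a weighted sum in two ways, with coefficients \<open>c E\<close> and with
  the indicator of \<open>E \<subseteq> D\<close>. The former dominate termwise and the weights are
  nonzero, so they agree.\<close>

lemma sp_char_branching_number:
  assumes D: "D \<in> diagrams (Suc m)" and E: "E \<in> diagrams m"
  shows "(\<Sum>k\<in>Sym m. sp_char D k * sp_char E k) = (if E \<subseteq> D then fact m else 0)"
proof -
  obtain c where c: "\<And>E. E \<in> diagrams m \<Longrightarrow> (\<Sum>k\<in>Sym m. sp_char D k * sp_char E k) = fact m * of_nat (c E)"
    "\<And>E. E \<in> diagrams m \<Longrightarrow> E \<subseteq> D \<Longrightarrow> c E \<ge> 1"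
    "sp_char D id = of_nat (\<Sum>E\<in>diagrams m. c E * nsyt m E)"
    using branch_coefficients[OF sp_char_nsyt D] by blast
  have "nsyt (Suc m) D = (\<Sum>E\<in>diagrams m. c E * nsyt m E)"
    using c(3) sp_char_nsyt[OF D] by (simp only: of_nat_eq_iff)
  moreover have "nsyt (Suc m) D = (\<Sum>E\<in>diagrams m. (if E \<subseteq> D then 1 else 0) * nsyt m E)"
    by (simp add: if_distrib[of "\<lambda>c. c * _"] sum.inter_filter[symmetric] cong: if_cong)
  ultimately have "(\<Sum>E\<in>diagrams m. (if E \<subseteq> D then 1 else 0) * nsyt m E) = (\<Sum>E\<in>diagrams m. c E * nsyt m E)"
    by simp
  moreover have "(if F \<subseteq> D then 1 else 0) * nsyt m F \<le> c F * nsyt m F" if "F \<in> diagrams m" for F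
    using c(2)[OF that] by (intro mult_right_mono) auto
  ultimately have "(if E \<subseteq> D then 1 else 0) * nsyt m E = c E * nsyt m E"
    by (rule sum_mono_inv[OF _ _ E]) simp_all
  moreover have "nsyt m E \<noteq> 0" using sp_char_dim[OF E] sp_char_nsyt[OF E] by (metis not_one_le_zero of_nat_eq_iff)
  ultimately have "c E = (if E \<subseteq> D then 1 else 0)" by simp
  then show ?thesis using c(1)[OF E] by simp
qed

text \<open>The regular character is \<open>fact n\<close> times the unit and a combination of the
  characters. Convolving with \<open>F\<close> multiplies each character by a scalar, which exhibits
  \<open>F\<close> as a combination; orthonormality identifies the coefficients.\<close>

lemma class_function_expansion:
  assumes F: "\<And>h k. h \<in> Sym n \<Longrightarrow> k \<in> Sym n \<Longrightarrow> F (inv h \<circ> k \<circ> h) = F k"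
    and g: "g \<in> Sym n"
  shows "F g = (\<Sum>D\<in>diagrams n. (\<Sum>k\<in>Sym n. F k * sp_char D k) / fact n * sp_char D g)"
proof -
  define G :: galg where "G = (\<lambda>g. if g \<in> Sym n then F g else 0)"
  have G: "G \<in> GA n" by (simp add: G_def GA_def)
  have Gc: "G (inv h \<circ> k \<circ> h) = G k" if "h \<in> Sym n" "k \<in> Sym n" for h k
    using that F by (simp add: G_def comp_in_Sym inv_in_Sym)
  have "\<exists>s. \<forall>D\<in>diagrams n. \<forall>g\<in>Sym n. conv n G (sp_char D) g = s D * sp_char D g"
  proof (rule bchoice, rule ballI)
    fix D assume D: "D \<in> diagrams n"
    show "\<exists>s. \<forall>g\<in>Sym n. conv n G (sp_char D) g = s * sp_char D g"
    proof (rule sp_char_conv_class[OF D G])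
      fix h k assume "h \<in> Sym n" "k \<in> Sym n"
      then show "G (inv h \<circ> k \<circ> h) = G k" by (rule Gc)
    qed
  qed
  then obtain s where s: "\<And>D g. D \<in> diagrams n \<Longrightarrow> g \<in> Sym n \<Longrightarrow> conv n G (sp_char D) g = s D * sp_char D g"
    by blast
  define a where "a D = of_nat (nsyt n D) * s D / fact n" for D
  have exp: "F g = (\<Sum>D\<in>diagrams n. a D * sp_char D g)" if g: "g \<in> Sym n" for g
  proof -
    have "(\<Sum>D\<in>diagrams n. of_nat (nsyt n D) * (s D * sp_char D g)) =
        (\<Sum>D\<in>diagrams n. \<Sum>h\<in>Sym n. G h * (of_nat (nsyt n D) * sp_char D (inv h \<circ> g)))"
      by (intro sum.cong refl) (simp add: s[OF _ g, symmetric] conv_def sum_distrib_left mult_ac)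
    also have "\<dots> = (\<Sum>h\<in>Sym n. G h * (\<Sum>D\<in>diagrams n. of_nat (nsyt n D) * sp_char D (inv h \<circ> g)))"
      by (subst sum.swap) (simp add: sum_distrib_left)
    also have "\<dots> = (\<Sum>h\<in>Sym n. G h * (if h = g then fact n else 0))"
    proof (intro sum.cong refl)
      fix h assume h: "h \<in> Sym n"
      have "inv h \<circ> g = id \<longleftrightarrow> h = g"
        using bij_inv_comp(1)[OF Sym_bij[OF h]] bij_inv_comp(4)[OF Sym_bij[OF h], of g] by (metis comp_id)
      then show "G h * (\<Sum>D\<in>diagrams n. of_nat (nsyt n D) * sp_char D (inv h \<circ> g)) = G h * (if h = g then fact n else 0)"
        using regular_character[OF sp_char_nsyt, of n "inv h \<circ> g"] h g by (simp add: comp_in_Sym inv_in_Sym)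
    qed
    also have "\<dots> = fact n * F g"
      using g by (simp add: if_distrib[of "\<lambda>c. _ * c"] G_def cong: if_cong)
    finally have "F g = (\<Sum>D\<in>diagrams n. of_nat (nsyt n D) * (s D * sp_char D g)) / fact n" by simp
    then show ?thesis by (simp add: a_def sum_divide_distrib mult_ac)
  qed
  have "(\<Sum>k\<in>Sym n. F k * sp_char D k) = fact n * a D" if D: "D \<in> diagrams n" for D
  proof -
    have "(\<Sum>k\<in>Sym n. F k * sp_char D k) = (\<Sum>k\<in>Sym n. \<Sum>E\<in>diagrams n. a E * (sp_char E k * sp_char D k))"
      by (intro sum.cong refl) (simp add: exp sum_distrib_right mult.assoc)
    also have "\<dots> = (\<Sum>E\<in>diagrams n. a E * (if E = D then fact n else 0))"
      by (subst sum.swap) (simp add: sum_distrib_left[symmetric] sp_char_orthonormal D)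
    finally show ?thesis using D by (simp add: if_distrib[of "\<lambda>c. _ * c"] cong: if_cong)
  qed
  then show ?thesis using exp[OF g] by simp
qed

lemma branching_rule:
  assumes D: "D \<in> diagrams (Suc m)" and k: "k \<in> Sym m"
  shows "sp_char D k = (\<Sum>E | E \<in> diagrams m \<and> E \<subseteq> D. sp_char E k)"
proof -
  have "sp_char D k = (\<Sum>E\<in>diagrams m. (\<Sum>k\<in>Sym m. sp_char D k * sp_char E k) / fact m * sp_char E k)"
    
    by (rule class_function_expansion[where F = "sp_char D", OF _ k])
      (rule sp_char_class[OF D], simp_all add: Sym_mono[of m "Suc m"])
  also have "\<dots> = (\<Sum>E\<in>diagrams m. if E \<subseteq> D then sp_char E k else 0)"
    by (intro sum.cong refl) (simp add: sp_char_branching_number[OF D])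
  finally show ?thesis by (simp add: sum.inter_filter)
qed

section \<open>Multiplication by the permutation character\<close>

definition fixpoints :: "nat \<Rightarrow> (nat \<Rightarrow> nat) \<Rightarrow> nat" where
  "fixpoints n g = card {i. i < n \<and> g i = i}"

lemma fixpoints_class:
  assumes h: "h \<in> Sym n" shows "fixpoints n (inv h \<circ> k \<circ> h) = fixpoints n k"
  unfolding fixpoints_def
proof (rule bij_betw_same_card[of h], rule bij_betw_imageI)
  have b: "bij h" by (rule Sym_bij[OF h])
  show "inj_on h {i. i < n \<and> (inv h \<circ> k \<circ> h) i = i}" using b by (meson bij_is_inj inj_on_subset subset_UNIV)
  have fp: "(inv h \<circ> k \<circ> h) i = i \<longleftrightarrow> k (h i) = h i" for i using bij_inv_eq_iff[OF b, of i "k (h i)"] by auto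
  show "h ` {i. i < n \<and> (inv h \<circ> k \<circ> h) i = i} = {i. i < n \<and> k i = i}"
  proof (intro equalityI subsetI)
    fix j assume j: "j \<in> {i. i < n \<and> k i = i}"
    then have "h (inv h j) = j" "inv h j < n" using b Sym_lt[OF inv_in_Sym[OF h]]
      by (auto simp: bij_is_surj surj_f_inv_f)
    then show "j \<in> h ` {i. i < n \<and> (inv h \<circ> k \<circ> h) i = i}"
      using j fp[of "inv h j"] by (intro image_eqI[of _ _ "inv h j"]) auto
  qed (use fp Sym_lt[OF h] in auto)
qed

text \<open>Pairs of a permutation and a fixed point \<open>i\<close> are counted. Conjugation by
  the transposition of \<open>i\<close> and \<open>m\<close> identifies the stabilizer of
  \<open>i\<close> with \<open>Sym m\<close> and leaves \<open>F\<close> unchanged. This is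
  Frobenius reciprocity for the permutation character.\<close>

lemma sum_fixpoints:
  fixes F :: galg
  assumes F: "\<And>h k. h \<in> Sym (Suc m) \<Longrightarrow> k \<in> Sym (Suc m) \<Longrightarrow> F (inv h \<circ> k \<circ> h) = F k"
  shows "(\<Sum>g\<in>Sym (Suc m). of_nat (fixpoints (Suc m) g) * F g) = of_nat (Suc m) * (\<Sum>g\<in>Sym m. F g)"
proof -
  let ?n = "Suc m"
  have "(\<Sum>g\<in>Sym ?n. of_nat (fixpoints ?n g) * F g) = (\<Sum>g\<in>Sym ?n. \<Sum>i | i \<in> {..<?n} \<and> g i = i. F g)"
    by (simp add: fixpoints_def)
  also have "\<dots> = (\<Sum>i<?n. \<Sum>g | g \<in> Sym ?n \<and> g i = i. F g)"
    by (rule sum.swap_restrict) simp_all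
  also have "\<dots> = (\<Sum>i<?n. \<Sum>g\<in>Sym m. F g)"
  proof (rule sum.cong[OF refl])
    fix i assume "i \<in> {..<?n}"
    then have t: "transpose i m \<in> Sym ?n" by (simp add: transpose_in_Sym)
    let ?t = "transpose i m"
    have ti: "inv ?t = ?t" by simp
    show "(\<Sum>g | g \<in> Sym ?n \<and> g i = i. F g) = (\<Sum>g\<in>Sym m. F g)"
    proof (rule sum.reindex_bij_witness[of _ "\<lambda>g. ?t \<circ> g \<circ> ?t" "\<lambda>g. ?t \<circ> g \<circ> ?t"])
      fix g assume g: "g \<in> {g \<in> Sym ?n. g i = i}"
      show "?t \<circ> (?t \<circ> g \<circ> ?t) \<circ> ?t = g" by (simp add: fun_eq_iff)
      show "?t \<circ> g \<circ> ?t \<in> Sym m" by (rule Sym_Suc_fix) (use g t in \<open>auto simp: comp_in_Sym\<close>)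
      show "F (?t \<circ> g \<circ> ?t) = F g" using F[OF t, of g] g by (simp add: ti)
    next
      fix g assume g: "g \<in> Sym m"
      show "?t \<circ> (?t \<circ> g \<circ> ?t) \<circ> ?t = g" by (simp add: fun_eq_iff)
      have "g m = m" by (rule Sym_fix[OF g])
      then show "?t \<circ> g \<circ> ?t \<in> {g \<in> Sym ?n. g i = i}" using t Sym_mono[of m ?n g] g by (simp add: comp_in_Sym)
    qed
  qed
  finally show ?thesis by simp
qed

text \<open>The coefficient at \<open>E\<close> is the inner product of the restrictions of both
  characters to \<open>Sym m\<close>; by the branching rule it counts the diagrams below
  both.\<close>

lemma fixpoints_times_char:
  assumes D: "D \<in> diagrams (Suc m)" and g: "g \<in> Sym (Suc m)"
  shows "of_nat (fixpoints (Suc m) g) * sp_char D g =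
    (\<Sum>E\<in>diagrams (Suc m). of_nat (card {F \<in> diagrams m. F \<subseteq> D \<and> F \<subseteq> E}) * sp_char E g)"
proof -
  let ?n = "Suc m" and ?F = "\<lambda>g. of_nat (fixpoints (Suc m) g) * sp_char D g"
  have coeff: "(\<Sum>k\<in>Sym ?n. ?F k * sp_char E k) = fact ?n * of_nat (card {F \<in> diagrams m. F \<subseteq> D \<and> F \<subseteq> E})"
    if E: "E \<in> diagrams ?n" for E
  proof -
    have "(\<Sum>k\<in>Sym ?n. ?F k * sp_char E k) = (\<Sum>k\<in>Sym ?n. of_nat (fixpoints ?n k) * (sp_char D k * sp_char E k))"
      by (simp add: mult.assoc)
    also have "\<dots> = of_nat ?n * (\<Sum>k\<in>Sym m. sp_char D k * sp_char E k)"
      by (rule sum_fixpoints) (simp add: sp_char_class[OF D] sp_char_class[OF E])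
    also have "(\<Sum>k\<in>Sym m. sp_char D k * sp_char E k) =
        (\<Sum>k\<in>Sym m. \<Sum>F | F \<in> diagrams m \<and> F \<subseteq> D. sp_char E k * sp_char F k)"
      by (intro sum.cong refl) (simp add: branching_rule[OF D] sum_distrib_left mult.commute)
    also have "\<dots> = (\<Sum>F | F \<in> diagrams m \<and> F \<subseteq> D. if F \<subseteq> E then fact m else 0)"
      by (subst sum.swap) (simp add: sp_char_branching_number[OF E])
    also have "\<dots> = fact m * of_nat (card {F \<in> diagrams m. F \<subseteq> D \<and> F \<subseteq> E})"
      by (simp add: sum.inter_filter[symmetric] conj_assoc mult.commute)
    finally show ?thesis by (simp add: algebra_simps)
  qed
  have "?F g = (\<Sum>E\<in>diagrams ?n. (\<Sum>k\<in>Sym ?n. ?F k * sp_char E k) / fact ?n * sp_char E g)"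
    by (rule class_function_expansion[where F = ?F, OF _ g]) (simp only: fixpoints_class sp_char_class[OF D])
  also have "\<dots> = (\<Sum>E\<in>diagrams ?n. of_nat (card {F \<in> diagrams m. F \<subseteq> D \<and> F \<subseteq> E}) * sp_char E g)"
    by (intro sum.cong refl) (simp only: coeff, simp del: fact_Suc)
  finally show ?thesis .
qed

text \<open>In a single row the column group is trivial, so the symmetrizer is the sum of all
  permutations and \<open>kappa\<close> is \<open>fact n\<close>.\<close>

lemma sp_char_row:
  assumes g: "g \<in> Sym n"
  shows "sp_char ({0} \<times> {..<n}) g = 1"
proof -
  have T: "tableau n ({0} \<times> {..<n}) (Pair 0)"
    by (auto simp: tableau_def young_def bij_betw_def inj_on_def)
  have col: "colG n (Pair 0) = {id}"
    by (auto simp: colG_def Sym_def permutes_def fun_eq_iff) (metis not_less_iff_gr_or_eq)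
  have y: "ysym n (Pair 0) g = 1" if g: "g \<in> Sym n" for g
  proof -
    have "ysym n (Pair 0) g = (\<Sum>h\<in>Sym n. if h = g then 1 else 0)"
      unfolding ysym_def conv_def
    proof (intro sum.cong refl)
      fix h assume h: "h \<in> Sym n"
      have "inv h \<circ> g = id \<longleftrightarrow> h = g"
        using bij_inv_comp(1)[OF Sym_bij[OF h]] bij_inv_comp(4)[OF Sym_bij[OF h], of g] by (metis comp_id)
      then show "rowel n (Pair 0) h * colel n (Pair 0) (inv h \<circ> g) = (if h = g then 1 else 0)"
        using h bij_inv_comp(1)[OF Sym_bij[OF h]] by (auto simp: rowel_def rowG_def colel_def col sign_id)
    qed
    then show ?thesis using g by simp
  qed
  have "kappa n (Pair 0) = fact n"
    unfolding kappa_def conv_def by (simp add: y inv_in_Sym card_Sym)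
  then have "chi n (Pair 0) g = 1"
    unfolding chi_def cl_def idem_def cscale_def using g by (simp add: y comp_in_Sym inv_in_Sym card_Sym)
  then show ?thesis using sp_char_eq[OF T g] by simp
qed

section \<open>Partitions, diagrams and the canonical tableau\<close>

lemma ferrers_Sigma: "ferrers lam = Sigma {..<length lam} (\<lambda>i. {..<lam ! i})"
  by (auto simp: ferrers_def)

lemma card_ferrers: "card (ferrers lam) = sum_list lam"
  by (simp add: ferrers_Sigma sum_list_sum_nth atLeast0LessThan)

lemma partition_nth_mono:
  assumes "is_partition n lam" "i \<le> k" "k < length lam" shows "lam ! k \<le> lam ! i"
  using assms sorted_wrt_nth_less[of "(\<ge>)" lam i k] by (cases "i = k") (auto simp: is_partition_def)

lemma partition_nth_pos: "is_partition n lam \<Longrightarrow> k < length lam \<Longrightarrow> 0 < lam ! k"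
  by (simp add: is_partition_def)

lemma ferrers_diagram:
  assumes "is_partition n lam" shows "ferrers lam \<in> diagrams n"
proof -
  have "young (ferrers lam)"
    unfolding young_def
  proof (intro conjI allI impI)
    show "finite (ferrers lam)" by (simp add: ferrers_Sigma)
    fix i j i' j' assume "(i, j) \<in> ferrers lam" "i' \<le> i" "j' \<le> j"
    then show "(i', j') \<in> ferrers lam"
      using partition_nth_mono[OF assms, of i' i] by (auto simp: ferrers_def)
  qed
  then show ?thesis using assms by (simp add: diagrams_def card_ferrers is_partition_def)
qed

lemma inj_ferrers: "inj_on ferrers {lam. is_partition n lam}"
proof (rule inj_onI)
  fix lam mu assume p: "lam \<in> {lam. is_partition n lam}" "mu \<in> {lam. is_partition n lam}"
    and eq: "ferrers lam = ferrers mu"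
  have mem: "i < length lam \<and> j < lam ! i \<longleftrightarrow> i < length mu \<and> j < mu ! i" for i j
    using eqset_imp_iff[OF eq, of "(i, j)"] by (simp add: ferrers_def)
  have len: "i < length lam \<longleftrightarrow> i < length mu" for i
    using mem[of i 0] p partition_nth_pos[of n lam i] partition_nth_pos[of n mu i] by auto
  then have l: "length lam = length mu" by (metis linorder_neqE_nat less_irrefl)
  show "lam = mu"
  proof (rule nth_equalityI[OF l])
    fix i assume "i < length lam"
    then have "j < lam ! i \<longleftrightarrow> j < mu ! i" for j using mem[of i j] len[of i] by simp
    then show "lam ! i = mu ! i" by (metis linorder_neqE_nat less_irrefl)
  qed
qed

lemma ferrers_surj:
  assumes D: "D \<in> diagrams n" shows "\<exists>lam. is_partition n lam \<and> ferrers lam = D"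
proof -
  have Y: "young D" by (rule diagramsD(1)[OF D])
  define k where "k = card {a. (a, 0) \<in> D}"
  define lam where "lam = map (rowlen D) [0..<k]"
  have k: "0 < rowlen D i \<longleftrightarrow> i < k" for i
    using eqset_imp_iff[OF young_column[OF Y, of 0], of i] by (simp add: k_def mem_rowlen[OF Y])
  have f: "ferrers lam = D"
  proof (rule set_eqI)
    fix x :: "nat \<times> nat"
    obtain i j where x: "x = (i, j)" by (cases x)
    have "j < rowlen D i \<Longrightarrow> i < k" using k[of i] by simp
    then show "x \<in> ferrers lam \<longleftrightarrow> x \<in> D"
      by (auto simp: x ferrers_def lam_def mem_rowlen[OF Y])
  qed
  have "sorted_wrt (\<ge>) lam"
    using rowlen_antimono[OF Y] by (auto simp: sorted_wrt_iff_nth_less lam_def)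
  moreover have "\<forall>x\<in>set lam. 0 < x" using k by (auto simp: lam_def)
  moreover have "sum_list lam = n" using card_ferrers[of lam] f diagramsD(2)[OF D] by simp
  ultimately show ?thesis using f by (auto simp: is_partition_def)
qed

lemma bij_ferrers: "bij_betw ferrers {lam. is_partition n lam} (diagrams n)"
  unfolding bij_betw_def
proof (intro conjI inj_ferrers equalityI subsetI)
  fix D assume "D \<in> diagrams n"
  then show "D \<in> ferrers ` {lam. is_partition n lam}" using ferrers_surj by blast
qed (auto intro: ferrers_diagram)

lemma finite_partitions [simp]: "finite {lam. is_partition n lam}"
  using bij_betw_finite[OF bij_ferrers] by simp

lemma sum_partitions: "(\<Sum>mu | is_partition n mu. f (ferrers mu)) = (\<Sum>D\<in>diagrams n. f D)"
  by (rule sum.reindex_bij_betw[OF bij_ferrers])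

section \<open>Agreement with the definitions by lists\<close>

definition can_pos :: "nat list \<Rightarrow> nat \<Rightarrow> nat \<times> nat" where
  "can_pos lam = inv_into (ferrers lam) (tableau_entry lam)"

text \<open>Row \<open>i\<close> receives the entries from \<open>sum_list (take i lam)\<close> up
  to the next partial sum. These intervals are disjoint, and counting cells gives
  surjectivity.\<close>

lemma tableau_entry_bij: "bij_betw (tableau_entry lam) (ferrers lam) {..<sum_list lam}"
proof -
  have mono: "sum_list (take i lam) \<le> sum_list (take i' lam)" if "i \<le> i'" for i i'
  proof -
    have "take i' lam = take i lam @ take (i' - i) (drop i lam)" using that by (metis le_add_diff_inverse take_add)
    then show ?thesis by simp
  qed
  have lt: "tableau_entry lam (i, j) < sum_list (take i' lam)" if "(i, j) \<in> ferrers lam" "i < i'" for i j i'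
  proof -
    have "tableau_entry lam (i, j) < sum_list (take (Suc i) lam)"
      using that by (simp add: tableau_entry_def ferrers_def take_Suc_conv_app_nth)
    also have "\<dots> \<le> sum_list (take i' lam)" using that by (intro mono) simp
    finally show ?thesis .
  qed
  have ge: "sum_list (take i lam) \<le> tableau_entry lam (i, j)" for i j by (simp add: tableau_entry_def)
  have inj: "inj_on (tableau_entry lam) (ferrers lam)"
  proof (rule inj_onI)
    fix x y assume xy: "x \<in> ferrers lam" "y \<in> ferrers lam" "tableau_entry lam x = tableau_entry lam y"
    obtain i j i' j' where e: "x = (i, j)" "y = (i', j')" by (metis surj_pair)
    have a: "(i, j) \<in> ferrers lam" "(i', j') \<in> ferrers lam"
      and eq: "tableau_entry lam (i, j) = tableau_entry lam (i', j')"
      using xy e by auto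
    have "i = i'"
    proof (rule ccontr)
      assume "i \<noteq> i'"
      then consider "i < i'" | "i' < i" by linarith
      then show False
        using lt[OF a(1), of i'] lt[OF a(2), of i] ge[of i j] ge[of i' j'] eq by cases simp_all
    qed
    then show "x = y" using eq e by (simp add: tableau_entry_def)
  qed
  have "tableau_entry lam ` ferrers lam \<subseteq> {..<sum_list lam}"
  proof (rule image_subsetI)
    fix x assume x: "x \<in> ferrers lam"
    obtain i j where e: "x = (i, j)" by (cases x)
    have "tableau_entry lam (i, j) < sum_list (take (length lam) lam)"
      by (rule lt) (use x e in \<open>auto simp: ferrers_def\<close>)
    then show "tableau_entry lam x \<in> {..<sum_list lam}" by (simp add: e)
  qed
  then have "tableau_entry lam ` ferrers lam = {..<sum_list lam}"
    by (rule card_subset_eq[rotated]) (simp_all add: card_image[OF inj] card_ferrers)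
  then show ?thesis using inj by (simp add: bij_betw_def)
qed

lemma can_tableau:
  assumes "is_partition n lam" shows "tableau n (ferrers lam) (can_pos lam)"
  using bij_betw_inv_into[OF tableau_entry_bij[of lam]] diagramsD(1)[OF ferrers_diagram[OF assms]] assms
  by (simp add: tableau_def can_pos_def is_partition_def)

text \<open>With \<open>fst\<close> or \<open>snd\<close> for \<open>f\<close>, this turns the entry
  sets of rows and columns into level sets of a labelling of the letters.\<close>

lemma tableau_entry_fiber:
  "tableau_entry lam ` {c \<in> ferrers lam. f c = i} = {x. x < sum_list lam \<and> f (can_pos lam x) = i}"
proof -
  have b: "bij_betw (tableau_entry lam) (ferrers lam) {..<sum_list lam}" by (rule tableau_entry_bij)
  have inj: "can_pos lam (tableau_entry lam c) = c" if "c \<in> ferrers lam" for c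
    using b that by (simp add: can_pos_def bij_betw_def inv_into_f_f)
  have lt: "tableau_entry lam c < sum_list lam" if "c \<in> ferrers lam" for c
    using bij_betwE[OF b] that by auto
  have surj: "can_pos lam x \<in> ferrers lam" "tableau_entry lam (can_pos lam x) = x" if "x < sum_list lam" for x
    using b that unfolding can_pos_def bij_betw_def by (auto intro: inv_into_into f_inv_into_f)
  show ?thesis
  proof (intro equalityI subsetI)
    fix x assume "x \<in> {x. x < sum_list lam \<and> f (can_pos lam x) = i}"
    then show "x \<in> tableau_entry lam ` {c \<in> ferrers lam. f c = i}"
      using surj[of x] by (intro image_eqI[of _ _ "can_pos lam x"]) auto
  qed (use inj lt in auto)
qed

lemma stab_image:
  assumes p: "p \<in> Sym n"
  shows "(\<forall>i. p ` {x. x < n \<and> f x = i} = {x. x < n \<and> f x = i}) \<longleftrightarrow> (\<forall>x<n. f (p x) = f x)"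
proof
  assume L: "\<forall>i. p ` {x. x < n \<and> f x = i} = {x. x < n \<and> f x = i}"
  show "\<forall>x<n. f (p x) = f x"
  proof (intro allI impI)
    fix x assume "x < n"
    then have "p x \<in> p ` {y. y < n \<and> f y = f x}" by auto
    then show "f (p x) = f x" using L by auto
  qed
next
  assume R: "\<forall>x<n. f (p x) = f x"
  show "\<forall>i. p ` {x. x < n \<and> f x = i} = {x. x < n \<and> f x = i}"
  proof
    fix i
    have "inj_on p {x. x < n \<and> f x = i}" using bij_is_inj[OF Sym_bij[OF p]] by (rule inj_on_subset) simp
    then show "p ` {x. x < n \<and> f x = i} = {x. x < n \<and> f x = i}"
      by (intro endo_inj_surj) (use R Sym_lt[OF p] in auto)
  qed
qed

lemma row_group_eq: "row_group lam = rowG (sum_list lam) (can_pos lam)"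
  unfolding row_group_def rowG_def Let_def tableau_entry_fiber
  using stab_image[of _ "sum_list lam" "\<lambda>x. fst (can_pos lam x)"] by (auto simp: Sym_def)

lemma column_group_eq: "column_group lam = colG (sum_list lam) (can_pos lam)"
  unfolding column_group_def colG_def Let_def tableau_entry_fiber
  using stab_image[of _ "sum_list lam" "\<lambda>x. snd (can_pos lam x)"] by (auto simp: Sym_def)

lemma young_symmetrizer_eq: "young_symmetrizer lam = ysym (sum_list lam) (can_pos lam)"
proof
  fix g
  let ?n = "sum_list lam" and ?p = "can_pos lam"
  have fin: "finite (colG ?n ?p)" by (rule finite_subset[OF _ finite_Sym[of ?n]]) (auto simp: colG_def)
  have "young_symmetrizer lam g = (\<Sum>p\<in>rowG ?n ?p. colel ?n ?p (inv p \<circ> g))"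
    unfolding young_symmetrizer_def row_group_eq column_group_eq
  proof (intro sum.cong refl)
    fix p assume p: "p \<in> rowG ?n ?p"
    \<comment> \<open>For given \<open>p\<close> only \<open>q = inv p \<circ> g\<close> can
      contribute, which turns the double sum into a convolution.\<close>
    have eq: "g = p \<circ> q \<longleftrightarrow> inv p \<circ> g = q" for q
      using bij_inv_comp(3,4)[OF Sym_bij[OF rowG_Sym[OF p]]] by metis
    have "(\<Sum>q\<in>colG ?n ?p. if g = p \<circ> q then of_int (sign q) else 0) =
        (\<Sum>q\<in>colG ?n ?p. if inv p \<circ> g = q then of_int (sign q) else (0 :: complex))"
      unfolding eq ..
    also have "\<dots> = colel ?n ?p (inv p \<circ> g)" using fin by (simp add: colel_def)
    finally show "(\<Sum>q\<in>colG ?n ?p. if g = p \<circ> q then of_int (sign q) else 0) = colel ?n ?p (inv p \<circ> g)" .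
  qed
  also have "\<dots> = (\<Sum>p\<in>{h \<in> Sym ?n. h \<in> rowG ?n ?p}. colel ?n ?p (inv p \<circ> g))" by (simp only: rowG_filter)
  also have "\<dots> = ysym ?n ?p g"
    unfolding ysym_def conv_def by (subst sum.inter_filter) (auto simp: rowel_def intro!: sum.cong)
  finally show "young_symmetrizer lam g = ysym ?n ?p g" .
qed

text \<open>Rescaling the generator by a nonzero scalar does not change the ideal, and the trace
  formula asks for an idempotent generator.\<close>

lemma irr_module_eq:
  assumes lam: "is_partition n lam"
  shows "irr_module lam = cfun.span ((\<lambda>g. left_mult g (idem n (can_pos lam))) ` Sym n)"
proof -
  let ?y = "ysym n (can_pos lam)" and ?e = "idem n (can_pos lam)" and ?k = "kappa n (can_pos lam)"
  have n: "sum_list lam = n" using lam by (simp add: is_partition_def)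
  have k: "?k \<noteq> 0" by (rule kappa_nonzero[OF can_tableau[OF lam]])
  have e: "left_mult g ?e = cscale (1 / ?k) (left_mult g ?y)" for g
    by (simp add: idem_def left_mult_def cscale_def)
  have y: "left_mult g ?y = cscale ?k (left_mult g ?e)" for g
    unfolding e using k by simp
  have "irr_module lam = cfun.span ((\<lambda>g. left_mult g ?y) ` Sym n)"
    unfolding irr_module_def young_symmetrizer_eq n by (rule arg_cong[of _ _ cfun.span]) (auto simp: Sym_def)
  also have "\<dots> = cfun.span ((\<lambda>g. left_mult g ?e) ` Sym n)"
    unfolding cfun.span_eq
  proof (intro conjI subsetI)
    fix x assume "x \<in> (\<lambda>g. left_mult g ?y) ` Sym n"
    then obtain g where "g \<in> Sym n" "x = cscale ?k (left_mult g ?e)" unfolding y by blast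
    then show "x \<in> cfun.span ((\<lambda>g. left_mult g ?e) ` Sym n)" by (auto intro: cfun.span_scale cfun.span_base)
  next
    fix x assume "x \<in> (\<lambda>g. left_mult g ?e) ` Sym n"
    then obtain g where "g \<in> Sym n" "x = cscale (1 / ?k) (left_mult g ?y)" unfolding e by blast
    then show "x \<in> cfun.span ((\<lambda>g. left_mult g ?y) ` Sym n)" by (auto intro: cfun.span_scale cfun.span_base)
  qed
  finally show ?thesis .
qed

text \<open>The trace on the ideal is the class average at \<open>inv g\<close>;
  \<open>chi_inv\<close> removes the inversion.\<close>

lemma irr_char_eq:
  assumes lam: "is_partition n lam" and g: "g \<in> Sym n"
  shows "irr_char lam g = sp_char (ferrers lam) g"
proof -
  have T: "tableau n (ferrers lam) (can_pos lam)" by (rule can_tableau[OF lam])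
  have "irr_char lam g = chi n (can_pos lam) (inv g)"
    unfolding irr_char_def irr_module_eq[OF lam] chi_def
    by (rule trace_left_ideal[OF g idem_GA idem_square[OF T]])
  then show ?thesis using chi_inv[OF g] sp_char_eq[OF T g] by simp
qed

section \<open>Counting Kronecker tableaux\<close>

text \<open>For shapes of equal size: the matrix of removing a cell and adding one, which will be
  the matrix of multiplication by the number of fixed points.\<close>

definition common_down :: "nat list \<Rightarrow> nat list \<Rightarrow> nat" where
  "common_down lam nu =
    card {F. young F \<and> Suc (card F) = sum_list lam \<and> F \<subseteq> ferrers lam \<and> F \<subseteq> ferrers nu}"

lemma corners_eq: "corners lam = outer_corners (ferrers lam)"
  by (simp add: corners_def outer_corners_def)

text \<open>Among the rows of maximal length only the topmost ends in a corner. The admissible marks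
  are thus one fewer than the corners.\<close>

lemma first_corner_unique:
  assumes lam: "is_partition n lam" and "0 < n"
  shows "card {c. is_first_corner lam c} = 1"
proof -
  have "lam \<noteq> []" using assms by (auto simp: is_partition_def)
  then have len: "0 < length lam" by simp
  let ?S = "{i. i < length lam \<and> lam ! i = lam ! 0}"
  \<comment> \<open>The last row as long as row 0; the row above it, if any, is strictly shorter, so
    row \<open>k\<close> ends in a corner.\<close>
  define k where "k = Max ?S"
  have "k \<in> ?S" unfolding k_def using len by (intro Max_in) auto
  then have k: "k < length lam" "lam ! k = lam ! 0" by auto
  have kmax: "i \<le> k" if "i < length lam" "lam ! i = lam ! 0" for i
    unfolding k_def using that by (intro Max_ge) auto
  have top: "lam ! i \<le> lam ! 0" if "i < length lam" for i
    using partition_nth_mono[OF lam _ that, of 0] by simp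
  have pos: "0 < lam ! k" by (rule partition_nth_pos[OF lam k(1)])
  have "\<not> (Suc k < length lam \<and> lam ! k - 1 < lam ! Suc k)"
  proof
    assume a: "Suc k < length lam \<and> lam ! k - 1 < lam ! Suc k"
    then have "lam ! Suc k = lam ! 0" using top[of "Suc k"] k(2) by linarith
    then show False using kmax[of "Suc k"] a by simp
  qed
  then have "is_first_corner lam (k, lam ! k - 1)"
    using k pos top by (auto simp: is_first_corner_def corners_def ferrers_def)
  moreover have "c = (k, lam ! k - 1)" if c: "is_first_corner lam c" for c
  proof -
    obtain i j where ij: "c = (i, j)" by (cases c)
    have i: "i < length lam" "j < lam ! i" "\<not> Suc j < lam ! i" and n: "\<not> (Suc i < length lam \<and> j < lam ! Suc i)"
      and m: "\<forall>a<length lam. lam ! a \<le> lam ! i"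
      using c by (auto simp: ij is_first_corner_def corners_def ferrers_def)
    have e: "lam ! i = lam ! 0" using m len top[OF i(1)] by (simp add: le_antisym)
    have "i = k"
    proof (rule ccontr)
      assume "i \<noteq> k"
      then have "Suc i \<le> k" using kmax[OF i(1) e] by simp
      then have "lam ! k \<le> lam ! Suc i" "Suc i < length lam" using partition_nth_mono[OF lam _ k(1)] k(1) by auto
      then show False using n i e k(2) by simp
    qed
    then show ?thesis using i ij by simp
  qed
  ultimately have "{c. is_first_corner lam c} = {(k, lam ! k - 1)}" by blast
  then show ?thesis by simp
qed

lemma partition_eq_iff:
  "is_partition n lam \<Longrightarrow> is_partition n nu \<Longrightarrow> ferrers lam = ferrers nu \<longleftrightarrow> lam = nu"
  using inj_ferrers[of n] by (auto simp: inj_on_def)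

text \<open>Moving a corner passes through the diagram left after the removal. Conversely, a common
  subdiagram with one cell fewer names both the removed and the added corner.\<close>

lemma differs_iff:
  assumes lam: "is_partition n lam" and nu: "is_partition n nu" and ne: "lam \<noteq> nu"
  shows "differs_by_corner lam nu \<longleftrightarrow>
    (\<exists>F. young F \<and> Suc (card F) = n \<and> F \<subseteq> ferrers lam \<and> F \<subseteq> ferrers nu)"
proof -
  note D = diagramsD[OF ferrers_diagram[OF lam]] and E = diagramsD[OF ferrers_diagram[OF nu]]
  show ?thesis
  proof
    assume "differs_by_corner lam nu"
    then obtain c c' where c: "c \<in> corners lam" "c' \<in> corners nu" "c' \<notin> ferrers lam - {c}"
      "ferrers nu = insert c' (ferrers lam - {c})"
      by (auto simp: differs_by_corner_def)
    then have cD: "c \<in> ferrers lam" by (auto simp: corners_def)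
    have "young (ferrers lam - {c})" using young_remove[OF D(1) cD] c(1) by (simp add: corners_eq)
    moreover have "Suc (card (ferrers lam - {c})) = n" using card_Suc_Diff1[OF D(3) cD] D(2) by simp
    ultimately show "\<exists>F. young F \<and> Suc (card F) = n \<and> F \<subseteq> ferrers lam \<and> F \<subseteq> ferrers nu"
      using c(4) by blast
  next
    assume "\<exists>F. young F \<and> Suc (card F) = n \<and> F \<subseteq> ferrers lam \<and> F \<subseteq> ferrers nu"
    then obtain F where F: "young F" "Suc (card F) = n" "F \<subseteq> ferrers lam" "F \<subseteq> ferrers nu" by blast
    have corner: "\<exists>c\<in>outer_corners G. F = G - {c}" if G: "young G" "card G = n" "F \<subseteq> G" for G
    proof -
      have "F \<in> {F. young F \<and> Suc (card F) = card G \<and> F \<subseteq> G}" using F G by simp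
      then show ?thesis unfolding down_eq[OF G(1)] by blast
    qed
    obtain c where c: "c \<in> corners lam" "F = ferrers lam - {c}"
      using corner[OF D(1,2) F(3)] by (auto simp: corners_eq)
    obtain c' where c': "c' \<in> corners nu" "F = ferrers nu - {c'}"
      using corner[OF E(1,2) F(4)] by (auto simp: corners_eq)
    have "c' \<in> ferrers nu" using c'(1) by (auto simp: corners_def)
    then have "c' \<notin> ferrers lam - {c}" "ferrers nu = insert c' (ferrers lam - {c})"
      using c(2) c'(2) by auto
    then show "differs_by_corner lam nu"
      using c(1) c'(1) ne unfolding differs_by_corner_def by blast
  qed
qed

text \<open>The step matrix is \<open>common_down\<close> minus the identity. On the diagonal,
  subdiagrams correspond to corners and the first corner is not allowed as a mark; off the diagonal
  the intersection is the only candidate and \<open>None\<close> the only mark.\<close>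

lemma card_steps:
  assumes lam: "is_partition n lam" and nu: "is_partition n nu" and n: "0 < n"
  shows "finite {e. kronecker_step lam e nu}"
    and "card {e. kronecker_step lam e nu} + (if lam = nu then 1 else 0) = common_down lam nu"
proof -
  note D = diagramsD[OF ferrers_diagram[OF lam]] and E = diagramsD[OF ferrers_diagram[OF nu]]
  have sum: "sum_list lam = n" using lam by (simp add: is_partition_def)
  have "finite {e. kronecker_step lam e nu} \<and>
    card {e. kronecker_step lam e nu} + (if lam = nu then 1 else 0) = common_down lam nu"
  proof (cases "lam = nu")
    case True
    have fin: "finite (corners lam)" by (rule finite_subset[OF _ D(3)]) (auto simp: corners_def)
    have sub: "{c. is_first_corner lam c} \<subseteq> corners lam" by (auto simp: is_first_corner_def)
    have steps: "{e. kronecker_step lam e nu} = Some ` (corners lam - {c. is_first_corner lam c})"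
    proof (rule set_eqI)
      fix e
      show "e \<in> {e. kronecker_step lam e nu} \<longleftrightarrow> e \<in> Some ` (corners lam - {c. is_first_corner lam c})"
        using True by (cases e) (auto simp: kronecker_step_def differs_by_corner_def)
    qed
    have "card (corners lam - {c. is_first_corner lam c}) + 1 = card (corners lam)"
      using card_Diff_subset[OF finite_subset[OF sub fin] sub] card_mono[OF fin sub]
        first_corner_unique[OF lam n] by simp
    then have "card {e. kronecker_step lam e nu} + 1 = card (corners lam)"
      unfolding steps by (simp add: card_image)
    also have "\<dots> = common_down lam nu"
      using card_down[OF D(1)] True by (simp add: common_down_def corners_eq card_ferrers)
    finally show ?thesis using True fin steps by simp
  next
    case False
    have steps: "{e. kronecker_step lam e nu} = (if differs_by_corner lam nu then {None} else {})"
    proof (rule set_eqI)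
      fix e
      show "e \<in> {e. kronecker_step lam e nu} \<longleftrightarrow> e \<in> (if differs_by_corner lam nu then {None} else {})"
        using False by (cases e) (auto simp: kronecker_step_def)
    qed
    let ?F = "{F. young F \<and> Suc (card F) = n \<and> F \<subseteq> ferrers lam \<and> F \<subseteq> ferrers nu}"
    have "F = ferrers lam \<inter> ferrers nu" if F: "F \<in> ?F" for F
    proof (rule card_seteq)
      have "ferrers lam \<noteq> ferrers nu" using partition_eq_iff[OF lam nu] False by simp
      then have "ferrers lam \<inter> ferrers nu \<subset> ferrers lam"
        using card_subset_eq[OF E(3), of "ferrers lam"] D(2) E(2) by auto
      then have "card (ferrers lam \<inter> ferrers nu) < n" using psubset_card_mono[OF D(3)] unfolding D(2) by blast
      then show "card (ferrers lam \<inter> ferrers nu) \<le> card F" using F by auto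
    qed (use F D(3) in auto)
    then have "?F \<subseteq> {ferrers lam \<inter> ferrers nu}" by (intro subsetI singleton_iff[THEN iffD2])
    then have "?F = {} \<or> ?F = {ferrers lam \<inter> ferrers nu}" by (rule subset_singletonD)
    then have "card ?F = (if ?F = {} then 0 else 1)"
    proof
      assume e: "?F = {ferrers lam \<inter> ferrers nu}"
      show ?thesis unfolding e by simp
    next
      assume e: "?F = {}"
      show ?thesis unfolding e by simp
    qed
    then have "common_down lam nu = (if ?F = {} then 0 else 1)"
      unfolding common_down_def sum .
    also have "\<dots> = (if differs_by_corner lam nu then 1 else 0)"
      unfolding differs_iff[OF lam nu False] Collect_empty_eq by (cases "\<exists>F. F \<in> ?F") auto
    finally have "common_down lam nu = (if differs_by_corner lam nu then 1 else 0)" .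
    then show ?thesis using False steps by simp
  qed
  then show "finite {e. kronecker_step lam e nu}"
    "card {e. kronecker_step lam e nu} + (if lam = nu then 1 else 0) = common_down lam nu" by auto
qed

section \<open>Recursion on the length of a Kronecker tableau\<close>

lemma kronecker_tableaux_0:
  assumes "is_partition (sum_list mu) mu"
  shows "kronecker_tableaux 0 mu lam = (if lam = mu then {([mu], [])} else {})"
  using assms by (auto simp: kronecker_tableaux_def length_Suc_conv)

text \<open>The last step is split off. The index \<open>lam\<close> repeats the last entry of
  \<open>s\<close>, so that the cardinality becomes a sum over shapes.\<close>

lemma kronecker_tableaux_Suc:
  assumes mu: "sum_list mu = n" and nu: "is_partition n nu"
  shows "kronecker_tableaux (Suc k) mu nu =
    (\<lambda>(lam, (s, d), e). (s @ [nu], d @ [e])) `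
      (SIGMA lam:{lam. is_partition n lam}. kronecker_tableaux k mu lam \<times> {e. kronecker_step lam e nu})"
    (is "?L = ?f ` ?R")
proof (intro equalityI subsetI)
  fix x assume x: "x \<in> ?L"
  obtain s' d' where sd': "x = (s', d')" by (cases x)
  have L: "length s' = Suc (Suc k)" "length d' = Suc k" "s' ! 0 = mu" "s' ! Suc k = nu"
    "\<And>i. i \<le> Suc k \<Longrightarrow> is_partition n (s' ! i)" "\<And>i. i < Suc k \<Longrightarrow> kronecker_step (s' ! i) (d' ! i) (s' ! Suc i)"
    using x mu by (auto simp: sd' kronecker_tableaux_def)
  define s d where "s = butlast s'" and "d = butlast d'"
  have s: "s' = s @ [nu]" "length s = Suc k"
    using L(1,4) append_butlast_last_id[of s'] by (cases "s' = []"; auto simp: s_def last_conv_nth)+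
  have d: "d' = d @ [d' ! k]" "length d = k"
    using L(2) append_butlast_last_id[of d'] by (cases "d' = []"; auto simp: d_def last_conv_nth)+
  have si: "s' ! i = s ! i" if "i \<le> k" for i using s that by (simp add: nth_append)
  have di: "d' ! i = d ! i" if "i < k" for i using d that by (metis nth_append)
  have "(s, d) \<in> kronecker_tableaux k mu (s ! k)"
    unfolding kronecker_tableaux_def
  proof (simp add: s(2) d(2) mu, intro conjI allI impI)
    show "s ! 0 = mu" using L(3) si[of 0] by simp
    show "is_partition n (s ! i)" if "i \<le> k" for i using L(5)[of i] si[OF that] that by simp
    show "kronecker_step (s ! i) (d ! i) (s ! Suc i)" if "i < k" for i
      using L(6)[of i] si[of i] si[of "Suc i"] di[OF that] that by simp
  qed
  moreover have "is_partition n (s ! k)" using L(5)[of k] si[of k] by simp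
  moreover have "kronecker_step (s ! k) (d' ! k) nu" using L(6)[of k] L(4) si[of k] by simp
  ultimately show "x \<in> ?f ` ?R"
    using s(1) d(1) by (intro image_eqI[of _ _ "(s ! k, (s, d), d' ! k)"]) (auto simp: sd')
next
  fix x assume "x \<in> ?f ` ?R"
  then obtain lam s d e where x: "x = (s @ [nu], d @ [e])" and R: "(s, d) \<in> kronecker_tableaux k mu lam"
    "kronecker_step lam e nu" by auto
  have K: "length s = Suc k" "length d = k" "s ! 0 = mu" "s ! k = lam"
    "\<And>i. i \<le> k \<Longrightarrow> is_partition n (s ! i)" "\<And>i. i < k \<Longrightarrow> kronecker_step (s ! i) (d ! i) (s ! Suc i)"
    using R mu by (auto simp: kronecker_tableaux_def)
  have shapes: "\<forall>i\<le>Suc k. is_partition n ((s @ [nu]) ! i)"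
    using K(1,5) nu by (auto simp: nth_append le_Suc_eq)
  have steps: "kronecker_step ((s @ [nu]) ! i) ((d @ [e]) ! i) ((s @ [nu]) ! Suc i)" if "i < Suc k" for i
    using K R(2) that by (cases "i = k") (auto simp: nth_append)
  show "x \<in> ?L"
    unfolding kronecker_tableaux_def x mu mem_Collect_eq prod.case
    using shapes steps K(1-3) by (auto simp: nth_append)
qed

lemma card_kronecker_tableaux_Suc:
  assumes mu: "is_partition n mu" and nu: "is_partition n nu" and n: "0 < n"
    and fin: "\<And>lam. is_partition n lam \<Longrightarrow> finite (kronecker_tableaux k mu lam)"
  shows "finite (kronecker_tableaux (Suc k) mu nu)"
    and "card (kronecker_tableaux (Suc k) mu nu) =
      (\<Sum>lam | is_partition n lam. card (kronecker_tableaux k mu lam) * card {e. kronecker_step lam e nu})"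
proof -
  let ?R = "SIGMA lam:{lam. is_partition n lam}. kronecker_tableaux k mu lam \<times> {e. kronecker_step lam e nu}"
  have sum: "sum_list mu = n" using mu by (simp add: is_partition_def)
  have finR: "finite ?R" by (intro finite_SigmaI finite_cartesian_product) (auto intro: fin card_steps(1)[OF _ nu n])
  then show "finite (kronecker_tableaux (Suc k) mu nu)"
    unfolding kronecker_tableaux_Suc[OF sum nu] by (rule finite_imageI)
  have "inj_on (\<lambda>(lam, (s, d), e). (s @ [nu], d @ [e])) ?R"
    by (rule inj_onI) (auto simp: kronecker_tableaux_def)
  then have "card (kronecker_tableaux (Suc k) mu nu) = card ?R"
    unfolding kronecker_tableaux_Suc[OF sum nu] by (rule card_image)
  also have "\<dots> = (\<Sum>lam | is_partition n lam. card (kronecker_tableaux k mu lam \<times> {e. kronecker_step lam e nu}))"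
    by (rule card_SigmaI) (auto intro: fin card_steps(1)[OF _ nu n])
  finally show "card (kronecker_tableaux (Suc k) mu nu) =
      (\<Sum>lam | is_partition n lam. card (kronecker_tableaux k mu lam) * card {e. kronecker_step lam e nu})"
    by (simp add: card_cartesian_product)
qed

lemma fixpoints_times_irr_char:
  assumes lam: "is_partition n lam" and n: "0 < n" and g: "g \<in> Sym n"
  shows "of_nat (fixpoints n g) * irr_char lam g =
    (\<Sum>nu | is_partition n nu. of_nat (common_down lam nu) * irr_char nu g)"
proof -
  obtain m where m: "n = Suc m" using n by (cases n) auto
  have sum: "sum_list lam = n" using lam by (simp add: is_partition_def)
  have "of_nat (fixpoints n g) * irr_char lam g = of_nat (fixpoints n g) * sp_char (ferrers lam) g"
    by (simp add: irr_char_eq[OF lam g])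
  also have "\<dots> = (\<Sum>E\<in>diagrams n. of_nat (card {F \<in> diagrams m. F \<subseteq> ferrers lam \<and> F \<subseteq> E}) * sp_char E g)"
    using fixpoints_times_char[of "ferrers lam" m g] ferrers_diagram[OF lam] g by (simp only: m)
  also have "\<dots> = (\<Sum>nu | is_partition n nu. of_nat (card {F \<in> diagrams m. F \<subseteq> ferrers lam \<and> F \<subseteq> ferrers nu}) * sp_char (ferrers nu) g)"
    by (rule sum_partitions[symmetric])
  also have "\<dots> = (\<Sum>nu | is_partition n nu. of_nat (common_down lam nu) * irr_char nu g)"
  proof (intro sum.cong refl)
    fix nu assume "nu \<in> {nu. is_partition n nu}"
    then have e: "irr_char nu g = sp_char (ferrers nu) g" using irr_char_eq[OF _ g] by simp
    have "{F \<in> diagrams m. F \<subseteq> ferrers lam \<and> F \<subseteq> ferrers nu} =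
        {F. young F \<and> Suc (card F) = n \<and> F \<subseteq> ferrers lam \<and> F \<subseteq> ferrers nu}"
      by (auto simp: diagrams_def m)
    then show "of_nat (card {F \<in> diagrams m. F \<subseteq> ferrers lam \<and> F \<subseteq> ferrers nu}) * sp_char (ferrers nu) g =
        of_nat (common_down lam nu) * irr_char nu g"
      by (simp only: e common_down_def sum)
  qed
  finally show ?thesis .
qed

lemma is_partition_row: "0 < n \<Longrightarrow> is_partition n [n]"
  by (simp add: is_partition_def)

lemma irr_char_row:
  assumes "0 < n" "g \<in> Sym n" shows "irr_char [n] g = 1"
proof -
  have "ferrers [n] = {0} \<times> {..<n}" by (auto simp: ferrers_def)
  then show ?thesis using irr_char_eq[OF is_partition_row[OF assms(1)] assms(2)] sp_char_row[OF assms(2)] by simp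
qed

text \<open>Below a single row lies only the row shorter by one, and a diagram of size n containing
  it has one cell left to place, in row 0 or in row 1.\<close>

lemma common_down_row:
  assumes n: "n \<ge> 2" and nu: "is_partition n nu"
  shows "common_down [n] nu = (if nu = [n] \<or> nu = [n - 1, 1] then 1 else 0)"
proof -
  let ?E = "{0} \<times> {..<n - 1} :: (nat \<times> nat) set"
  have eq: "F = ?E" if F: "young F" "Suc (card F) = n" "F \<subseteq> ferrers [n]" for F
  proof -
    have row: "F = Pair 0 ` {j. (0, j) \<in> F}" using F(3) by (auto simp: ferrers_def)
    have "card F = card (Pair (0::nat) ` {j. (0, j) \<in> F})" using row by (rule arg_cong[where f = card])
    then have "card F = card {j. (0, j) \<in> F}" by (simp add: card_image inj_on_def)
    then have "rowlen F 0 = n - 1" using F(2) by (simp add: rowlen_def)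
    then have "{j. (0, j) \<in> F} = {..<n - 1}" by (auto simp: mem_rowlen[OF F(1)])
    then show ?thesis using row by auto
  qed
  have E: "young ?E" "?E \<subseteq> ferrers [n]" "Suc (card ?E) = n" using n by (auto simp: young_def ferrers_def)
  have "{F. young F \<and> Suc (card F) = n \<and> F \<subseteq> ferrers [n] \<and> F \<subseteq> ferrers nu} =
      (if ?E \<subseteq> ferrers nu then {?E} else {})"
  proof (rule set_eqI)
    fix F
    show "F \<in> {F. young F \<and> Suc (card F) = n \<and> F \<subseteq> ferrers [n] \<and> F \<subseteq> ferrers nu} \<longleftrightarrow>
        F \<in> (if ?E \<subseteq> ferrers nu then {?E} else {})"
      using eq[of F] E by (cases "F = ?E") auto
  qed
  then have 1: "common_down [n] nu = (if ?E \<subseteq> ferrers nu then 1 else 0)"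
    by (simp add: common_down_def)
  have "?E \<subseteq> ferrers nu \<longleftrightarrow> nu = [n] \<or> nu = [n - 1, 1]"
  proof
    assume E: "?E \<subseteq> ferrers nu"
    \<comment> \<open>The last cell of the shorter row, which exists as n \<ge> 2; it forces the
      first part to be at least n - 1.\<close>
    have "(0, n - 2) \<in> ?E" using n by auto
    then have "(0, n - 2) \<in> ferrers nu" using E by blast
    then obtain x r where xr: "nu = x # r" "n - 2 < x" by (cases nu) (auto simp: ferrers_def)
    have p: "\<forall>y\<in>set r. 0 < y" "x + sum_list r = n" using nu xr by (auto simp: is_partition_def)
    show "nu = [n] \<or> nu = [n - 1, 1]"
    proof (cases r)
      case Nil
      then show ?thesis using p xr by simp
    next
      case (Cons y r')
      then have "0 < y" "y + sum_list r' \<le> 1" using p xr n by auto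
      then have "y = 1" "sum_list r' = 0" by linarith+
      moreover have "r' = []" using \<open>sum_list r' = 0\<close> p(1) Cons by (cases r') auto
      ultimately show ?thesis using Cons xr p by simp
    qed
  next
    assume "nu = [n] \<or> nu = [n - 1, 1]"
    then show "?E \<subseteq> ferrers nu" by (auto simp: ferrers_def)
  qed
  then show ?thesis using 1 by simp
qed

text \<open>The number of fixed points is its own product with the trivial character, and the
  one-row shape has two neighbours, itself and \<open>[n - 1, 1]\<close>.\<close>

lemma standard_char:
  assumes n: "n \<ge> 2" and g: "g \<in> Sym n"
  shows "of_nat (fixpoints n g) = 1 + irr_char [n - 1, 1] g"
proof -
  have p: "is_partition n [n]" "is_partition n [n - 1, 1]" using n by (auto simp: is_partition_def)
  have ne: "[n] \<noteq> [n - 1, 1]" by simp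
  have "of_nat (fixpoints n g) = of_nat (fixpoints n g) * irr_char [n] g"
    using n g by (simp add: irr_char_row)
  also have "\<dots> = (\<Sum>nu | is_partition n nu. of_nat (common_down [n] nu) * irr_char nu g)"
    by (rule fixpoints_times_irr_char[OF p(1) _ g]) (use n in simp)
  also have "\<dots> = (\<Sum>nu | is_partition n nu. if nu = [n] \<or> nu = [n - 1, 1] then irr_char nu g else 0)"
    by (intro sum.cong refl) (simp add: common_down_row[OF n])
  also have "\<dots> = (\<Sum>nu\<in>{nu \<in> {nu. is_partition n nu}. nu = [n] \<or> nu = [n - 1, 1]}. irr_char nu g)"
    by (rule sum.inter_filter[symmetric]) simp
  also have "{nu \<in> {nu. is_partition n nu}. nu = [n] \<or> nu = [n - 1, 1]} = {[n], [n - 1, 1]}" using p by auto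
  also have "(\<Sum>nu\<in>{[n], [n - 1, 1]}. irr_char nu g) = 1 + irr_char [n - 1, 1] g"
    using ne n g by (simp add: irr_char_row)
  finally show ?thesis .
qed

text \<open>Finiteness travels with the induction because the cardinality of the recursive
  description is computed from finite pieces. At k = 0 the empty product is the trivial character,
  and only the shape \<open>[n]\<close> is reached.\<close>

lemma kronecker_power_expansion:
  assumes n: "n \<ge> 2"
  shows "(\<forall>nu. is_partition n nu \<longrightarrow> finite (kronecker_tableaux k [n] nu)) \<and>
    (\<forall>g\<in>Sym n. irr_char [n - 1, 1] g ^ k =
      (\<Sum>nu | is_partition n nu. of_nat (card (kronecker_tableaux k [n] nu)) * irr_char nu g))"
proof (induction k)
  case 0
  have p: "is_partition (sum_list [n]) [n]" "is_partition n [n]" using n by (auto simp: is_partition_def)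
  have "(\<Sum>nu | is_partition n nu. of_nat (card (kronecker_tableaux 0 [n] nu)) * irr_char nu g) = 1"
    if g: "g \<in> Sym n" for g
  proof -
    have "(\<Sum>nu | is_partition n nu. of_nat (card (kronecker_tableaux 0 [n] nu)) * irr_char nu g) =
        (\<Sum>nu | is_partition n nu. if nu = [n] then irr_char nu g else 0)"
      by (intro sum.cong refl) (simp add: kronecker_tableaux_0[OF p(1)])
    also have "\<dots> = 1" using p n g by (simp add: irr_char_row)
    finally show ?thesis .
  qed
  then show ?case by (simp add: kronecker_tableaux_0[OF p(1)])
next
  case (Suc k)
  let ?P = "{nu. is_partition n nu}" and ?c = "\<lambda>k nu. card (kronecker_tableaux k [n] nu)"
  have n0: "0 < n" and p: "is_partition n [n]" using n by (auto simp: is_partition_def)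
  have fin: "\<And>lam. is_partition n lam \<Longrightarrow> finite (kronecker_tableaux k [n] lam)" using Suc.IH by blast
  have "irr_char [n - 1, 1] g ^ Suc k = (\<Sum>nu\<in>?P. of_nat (?c (Suc k) nu) * irr_char nu g)"
    if g: "g \<in> Sym n" for g
  proof -
    \<comment> \<open>This subtraction of 1 becomes the subtracted identity in
      \<open>card_steps\<close>.\<close>
    have X: "irr_char [n - 1, 1] g = of_nat (fixpoints n g) - 1"
      using standard_char[OF n g] by simp
    have step: "irr_char [n - 1, 1] g * irr_char lam g =
        (\<Sum>nu\<in>?P. of_nat (card {e. kronecker_step lam e nu}) * irr_char nu g)"
      if lam: "lam \<in> ?P" for lam
    proof -
      have lam': "is_partition n lam" using lam by simp
      have "irr_char [n - 1, 1] g * irr_char lam g = of_nat (fixpoints n g) * irr_char lam g - irr_char lam g"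
        unfolding X by (simp add: algebra_simps)
      also have "\<dots> = (\<Sum>nu\<in>?P. of_nat (common_down lam nu) * irr_char nu g) -
          (\<Sum>nu\<in>?P. if lam = nu then irr_char nu g else 0)"
        using lam by (simp add: fixpoints_times_irr_char[OF lam' n0 g])
      also have "\<dots> = (\<Sum>nu\<in>?P. of_nat (card {e. kronecker_step lam e nu}) * irr_char nu g)"
        unfolding sum_subtractf[symmetric]
      proof (intro sum.cong refl)
        fix nu assume "nu \<in> ?P"
        then have "is_partition n nu" by simp
        from card_steps(2)[OF lam' this n0, symmetric]
        show "of_nat (common_down lam nu) * irr_char nu g - (if lam = nu then irr_char nu g else 0) =
            of_nat (card {e. kronecker_step lam e nu}) * irr_char nu g"
          by (simp add: algebra_simps)
      qed
      finally show ?thesis .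
    qed
    have "irr_char [n - 1, 1] g ^ Suc k = irr_char [n - 1, 1] g * (\<Sum>lam\<in>?P. of_nat (?c k lam) * irr_char lam g)"
      using Suc.IH g by simp
    also have "\<dots> = (\<Sum>lam\<in>?P. of_nat (?c k lam) * (irr_char [n - 1, 1] g * irr_char lam g))"
      by (simp add: sum_distrib_left mult_ac)
    also have "\<dots> = (\<Sum>lam\<in>?P. \<Sum>nu\<in>?P. of_nat (?c k lam * card {e. kronecker_step lam e nu}) * irr_char nu g)"
    proof (intro sum.cong refl)
      fix lam assume l: "lam \<in> ?P"
      show "of_nat (?c k lam) * (irr_char [n - 1, 1] g * irr_char lam g) =
          (\<Sum>nu\<in>?P. of_nat (?c k lam * card {e. kronecker_step lam e nu}) * irr_char nu g)"
        unfolding step[OF l] by (simp add: sum_distrib_left mult.assoc)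
    qed
    also have "\<dots> = (\<Sum>nu\<in>?P. \<Sum>lam\<in>?P. of_nat (?c k lam * card {e. kronecker_step lam e nu}) * irr_char nu g)"
      by (rule sum.swap)
    also have "\<dots> = (\<Sum>nu\<in>?P. of_nat (?c (Suc k) nu) * irr_char nu g)"
      by (intro sum.cong refl)
        (simp add: card_kronecker_tableaux_Suc(2)[OF p _ n0 fin] sum_distrib_right)
    finally show ?thesis .
  qed
  then show ?case using card_kronecker_tableaux_Suc(1)[OF p _ n0 fin] by blast
qed

text \<open>Orthonormality recovers each coefficient from \<open>X\<close> alone, so the description
  in \<open>char_multiplicity\<close> singles out one number.\<close>

lemma irr_char_coefficient:
  assumes lam: "is_partition n lam"
    and X: "\<And>g. g \<in> Sym n \<Longrightarrow> X g = (\<Sum>mu | is_partition n mu. of_nat (a mu) * irr_char mu g)"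
  shows "(\<Sum>g\<in>Sym n. X g * irr_char lam g) = fact n * of_nat (a lam)"
proof -
  have "(\<Sum>g\<in>Sym n. X g * irr_char lam g) =
      (\<Sum>g\<in>Sym n. \<Sum>mu | is_partition n mu. of_nat (a mu) * (sp_char (ferrers mu) g * sp_char (ferrers lam) g))"
    by (intro sum.cong refl) (simp add: X irr_char_eq[OF lam] irr_char_eq[of n] sum_distrib_right mult.assoc)
  also have "\<dots> = (\<Sum>mu | is_partition n mu. of_nat (a mu) * (if mu = lam then fact n else 0))"
  proof (subst sum.swap, intro sum.cong refl)
    fix mu assume "mu \<in> {mu. is_partition n mu}"
    then have mu: "is_partition n mu" by simp
    show "(\<Sum>g\<in>Sym n. of_nat (a mu) * (sp_char (ferrers mu) g * sp_char (ferrers lam) g)) =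
        of_nat (a mu) * (if mu = lam then fact n else 0)"
      unfolding sum_distrib_left[symmetric] sp_char_orthonormal[OF ferrers_diagram[OF mu] ferrers_diagram[OF lam]]
      using partition_eq_iff[OF mu lam] by simp
  qed
  finally show ?thesis using lam by (simp add: if_distrib[of "\<lambda>c. _ * c"] cong: if_cong)
qed

theorem proposition1:
  fixes k n :: nat and lam :: "nat list"
  assumes "k \<ge> 1" and "n \<ge> 2" and "is_partition n lam"
  shows "char_multiplicity n (kronecker_power (irr_char [n - 1, 1]) k) lam
           = card (kronecker_tableaux k [n] lam)"
proof -
  let ?X = "kronecker_power (irr_char [n - 1, 1]) k"
  define t where "t mu = card (kronecker_tableaux k [n] mu)" for mu
  have t: "?X g = (\<Sum>mu | is_partition n mu. of_nat (t mu) * irr_char mu g)" if "g \<in> Sym n" for g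
    using kronecker_power_expansion[OF assms(2), of k] that by (simp add: kronecker_power_def t_def)
  show ?thesis
    unfolding char_multiplicity_def t_def[symmetric]
  proof (rule the_equality)
    show "\<exists>a. a lam = t lam \<and> (\<forall>g. g permutes {..<n} \<longrightarrow> ?X g = (\<Sum>mu | is_partition n mu. of_nat (a mu) * irr_char mu g))"
      using t by (intro exI[of _ t]) (simp add: Sym_def)
  next
    fix m assume "\<exists>a. a lam = m \<and> (\<forall>g. g permutes {..<n} \<longrightarrow> ?X g = (\<Sum>mu | is_partition n mu. of_nat (a mu) * irr_char mu g))"
    then obtain a where a: "a lam = m" "\<And>g. g \<in> Sym n \<Longrightarrow> ?X g = (\<Sum>mu | is_partition n mu. of_nat (a mu) * irr_char mu g)"
      by (auto simp: Sym_def)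
    have "fact n * complex_of_nat m = fact n * of_nat (t lam)"
      using irr_char_coefficient[OF assms(3), of ?X a, OF a(2)] irr_char_coefficient[OF assms(3), of ?X t, OF t] a(1)
      by simp
    then show "m = t lam" by simp
  qed
qed

end
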